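(* Let $G(V,E)$ be a finite connected graph (loops and multiple edges allowed, $|E|\ge 1$) with all edges of length $1$, each edge $e_j$ parametrized by $x\in(0,1)$ (which gives an orientation on $G$), and let $q_j\in L^1(0,1)$ be a real-valued potential on $e_j$ for each $j$. Consider the eigenvalue problem $-y''+q_j(x)y=\lambda y$ on $e_j$ (for all $j$) with standard matching conditions at the vertices. If $\lambda=0$ is the smallest eigenvalue and for infinitely many $k\in\mathbb{Z}^+$ there are $|E|-|V|+2$ eigenvalues (counting multiplicities) such that $\lambda=(2k\pi)^2+o(1)$, then $q_j=0$ a.e. on $(0,1)$ for every $j$. Moreover, if $G$ is bipartite, the same is true for $k$ instead of $2k$: if $\lambda=0$ is the smallest eigenvalue and for infinitely many $k\in\mathbb{Z}^+$ there are $|E|-|V|+2$ eigenvalues (counting multiplicities) such that $\lambda=(k\pi)^2+o(1)$, then $q_j=0$ a.e. on $(0,1)$ for every $j$. Here "for infinitely many $k$ there are $m$ eigenvalues (counting multiplicities) such that $\lambda=\mu_k+o(1)$" means: there are an infinite set $K\subset\mathbb{Z}^+$ and numbers $\varepsilon_k\ge 0$ ($k\in K$) with $\varepsilon_k\to0$ as $k\to\infty$ in $K$, such that for each $k\in K$ at least $m$ eigenvalues, counted with multiplicity, satisfy $|\lambda-\mu_k|\le\varepsilon_k$.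
   Context: Standard matching (Neumann/Kirchhoff) conditions: a function $y=(y_j)_{j}$ on $G$, with $y_j$ defined on $e_j\cong(0,1)$, satisfies (i) continuity: at each vertex $v$ all the boundary values of $y$ at $v$ coincide, i.e. $y_j(\kappa_j)=y_k(\kappa_k)$ whenever $e_j,e_k$ are attached to $v$, where $\kappa=0$ for an edge leaving $v$, $\kappa=1$ for an edge entering $v$ (both $0$ and $1$ occur for a loop); and (ii) for every vertex $v$, $\sum_{e_j\text{ leaves }v}y_j'(0)=\sum_{e_j\text{ enters }v}y_j'(1)$, with loops counted on both sides. Solutions of the differential equation are understood with $y_j,y_j'$ absolutely continuous. An eigenvalue is a $\lambda$ for which there is a nonzero $y$ satisfying the equation on every edge together with (i) and (ii); its multiplicity is the dimension of the space of such $y$. *)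

theory Defs
  imports
    "HOL-Analysis.Analysis"
    "HOL-Library.Function_Algebras"
    "Graph_Theory.Graph_Theory"
begin

text \<open>
  A metric graph with unit edges is a \<^locale>\<open>fin_digraph\<close>: the direction of an arc is the
  direction of its parametrisation by \<open>(0,1)\<close>, so the tail of an arc sits at \<open>x = 0\<close> and its
  head at \<open>x = 1\<close>. Loops and parallel arcs are allowed there.
\<close>

definition bipartite_digraph :: "('v, 'e) pre_digraph \<Rightarrow> bool" where
  "bipartite_digraph G \<longleftrightarrow>
     (\<exists>A B. verts G = A \<union> B \<and> A \<inter> B = {} \<and>
        (\<forall>e\<in>arcs G. (tail G e \<in> A \<and> head G e \<in> B) \<or> (tail G e \<in> B \<and> head G e \<in> A)))"

text \<open>
  Absolute continuity on \<open>[a,b]\<close> in the usual \<open>\<epsilon>\<close>-\<open>\<delta>\<close> form. The finite families of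
  non-overlapping subintervals are given by the divisions of subsets of \<open>[a,b]\<close>; a member \<open>k\<close>
  is the interval from \<open>Inf k\<close> to \<open>Sup k\<close>.
\<close>

definition absolutely_continuous_on_interval :: "(real \<Rightarrow> real) \<Rightarrow> real \<Rightarrow> real \<Rightarrow> bool" where
  "absolutely_continuous_on_interval f a b \<longleftrightarrow>
     (\<forall>\<epsilon>>0. \<exists>\<delta>>0. \<forall>D S. D division_of S \<and> S \<subseteq> {a..b} \<and> (\<Sum>k\<in>D. Sup k - Inf k) < \<delta> \<longrightarrow>
        (\<Sum>k\<in>D. \<bar>f (Sup k) - f (Inf k)\<bar>) < \<epsilon>)"

definition edge_deriv :: "(real \<Rightarrow> real) \<Rightarrow> real \<Rightarrow> real" where
  "edge_deriv f x = vector_derivative f (at x within {0..1})"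

text \<open>
  Solutions of \<open>-f'' + q f = \<lambda> f\<close> with \<open>f\<close> and \<open>f'\<close> absolutely continuous. Such functions on
  \<open>(0,1)\<close> extend to \<open>C\<^sup>1\<close> functions on \<open>[0,1]\<close>, and it is this extension that is used; the
  boundary derivatives are therefore one-sided derivatives.
\<close>

definition edge_solution :: "(real \<Rightarrow> real) \<Rightarrow> real \<Rightarrow> (real \<Rightarrow> real) \<Rightarrow> bool" where
  "edge_solution q lam f \<longleftrightarrow>
     f differentiable_on {0..1} \<and>
     absolutely_continuous_on_interval f 0 1 \<and>
     absolutely_continuous_on_interval (edge_deriv f) 0 1 \<and>
     (AE x in lebesgue. x \<in> {0<..<1} \<longrightarrow>
        (\<exists>d. (edge_deriv f has_real_derivative d) (at x) \<and> - d + q x * f x = lam * f x))"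

text \<open>The end \<open>\<kappa> \<in> {0, 1}\<close> of the arc \<open>e\<close> is attached to \<open>v\<close>; for a loop both ends are.\<close>

definition attached :: "('v, 'e) pre_digraph \<Rightarrow> 'v \<Rightarrow> 'e \<Rightarrow> real \<Rightarrow> bool" where
  "attached G v e \<kappa> \<longleftrightarrow>
     e \<in> arcs G \<and> (\<kappa> = 0 \<and> tail G e = v \<or> \<kappa> = 1 \<and> head G e = v)"

definition standard_matching :: "('v, 'e) pre_digraph \<Rightarrow> ('e \<Rightarrow> real \<Rightarrow> real) \<Rightarrow> bool" where
  "standard_matching G y \<longleftrightarrow>
     (\<forall>v\<in>verts G. \<forall>e e' \<kappa> \<kappa>'. attached G v e \<kappa> \<and> attached G v e' \<kappa>' \<longrightarrow> y e \<kappa> = y e' \<kappa>') \<and>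
     (\<forall>v\<in>verts G. (\<Sum>e\<in>out_arcs G v. edge_deriv (y e) 0) = (\<Sum>e\<in>in_arcs G v. edge_deriv (y e) 1))"

text \<open>
  Functions on the graph are represented by HOL functions vanishing off the arcs and off
  \<open>[0,1]\<close>. Without this normalisation distinct HOL functions would represent the same function
  on the graph and the eigenspaces would have the wrong dimension.
\<close>

definition eigenspace ::
    "('v, 'e) pre_digraph \<Rightarrow> ('e \<Rightarrow> real \<Rightarrow> real) \<Rightarrow> real \<Rightarrow> ('e \<Rightarrow> real \<Rightarrow> real) set" where
  "eigenspace G q lam =
     {y. (\<forall>e x. e \<notin> arcs G \<or> x \<notin> {0..1} \<longrightarrow> y e x = 0) \<and>
         (\<forall>e\<in>arcs G. edge_solution (q e) lam (y e)) \<and>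
         standard_matching G y}"

definition is_eigenvalue :: "('v, 'e) pre_digraph \<Rightarrow> ('e \<Rightarrow> real \<Rightarrow> real) \<Rightarrow> real \<Rightarrow> bool" where
  "is_eigenvalue G q lam \<longleftrightarrow> (\<exists>y\<in>eigenspace G q lam. y \<noteq> 0)"

definition is_smallest_eigenvalue ::
    "('v, 'e) pre_digraph \<Rightarrow> ('e \<Rightarrow> real \<Rightarrow> real) \<Rightarrow> real \<Rightarrow> bool" where
  "is_smallest_eigenvalue G q lam \<longleftrightarrow>
     is_eigenvalue G q lam \<and> (\<forall>\<mu>. is_eigenvalue G q \<mu> \<longrightarrow> lam \<le> \<mu>)"

definition scale_graph_fun :: "real \<Rightarrow> ('e \<Rightarrow> real \<Rightarrow> real) \<Rightarrow> 'e \<Rightarrow> real \<Rightarrow> real" where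
  "scale_graph_fun c y = (\<lambda>e x. c * y e x)"

interpretation graph_fun: vector_space scale_graph_fun
  by unfold_locales (auto simp: scale_graph_fun_def fun_eq_iff algebra_simps)

text \<open>
  The locale's \<open>dim\<close> is \<open>0\<close> for spaces of infinite dimension; an eigenspace of a finite graph has
  dimension at most twice the number of arcs.
\<close>

definition eigenvalue_multiplicity ::
    "('v, 'e) pre_digraph \<Rightarrow> ('e \<Rightarrow> real \<Rightarrow> real) \<Rightarrow> real \<Rightarrow> nat" where
  "eigenvalue_multiplicity G q lam = graph_fun.dim (eigenspace G q lam)"

text \<open>
  At least \<open>m\<close> eigenvalues, counted with multiplicity, in \<open>[\<mu> - \<epsilon>, \<mu> + \<epsilon>]\<close>. Quantifying over
  finite sets \<open>S\<close> avoids a sum over a set not known to be finite.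
\<close>

definition eigenvalues_within ::
    "('v, 'e) pre_digraph \<Rightarrow> ('e \<Rightarrow> real \<Rightarrow> real) \<Rightarrow> int \<Rightarrow> real \<Rightarrow> real \<Rightarrow> bool" where
  "eigenvalues_within G q m \<mu> \<epsilon> \<longleftrightarrow>
     (\<exists>S. finite S \<and> (\<forall>lam\<in>S. is_eigenvalue G q lam \<and> \<bar>lam - \<mu>\<bar> \<le> \<epsilon>) \<and>
        m \<le> int (\<Sum>lam\<in>S. eigenvalue_multiplicity G q lam))"

text \<open>For infinitely many \<open>k\<close> there are \<open>m\<close> eigenvalues with \<open>\<lambda> = \<mu> k + o(1)\<close>.\<close>

definition infinitely_often_eigenvalues_near ::
    "('v, 'e) pre_digraph \<Rightarrow> ('e \<Rightarrow> real \<Rightarrow> real) \<Rightarrow> int \<Rightarrow> (nat \<Rightarrow> real) \<Rightarrow> bool" where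
  "infinitely_often_eigenvalues_near G q m \<mu> \<longleftrightarrow>
     (\<exists>K \<epsilon>. infinite K \<and> K \<subseteq> {1..} \<and> (\<forall>k\<in>K. 0 \<le> \<epsilon> k) \<and>
        (\<epsilon> \<longlongrightarrow> 0) (inf sequentially (principal K)) \<and>
        (\<forall>k\<in>K. eigenvalues_within G q m (\<mu> k) (\<epsilon> k)))"

end

theory Submission
  imports Defs
begin

text \<open>
  If \<open>0\<close> is the smallest eigenvalue, then the quadratic form obtained by eliminating the edge interiors
  (the Dirichlet-to-Neumann form on vertex functions) is positive definite for every \<open>l < 0\<close>: it is so
  for very negative \<open>l\<close>, and at the first \<open>l < 0\<close> where this fails a null vector would extend to an
  eigenfunction. Testing the form at \<open>l = 0\<close> with the constant vertex function and using, on each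
  edge, the solution \<open>w > 0\<close> with boundary values \<open>1\<close> gives
  \<open>\<Sum>\<integral>q = form(1, 1) + \<Sum>\<integral>(w'/w)\<^sup>2\<close>. Hence \<open>\<Sum>\<integral>q \<ge> 0\<close>, with equality only
  for \<open>q = 0\<close>.

  Conversely, \<open>|E| - |V| + 2\<close> orthonormal eigenfunctions with eigenvalues near \<open>(n \<pi>)\<^sup>2\<close> look like
  \<open>\<alpha> cos(n \<pi> x) + \<beta> sin(n \<pi> x)\<close> on each edge, where in the limit \<open>\<alpha>\<close> is the same on all edges and
  \<open>\<beta>\<close> is a circulation. Green's identity against \<open>cos(n \<pi> x)\<close> and the Riemann-Lebesgue lemma give
  \<open>\<alpha> \<Sum>\<integral>q = 0\<close>. If \<open>\<Sum>\<integral>q\<close> were nonzero, all \<open>\<alpha>\<close> would vanish and there would be \<open>|E| - |V| + 2\<close> orthonormal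
  circulations, one more than the cycle space has room for.
\<close>

section \<open>Absolutely continuous functions\<close>

text \<open>The hypothesis says that a full unperturbed multiplicity survives: for
  \<open>q = 0\<close> the eigenvalue (n \<pi>)^2 carries one cosine mode, if the signs (-1)^n fit
  along all arcs, and a sine copy of the cycle space, of dimension |E| - |V| + 1. The rate o(1)
  matters because Green's identity multiplies the overlap with the cosine by \<lambda> - (n
  \<pi>)^2, and this product has to vanish in the limit. The form has only |V| variables, but it has
  poles at the Dirichlet eigenvalues of the edges. Definiteness is therefore continued in l jointly
  with positivity of the sine solutions. The constant test function also keeps l away from the
  poles: it bounds the form of every edge at (1, 1) from above by \<integral>q - l, so a positive
  total bounds each single edge from below, whereas at the first pole its value would tend to
  -\<infinity>. As q is only integrable, the equation holds almost everywhere; identities are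
  integrated through absolute continuity and solutions are estimated by Gronwall with an L^1
  coefficient.\<close>

abbreviation AC :: "(real \<Rightarrow> real) \<Rightarrow> bool" where
  "AC f \<equiv> absolutely_continuous_on_interval f 0 1"

text \<open>\<open>h\<close> is a derivative almost everywhere only, with unconstrained values on a
  null set and at the ends; absolute continuity is what makes its integral recover
  \<open>f\<close>.\<close>

definition ac_deriv :: "(real \<Rightarrow> real) \<Rightarrow> (real \<Rightarrow> real) \<Rightarrow> bool" where
  "ac_deriv f h \<longleftrightarrow> AC f \<and>
     (\<exists>N. negligible N \<and> (\<forall>x\<in>{0<..<1} - N. (f has_real_derivative h x) (at x)))"

lemma AC_D:
  assumes "AC f" "\<epsilon> > 0"
  obtains \<delta> where "\<delta> > 0" "\<And>D S. D division_of S \<Longrightarrow> S \<subseteq> {0..1} \<Longrightarrow>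
    (\<Sum>k\<in>D. Sup k - Inf k) < \<delta> \<Longrightarrow> (\<Sum>k\<in>D. \<bar>f (Sup k) - f (Inf k)\<bar>) < \<epsilon>"
  using assms unfolding absolutely_continuous_on_interval_def by metis

lemma AC_I:
  assumes "\<And>\<epsilon>. \<epsilon> > 0 \<Longrightarrow> \<exists>\<delta>>0. \<forall>D S. D division_of S \<longrightarrow> S \<subseteq> {0..1} \<longrightarrow>
    (\<Sum>k\<in>D. Sup k - Inf k) < \<delta> \<longrightarrow> (\<Sum>k\<in>D. \<bar>f (Sup k) - f (Inf k)\<bar>) < \<epsilon>"
  shows "AC f"
  using assms unfolding absolutely_continuous_on_interval_def by meson

lemma division_memD:
  fixes D :: "real set set"
  assumes "D division_of S" "S \<subseteq> {0..1}" "k \<in> D"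
  shows "k = {Inf k..Sup k}" "Inf k \<le> Sup k" "0 \<le> Inf k" "Sup k \<le> 1" "k \<noteq> {}" "k \<subseteq> S"
proof -
  obtain a b where "k = cbox a b" using division_ofD(4)[OF assms(1,3)] by blast
  moreover show "k \<noteq> {}" using division_ofD(3)[OF assms(1,3)] .
  ultimately have k: "k = {a..b}" "a \<le> b" by auto
  show "k \<subseteq> S" using division_ofD(2)[OF assms(1,3)] .
  with k assms(2) have "{a..b} \<subseteq> {0..1}" by blast
  with k show "k = {Inf k..Sup k}" "Inf k \<le> Sup k" "0 \<le> Inf k" "Sup k \<le> 1"
    using assms(2) by (simp_all add: atLeastatMost_subset_iff)
qed

lemma AC_continuous_on:
  assumes "AC f"
  shows "continuous_on {0..1} f"
  unfolding continuous_on_iff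
proof (intro ballI allI impI)
  fix x e :: real assume x: "x \<in> {0..1}" and e: "e > 0"
  obtain d where d: "d > 0" "\<And>D S. D division_of S \<Longrightarrow> S \<subseteq> {0..1} \<Longrightarrow>
    (\<Sum>k\<in>D. Sup k - Inf k) < d \<Longrightarrow> (\<Sum>k\<in>D. \<bar>f (Sup k) - f (Inf k)\<bar>) < e"
    using AC_D[OF assms e] by blast
  have key: "\<bar>f v - f u\<bar> < e" if "u \<in> {0..1}" "v \<in> {0..1}" "u \<le> v" "v - u < d" for u v
    using d(2)[of "{{u..v}}" "{u..v}"] division_of_self[of u v] that by simp
  show "\<exists>d>0. \<forall>x'\<in>{0..1}. dist x' x < d \<longrightarrow> dist (f x') (f x) < e"
  proof (intro exI[of _ d] conjI ballI impI d(1))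
    fix y assume "y \<in> {0..1::real}" "dist y x < d"
    then show "dist (f y) (f x) < e"
      using key[of x y] key[of y x] x by (cases "x \<le> y") (auto simp: dist_real_def abs_minus_commute)
  qed
qed

text \<open>Turns a small open neighbourhood of the exceptional null set into a bound on the total
  length of the intervals inside it, the quantity that absolute continuity controls.\<close>

lemma sum_lengths_le_measure:
  fixes D :: "real set set"
  assumes "D division_of S" "S \<subseteq> {0..1}" "S \<subseteq> U" "U \<in> lmeasurable"
  shows "(\<Sum>k\<in>D. Sup k - Inf k) \<le> measure lebesgue U"
proof -
  have "((\<lambda>x. 1::real) has_integral (\<Sum>k\<in>D. Sup k - Inf k)) S"
  proof (rule has_integral_combine_division[OF assms(1)])
    fix k assume k: "k \<in> D"
    have "((\<lambda>x. 1::real) has_integral (Sup k - Inf k)) {Inf k..Sup k}"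
      using has_integral_const_real[of "1::real" "Inf k" "Sup k"] division_memD(2)[OF assms(1,2) k] by simp
    then show "((\<lambda>x. 1::real) has_integral (Sup k - Inf k)) k"
      using division_memD(1)[OF assms(1,2) k] by simp
  qed
  moreover have "S \<in> lmeasurable"
  proof -
    have "compact (\<Union>D)"
    proof (rule compact_Union)
      show "finite D" using assms(1) by (rule division_ofD(1))
      fix k assume "k \<in> D"
      then show "compact k" using division_ofD(4)[OF assms(1)] compact_cbox by metis
    qed
    then show ?thesis
      using division_ofD(6)[OF assms(1)] by (simp add: lmeasurable_compact)
  qed
  ultimately have "(\<Sum>k\<in>D. Sup k - Inf k) = measure lebesgue S"
    by (metis integral_unique lmeasure_integral)
  also have "\<dots> \<le> measure lebesgue U"
    using assms(3,4) \<open>S \<in> lmeasurable\<close> by (meson fmeasurableD measure_mono_fmeasurable)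
  finally show ?thesis .
qed

lemma real_derivative_straddle:
  assumes "(f has_real_derivative d) (at x)" "e > 0"
  obtains r where "r > 0"
    "\<And>u v. u \<le> x \<Longrightarrow> x \<le> v \<Longrightarrow> {u..v} \<subseteq> ball x r \<Longrightarrow> \<bar>d * (v - u) - (f v - f u)\<bar> \<le> e * (v - u)"
proof -
  have "(f has_derivative (\<lambda>h. d * h)) (at x within UNIV)"
    using assms(1) by (simp add: has_field_derivative_def)
  then obtain r where r: "r > 0" "\<And>y. \<bar>y - x\<bar> < r \<Longrightarrow> \<bar>f y - f x - d * (y - x)\<bar> \<le> e * \<bar>y - x\<bar>"
    using assms(2) unfolding has_derivative_within_alt by auto
  show thesis
  proof (rule that[OF r(1)])
    fix u v assume uv: "u \<le> x" "x \<le> v" "{u..v} \<subseteq> ball x r"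
    then have "u \<in> ball x r" "v \<in> ball x r" by (meson atLeastAtMost_iff order_trans order_refl subsetD)+
    then have "\<bar>u - x\<bar> < r" "\<bar>v - x\<bar> < r" by (auto simp: dist_real_def)
    from r(2)[OF this(1)] r(2)[OF this(2)] uv
    have 1: "\<bar>f u - f x - d * (u - x)\<bar> \<le> e * (x - u)" "\<bar>f v - f x - d * (v - x)\<bar> \<le> e * (v - x)"
      by auto
    have 2: "d * (v - u) - (f v - f u) = (f u - f x - d * (u - x)) - (f v - f x - d * (v - x))"
      by (simp add: algebra_simps)
    show "\<bar>d * (v - u) - (f v - f u)\<bar> \<le> e * (v - u)"
      unfolding 2 using 1 by (simp add: algebra_simps abs_le_iff)
  qed
qed

text \<open>Tags in the exceptional null set are controlled by absolute continuity, the others by the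
  straddle lemma; no integrability of the derivative has to be assumed.\<close>

theorem ac_deriv_has_integral:
  assumes "ac_deriv f h" "0 \<le> a" "a \<le> b" "b \<le> 1"
  shows "(h has_integral f b - f a) {a..b}"
proof (cases "a = b")
  case True then show ?thesis by (simp add: has_integral_refl)
next
  case False
  with assms have ab: "a < b" by simp
  have AC: "AC f" using assms by (simp add: ac_deriv_def)
  obtain N0 where N0: "negligible N0" "\<And>x. x \<in> {0<..<1} - N0 \<Longrightarrow> (f has_real_derivative h x) (at x)"
    using assms unfolding ac_deriv_def by blast
  \<comment> \<open>The end points join the exceptional set because they may be 0 or 1, where no
    two-sided derivative is assumed.\<close>
  define N where "N = N0 \<union> {a,b}"
  have N: "negligible N" using N0(1) by (simp add: N_def)
  have der: "(f has_real_derivative h x) (at x)" if "x \<in> {a..b} - N" for x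
    using that assms by (intro N0(2)) (auto simp: N_def)
  \<comment> \<open>With value 0 on \<open>N\<close>, a tag in \<open>N\<close> leaves only the
    increment of \<open>f\<close>, whose size absolute continuity bounds.\<close>
  define h' where "h' x = (if x \<in> N then 0 else h x)" for x
  have "(h' has_integral f b - f a) {a..b}"
    unfolding has_integral_real
  proof (intro allI impI)
    fix e :: real assume e: "e > 0"
    obtain d where d: "d > 0" "\<And>D S. D division_of S \<Longrightarrow> S \<subseteq> {0..1} \<Longrightarrow>
        (\<Sum>k\<in>D. Sup k - Inf k) < d \<Longrightarrow> (\<Sum>k\<in>D. \<bar>f (Sup k) - f (Inf k)\<bar>) < e/2"
      using AC_D[OF AC half_gt_zero[OF e]] by blast
    obtain U where U: "open U" "N \<subseteq> U" "U \<in> lmeasurable" "measure lebesgue U < d"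
    proof -
      obtain U where U: "open U" "N \<subseteq> U" "(U - N) \<in> lmeasurable" "emeasure lebesgue (U - N) < ennreal d"
        using sets_lebesgue_outer_open[OF negligible_imp_sets[OF N] d(1)] by blast
      have U1: "U \<in> lmeasurable"
      proof -
        have "(U - N) \<union> N \<in> lmeasurable"
          using U(3) N by (intro fmeasurable.Un) (auto simp: negligible_iff_measure)
        then show ?thesis using U(2) by (simp add: Un_absorb2)
      qed
      have "measure lebesgue U = measure lebesgue (U - N)"
        using measure_Diff_null_set[of U lebesgue N] N U1 by (auto simp: negligible_iff_null_sets)
      also have "\<dots> < d"
        using U(3,4) by (subst (asm) emeasure_eq_measure2) (auto simp: ennreal_less_iff)
      finally show ?thesis using that U U1 by blast
    qed
    define e' where "e' = e / (2 * (b - a))"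
    have e': "e' > 0" using e ab by (simp add: e'_def)
    have "\<exists>r>0. \<forall>u v. u \<le> x \<longrightarrow> x \<le> v \<longrightarrow> {u..v} \<subseteq> ball x r \<longrightarrow>
        \<bar>h x * (v - u) - (f v - f u)\<bar> \<le> e' * (v - u)" if "x \<in> {a..b} - N" for x
      using real_derivative_straddle[OF der[OF that] e'] by metis
    then obtain r where r: "\<And>x. x \<in> {a..b} - N \<Longrightarrow> r x > 0"
      "\<And>x u v. x \<in> {a..b} - N \<Longrightarrow> u \<le> x \<Longrightarrow> x \<le> v \<Longrightarrow> {u..v} \<subseteq> ball x (r x) \<Longrightarrow>
        \<bar>h x * (v - u) - (f v - f u)\<bar> \<le> e' * (v - u)"
      by metis
    \<comment> \<open>Intervals tagged in \<open>N\<close> are forced into \<open>U\<close>, so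
      their total length is below \<open>d\<close>; the others obey the straddle estimate with total
      error e' (b - a) = e/2.\<close>
    define g where "g x = (if x \<in> N then U else if x \<in> {a..b} then ball x (r x) else UNIV)" for x
    have g: "gauge g"
      unfolding gauge_def g_def using U(1,2) r(1) by auto
    have main: "norm ((\<Sum>(x,k)\<in>D. measure lborel k *\<^sub>R h' x) - (f b - f a)) < e"
      if D: "D tagged_division_of {a..b}" "g fine D" for D
    proof -
      have fin: "finite D" using D(1) by blast
      have sum: "(\<Sum>(x,k)\<in>D. f (Sup k) - f (Inf k)) = f b - f a"
        using additive_tagged_division_1[OF _ D(1), of f] ab by simp
      have mem: "k = {Inf k..Sup k} \<and> Inf k \<le> x \<and> x \<le> Sup k \<and> x \<in> {a..b} \<and> measure lborel k = Sup k - Inf k \<and> k \<subseteq> g x \<and> k \<subseteq> {a..b}"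
        if xk: "(x,k) \<in> D" for x k
      proof -
        obtain u v where "k = cbox u v" using tagged_division_ofD(4)[OF D(1) xk] by blast
        moreover have "x \<in> k" "k \<subseteq> {a..b}" using tagged_division_ofD(2,3)[OF D(1) xk] by auto
        moreover have "k \<subseteq> g x" using D(2) xk by (auto simp: fine_def)
        ultimately show ?thesis by auto
      qed
      define T where "T = (\<lambda>(x,k). measure lborel k * h' x - (f (Sup k) - f (Inf k)))"
      let ?D1 = "{p\<in>D. fst p \<in> N}" and ?D2 = "{p\<in>D. fst p \<notin> N}"
      have "(\<Sum>(x,k)\<in>D. measure lborel k *\<^sub>R h' x) - (f b - f a) = (\<Sum>p\<in>D. T p)"
        unfolding sum[symmetric] T_def by (simp add: sum_subtractf case_prod_unfold)
      also have "\<dots> = (\<Sum>p\<in>?D1. T p) + (\<Sum>p\<in>?D2. T p)"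
        using fin by (subst sum.union_disjoint[symmetric]) (auto intro!: sum.cong)
      finally have eq: "(\<Sum>(x,k)\<in>D. measure lborel k *\<^sub>R h' x) - (f b - f a) = (\<Sum>p\<in>?D1. T p) + (\<Sum>p\<in>?D2. T p)" .
      have "\<bar>\<Sum>p\<in>?D2. T p\<bar> \<le> (\<Sum>p\<in>?D2. e' * measure lborel (snd p))"
      proof (rule order_trans[OF sum_abs], rule sum_mono)
        fix p assume "p \<in> ?D2"
        then obtain x k where p: "p = (x,k)" "(x,k) \<in> D" "x \<notin> N" by (cases p) auto
        note m = mem[OF p(2)]
        have "{Inf k..Sup k} \<subseteq> ball x (r x)" using m p(3) by (auto simp: g_def)
        then have "\<bar>h x * (Sup k - Inf k) - (f (Sup k) - f (Inf k))\<bar> \<le> e' * (Sup k - Inf k)"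
          using m p(3) by (intro r(2)) auto
        then show "\<bar>T p\<bar> \<le> e' * measure lborel (snd p)"
          using p m by (simp add: T_def h'_def mult.commute)
      qed
      also have "\<dots> \<le> (\<Sum>p\<in>D. e' * measure lborel (snd p))"
        using fin e' by (intro sum_mono2) auto
      also have "\<dots> = e' * (b - a)"
        using additive_content_tagged_division[of D a b] D(1) ab
        by (simp add: sum_distrib_left[symmetric] case_prod_unfold)
      also have "\<dots> = e/2" using ab by (simp add: e'_def divide_simps)
      finally have b2: "\<bar>\<Sum>p\<in>?D2. T p\<bar> \<le> e/2" .
      have part: "?D1 tagged_partial_division_of {a..b}"
        by (rule tagged_partial_division_subset[OF conjunct1[OF D(1)[unfolded tagged_division_of_def]]]) auto
      have div: "(snd ` ?D1) division_of \<Union>(snd ` ?D1)"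
        using partial_division_of_tagged_division[OF part] .
      have subU: "\<Union>(snd ` ?D1) \<subseteq> U" using mem by (fastforce simp: g_def)
      have sub01: "\<Union>(snd ` ?D1) \<subseteq> {0..1}"
      proof (rule Union_least)
        fix k assume "k \<in> snd ` ?D1"
        then obtain x where "(x,k) \<in> D" by auto
        then have "k \<subseteq> {a..b}" using mem by blast
        moreover have "{a..b} \<subseteq> {0..1}" using assms by auto
        ultimately show "k \<subseteq> {0..1}" by blast
      qed
      have "(\<Sum>k\<in>snd ` ?D1. \<bar>f (Sup k) - f (Inf k)\<bar>) < e/2"
        using sum_lengths_le_measure[OF div sub01 subU U(3)] U(4) by (intro d(2)[OF div sub01]) simp
      \<comment> \<open>Absolute continuity sees a set of intervals, the Riemann sum sees tagged
        pairs. An interval carrying two tags has empty interior, so it is a single point and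
        contributes 0.\<close>
      moreover have "(\<Sum>k\<in>snd ` ?D1. \<bar>f (Sup k) - f (Inf k)\<bar>) = (\<Sum>p\<in>?D1. \<bar>f (Sup (snd p)) - f (Inf (snd p))\<bar>)"
      proof (rule sum.reindex_nontrivial[unfolded o_def])
        show "finite ?D1" using fin by auto
        fix p p' assume pp: "p \<in> ?D1" "p' \<in> ?D1" "p \<noteq> p'" "snd p = snd p'"
        then have "interior (snd p) \<inter> interior (snd p') = {}"
          using tagged_division_ofD(5)[OF D(1), of "fst p" "snd p" "fst p'" "snd p'"]
          by (metis (mono_tags, lifting) mem_Collect_eq prod.collapse)
        then have "interior (snd p) = {}" using pp by simp
        moreover have pD: "(fst p, snd p) \<in> D" using pp(1) by simp
        note m = mem[OF pD]
        have eq: "snd p = {Inf (snd p)..Sup (snd p)}" using m by (rule conjunct1)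
        have "Inf (snd p) \<le> Sup (snd p)"
          using m[THEN conjunct2, THEN conjunct1] m[THEN conjunct2, THEN conjunct2, THEN conjunct1]
          by (rule order_trans)
        moreover have "interior {Inf (snd p)..Sup (snd p)} = {}"
          using arg_cong[OF eq, of interior] \<open>interior (snd p) = {}\<close> by (rule trans[OF sym])
        ultimately have "Inf (snd p) = Sup (snd p)" by simp
        then show "\<bar>f (Sup (snd p)) - f (Inf (snd p))\<bar> = 0" by simp
      qed
      moreover have "(\<Sum>p\<in>?D1. T p) = - (\<Sum>p\<in>?D1. f (Sup (snd p)) - f (Inf (snd p)))"
        unfolding sum_negf[symmetric] by (intro sum.cong) (auto simp: T_def h'_def)
      moreover have "\<bar>\<Sum>p\<in>?D1. f (Sup (snd p)) - f (Inf (snd p))\<bar> \<le> (\<Sum>p\<in>?D1. \<bar>f (Sup (snd p)) - f (Inf (snd p))\<bar>)"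
        by (rule sum_abs)
      ultimately show ?thesis unfolding eq real_norm_def using b2 by linarith
    qed
    show "\<exists>\<gamma>. gauge \<gamma> \<and> (\<forall>\<D>. \<D> tagged_division_of {a..b} \<and> \<gamma> fine \<D> \<longrightarrow>
        norm ((\<Sum>(x,k)\<in>\<D>. measure lborel k *\<^sub>R h' x) - (f b - f a)) < e)"
      by (intro exI[of _ g] conjI allI impI, rule g, elim conjE, rule main)
  qed
  then show ?thesis
    by (rule has_integral_spike[OF N, rotated]) (simp add: h'_def)
qed

text \<open>Comparison of increments is the common source of the closure properties: sums, products,
  compositions and Lipschitz functions reduce to it, with \<open>g\<close> and \<open>h\<close>
  equal when there is one comparison function.\<close>

lemma AC_dominated:
  assumes "AC g" "AC h"
    and le: "\<And>u v. 0 \<le> u \<Longrightarrow> u \<le> v \<Longrightarrow> v \<le> 1 \<Longrightarrow> \<bar>f v - f u\<bar> \<le> L * (\<bar>g v - g u\<bar> + \<bar>h v - h u\<bar>)"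
  shows "AC f"
proof (rule AC_I)
  fix e :: real assume e: "e > 0"
  define M where "M = \<bar>L\<bar> + 1"
  have M: "M > 0" "L \<le> M" by (auto simp: M_def)
  have e': "e / (2 * M) > 0" using e M by simp
  obtain d1 where d1: "d1 > 0" "\<And>D S. D division_of S \<Longrightarrow> S \<subseteq> {0..1} \<Longrightarrow>
    (\<Sum>k\<in>D. Sup k - Inf k) < d1 \<Longrightarrow> (\<Sum>k\<in>D. \<bar>g (Sup k) - g (Inf k)\<bar>) < e / (2 * M)"
    using AC_D[OF assms(1) e'] by blast
  obtain d2 where d2: "d2 > 0" "\<And>D S. D division_of S \<Longrightarrow> S \<subseteq> {0..1} \<Longrightarrow>
    (\<Sum>k\<in>D. Sup k - Inf k) < d2 \<Longrightarrow> (\<Sum>k\<in>D. \<bar>h (Sup k) - h (Inf k)\<bar>) < e / (2 * M)"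
    using AC_D[OF assms(2) e'] by blast
  show "\<exists>\<delta>>0. \<forall>D S. D division_of S \<longrightarrow> S \<subseteq> {0..1} \<longrightarrow>
    (\<Sum>k\<in>D. Sup k - Inf k) < \<delta> \<longrightarrow> (\<Sum>k\<in>D. \<bar>f (Sup k) - f (Inf k)\<bar>) < e"
  proof (intro exI[of _ "min d1 d2"] conjI allI impI)
    show "min d1 d2 > 0" using d1(1) d2(1) by simp
    fix D :: "real set set" and S
    assume D: "D division_of S" "S \<subseteq> {0..1}" "(\<Sum>k\<in>D. Sup k - Inf k) < min d1 d2"
    have "(\<Sum>k\<in>D. \<bar>f (Sup k) - f (Inf k)\<bar>)
        \<le> (\<Sum>k\<in>D. M * (\<bar>g (Sup k) - g (Inf k)\<bar> + \<bar>h (Sup k) - h (Inf k)\<bar>))"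
    proof (rule sum_mono)
      fix k assume "k \<in> D"
      note k = division_memD[OF D(1,2) this]
      have "\<bar>f (Sup k) - f (Inf k)\<bar> \<le> L * (\<bar>g (Sup k) - g (Inf k)\<bar> + \<bar>h (Sup k) - h (Inf k)\<bar>)"
        using k by (intro le) auto
      also have "\<dots> \<le> M * (\<bar>g (Sup k) - g (Inf k)\<bar> + \<bar>h (Sup k) - h (Inf k)\<bar>)"
        using M by (intro mult_right_mono) auto
      finally show "\<bar>f (Sup k) - f (Inf k)\<bar> \<le> M * (\<bar>g (Sup k) - g (Inf k)\<bar> + \<bar>h (Sup k) - h (Inf k)\<bar>)" .
    qed
    also have "\<dots> = M * ((\<Sum>k\<in>D. \<bar>g (Sup k) - g (Inf k)\<bar>) + (\<Sum>k\<in>D. \<bar>h (Sup k) - h (Inf k)\<bar>))"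
      by (simp only: sum_distrib_left sum.distrib distrib_left)
    also have "\<dots> < M * (e / (2 * M) + e / (2 * M))"
      using d1(2)[OF D(1,2)] d2(2)[OF D(1,2)] D(3) M(1) by (intro mult_strict_left_mono add_strict_mono) auto
    also have "\<dots> = e" using M(1) by simp
    finally show "(\<Sum>k\<in>D. \<bar>f (Sup k) - f (Inf k)\<bar>) < e" .
  qed
qed

lemma AC_ident: "AC (\<lambda>x. x)"
proof (rule AC_I)
  fix e :: real assume e: "e > 0"
  have "(\<Sum>k\<in>D. \<bar>Sup k - Inf k\<bar>) = (\<Sum>k\<in>D. Sup k - Inf k)"
    if "D division_of S" "S \<subseteq> {0..1}" for D and S :: "real set"
    using division_memD(2)[OF that] by (intro sum.cong) auto
  then show "\<exists>\<delta>>0. \<forall>D S. D division_of S \<longrightarrow> S \<subseteq> {0..1} \<longrightarrow>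
    (\<Sum>k\<in>D. Sup k - Inf k) < \<delta> \<longrightarrow> (\<Sum>k\<in>D. \<bar>Sup k - Inf k\<bar>) < e"
    using e by auto
qed

lemma AC_lipschitz:
  assumes "\<And>u v. 0 \<le> u \<Longrightarrow> u \<le> v \<Longrightarrow> v \<le> 1 \<Longrightarrow> \<bar>f v - f u\<bar> \<le> L * (v - u)"
  shows "AC f"
proof (rule AC_dominated[OF AC_ident AC_ident, of f "\<bar>L\<bar>"])
  fix u v :: real assume uv: "0 \<le> u" "u \<le> v" "v \<le> 1"
  have "\<bar>f v - f u\<bar> \<le> L * (v - u)" using assms uv by blast
  also have "\<dots> \<le> \<bar>L\<bar> * (\<bar>v - u\<bar> + \<bar>v - u\<bar>)" using uv by (intro mult_mono) auto
  finally show "\<bar>f v - f u\<bar> \<le> \<bar>L\<bar> * (\<bar>v - u\<bar> + \<bar>v - u\<bar>)" .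
qed

lemma continuous_on_bounded_01:
  fixes f :: "real \<Rightarrow> real"
  assumes "continuous_on {0..1} f"
  obtains B where "B > 0" "\<And>x. x \<in> {0..1} \<Longrightarrow> \<bar>f x\<bar> \<le> B"
proof -
  have "bounded (f ` {0..1})"
    using compact_continuous_image[OF assms] compact_imp_bounded by auto
  then obtain B where "B > 0" "\<forall>y\<in>f ` {0..1}. norm y \<le> B" using bounded_pos by blast
  then show thesis using that by auto
qed

lemma ac_derivI:
  assumes "AC f" "negligible N" "\<And>x. 0 < x \<Longrightarrow> x < 1 \<Longrightarrow> x \<notin> N \<Longrightarrow> (f has_real_derivative h x) (at x)"
  shows "ac_deriv f h"
  using assms unfolding ac_deriv_def by auto

lemma ac_derivE:
  assumes "ac_deriv f h"
  obtains N where "AC f" "negligible N"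
    "\<And>x. 0 < x \<Longrightarrow> x < 1 \<Longrightarrow> x \<notin> N \<Longrightarrow> (f has_real_derivative h x) (at x)"
  using assms unfolding ac_deriv_def by auto

lemma ac_deriv_continuous_on: "ac_deriv f h \<Longrightarrow> continuous_on {0..1} f"
  by (auto simp: ac_deriv_def AC_continuous_on)

lemma ac_deriv_C1:
  assumes der: "\<And>x. x \<in> {0..1} \<Longrightarrow> (f has_real_derivative h x) (at x within {0..1})"
    and "continuous_on {0..1} h"
  shows "ac_deriv f h"
proof -
  obtain B where B: "B > 0" "\<And>x. x \<in> {0..1} \<Longrightarrow> \<bar>h x\<bar> \<le> B"
    using continuous_on_bounded_01[OF assms(2)] by blast
  have "AC f"
  proof (rule AC_lipschitz)
    fix u v :: real assume uv: "0 \<le> u" "u \<le> v" "v \<le> 1"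
    have "norm (f v - f u) \<le> B * norm (v - u)"
      by (rule field_differentiable_bound[of "{0..1}" f h B v u]) (use der B uv in auto)
    then show "\<bar>f v - f u\<bar> \<le> B * (v - u)" using uv by simp
  qed
  moreover have "(f has_real_derivative h x) (at x)" if "0 < x" "x < 1" for x
    using der[of x] that at_within_Icc_at[of 0 x 1] by simp
  ultimately show ?thesis by (intro ac_derivI[of f "{}"]) auto
qed

lemma ac_deriv_cong:
  assumes "ac_deriv f h" "\<And>x. x \<in> {0..1} \<Longrightarrow> f x = g x" "\<And>x. x \<in> {0..1} \<Longrightarrow> h x = k x"
  shows "ac_deriv g k"
proof -
  obtain N where N: "AC f" "negligible N"
    "\<And>x. 0 < x \<Longrightarrow> x < 1 \<Longrightarrow> x \<notin> N \<Longrightarrow> (f has_real_derivative h x) (at x)"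
    using ac_derivE[OF assms(1)] by blast
  have "AC g"
    by (rule AC_dominated[OF N(1) N(1), of g 1]) (use assms(2) in auto)
  moreover have "(g has_real_derivative k x) (at x)" if "0 < x" "x < 1" "x \<notin> N" for x
  proof -
    have "(f has_real_derivative k x) (at x)" using N(3)[OF that] assms(3)[of x] that by simp
    then show ?thesis
      by (rule has_field_derivative_transform_within_open[of _ _ _ "{0<..<1}"]) (use assms(2) that in auto)
  qed
  ultimately show ?thesis using N(2) by (intro ac_derivI) auto
qed

lemma ac_deriv_mult:
  assumes "ac_deriv f f'" "ac_deriv g g'"
  shows "ac_deriv (\<lambda>x. f x * g x) (\<lambda>x. f' x * g x + f x * g' x)"
proof -
  obtain N where N: "AC f" "negligible N"
    "\<And>x. 0 < x \<Longrightarrow> x < 1 \<Longrightarrow> x \<notin> N \<Longrightarrow> (f has_real_derivative f' x) (at x)"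
    using ac_derivE[OF assms(1)] by blast
  obtain M where M: "AC g" "negligible M"
    "\<And>x. 0 < x \<Longrightarrow> x < 1 \<Longrightarrow> x \<notin> M \<Longrightarrow> (g has_real_derivative g' x) (at x)"
    using ac_derivE[OF assms(2)] by blast
  obtain B1 where B1: "B1 > 0" "\<And>x. x \<in> {0..1} \<Longrightarrow> \<bar>f x\<bar> \<le> B1"
    using continuous_on_bounded_01[OF AC_continuous_on[OF N(1)]] by blast
  obtain B2 where B2: "B2 > 0" "\<And>x. x \<in> {0..1} \<Longrightarrow> \<bar>g x\<bar> \<le> B2"
    using continuous_on_bounded_01[OF AC_continuous_on[OF M(1)]] by blast
  have "AC (\<lambda>x. f x * g x)"
  proof (rule AC_dominated[OF N(1) M(1), of _ "max B1 B2"])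
    fix u v :: real assume uv: "0 \<le> u" "u \<le> v" "v \<le> 1"
    have "f v * g v - f u * g u = (f v - f u) * g v + f u * (g v - g u)" by (simp add: algebra_simps)
    then have "\<bar>f v * g v - f u * g u\<bar> \<le> \<bar>f v - f u\<bar> * \<bar>g v\<bar> + \<bar>f u\<bar> * \<bar>g v - g u\<bar>"
      by (metis abs_mult abs_triangle_ineq)
    also have "\<dots> \<le> \<bar>f v - f u\<bar> * max B1 B2 + max B1 B2 * \<bar>g v - g u\<bar>"
      using B1(2)[of u] B2(2)[of v] uv by (intro add_mono mult_left_mono mult_right_mono) auto
    finally show "\<bar>f v * g v - f u * g u\<bar> \<le> max B1 B2 * (\<bar>f v - f u\<bar> + \<bar>g v - g u\<bar>)"
      by (simp add: algebra_simps)
  qed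
  then show ?thesis
    by (rule ac_derivI[of _ "N \<union> M"]) (use N M in \<open>auto intro!: derivative_eq_intros\<close>)
qed

lemma ac_deriv_add:
  assumes "ac_deriv f f'" "ac_deriv g g'"
  shows "ac_deriv (\<lambda>x. f x + g x) (\<lambda>x. f' x + g' x)"
proof -
  obtain N where N: "AC f" "negligible N"
    "\<And>x. 0 < x \<Longrightarrow> x < 1 \<Longrightarrow> x \<notin> N \<Longrightarrow> (f has_real_derivative f' x) (at x)"
    using ac_derivE[OF assms(1)] by blast
  obtain M where M: "AC g" "negligible M"
    "\<And>x. 0 < x \<Longrightarrow> x < 1 \<Longrightarrow> x \<notin> M \<Longrightarrow> (g has_real_derivative g' x) (at x)"
    using ac_derivE[OF assms(2)] by blast
  have "AC (\<lambda>x. f x + g x)"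
    by (rule AC_dominated[OF N(1) M(1), of _ 1]) auto
  then show ?thesis
    by (rule ac_derivI[of _ "N \<union> M"]) (use N M in \<open>auto intro!: derivative_eq_intros\<close>)
qed

lemma ac_deriv_const: "ac_deriv (\<lambda>x. c) (\<lambda>x. 0)"
  by (rule ac_deriv_C1) auto

lemma ac_deriv_cmult:
  assumes "ac_deriv f f'"
  shows "ac_deriv (\<lambda>x. c * f x) (\<lambda>x. c * f' x)"
  using ac_deriv_mult[OF ac_deriv_const assms] by simp

lemma ac_deriv_diff:
  assumes "ac_deriv f f'" "ac_deriv g g'"
  shows "ac_deriv (\<lambda>x. f x - g x) (\<lambda>x. f' x - g' x)"
  using ac_deriv_add[OF assms(1) ac_deriv_cmult[OF assms(2), of "-1"]] by simp

lemma ac_deriv_mono: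
  assumes "ac_deriv f h" "\<And>x. x \<in> {a..b} \<Longrightarrow> 0 \<le> h x" "0 \<le> a" "a \<le> b" "b \<le> 1"
  shows "f a \<le> f b"
  using has_integral_nonneg[OF ac_deriv_has_integral[OF assms(1,3-5)]] assms(2) by auto

lemma ac_deriv_integral:
  assumes "ac_deriv f h" "0 \<le> x" "x \<le> 1"
  shows "f x = f 0 + integral {0..x} h"
  using integral_unique[OF ac_deriv_has_integral[OF assms(1), of 0 x]] assms by simp

text \<open>A bounded derivative on a convex set containing the range makes \<open>\<phi>\<close>
  Lipschitz where it is evaluated; this admits exp, whose derivative is bounded only on sets bounded
  above.\<close>

lemma ac_deriv_compose:
  assumes "ac_deriv f f'" and S: "convex S" "\<And>x. x \<in> {0..1} \<Longrightarrow> f x \<in> S"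
    and der: "\<And>y. y \<in> S \<Longrightarrow> (\<phi> has_real_derivative \<phi>' y) (at y)"
    and bound: "\<And>y. y \<in> S \<Longrightarrow> \<bar>\<phi>' y\<bar> \<le> L"
  shows "ac_deriv (\<lambda>x. \<phi> (f x)) (\<lambda>x. \<phi>' (f x) * f' x)"
proof -
  obtain N where N: "AC f" "negligible N"
    "\<And>x. 0 < x \<Longrightarrow> x < 1 \<Longrightarrow> x \<notin> N \<Longrightarrow> (f has_real_derivative f' x) (at x)"
    using ac_derivE[OF assms(1)] by blast
  have "0 \<le> L" using bound[OF S(2)[of 0]] by auto
  have "AC (\<lambda>x. \<phi> (f x))"
  proof (rule AC_dominated[OF N(1) N(1), of _ L])
    fix u v :: real assume uv: "0 \<le> u" "u \<le> v" "v \<le> 1"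
    have "norm (\<phi> (f v) - \<phi> (f u)) \<le> L * norm (f v - f u)"
      by (rule field_differentiable_bound[OF S(1) has_field_derivative_at_within[OF der]])
        (use S(2) bound uv in auto)
    also have "\<dots> \<le> L * (\<bar>f v - f u\<bar> + \<bar>f v - f u\<bar>)"
      using \<open>0 \<le> L\<close> by (intro mult_left_mono) auto
    finally show "\<bar>\<phi> (f v) - \<phi> (f u)\<bar> \<le> L * (\<bar>f v - f u\<bar> + \<bar>f v - f u\<bar>)" by simp
  qed
  moreover have "((\<lambda>x. \<phi> (f x)) has_real_derivative \<phi>' (f x) * f' x) (at x)"
    if "0 < x" "x < 1" "x \<notin> N" for x
    using DERIV_chain2[OF der N(3)[OF that]] S(2)[of x] that by simp
  ultimately show ?thesis using N(2) by (intro ac_derivI)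
qed

lemma ac_deriv_exp:
  assumes "ac_deriv f f'"
  shows "ac_deriv (\<lambda>x. exp (f x)) (\<lambda>x. exp (f x) * f' x)"
proof -
  obtain B where B: "\<And>x. x \<in> {0..1} \<Longrightarrow> \<bar>f x\<bar> \<le> B"
    using continuous_on_bounded_01[OF ac_deriv_continuous_on[OF assms]] by blast
  show ?thesis
    by (rule ac_deriv_compose[OF assms, of "{-B..B}" exp exp "exp B"])
      (use B in \<open>auto simp: abs_le_iff minus_le_iff\<close>)
qed

text \<open>Truncating \<open>h\<close> at a large height \<open>n\<close> costs little in L^1.
  Measurability supplies continuous functions converging to \<open>h\<close> almost everywhere;
  truncating them at the same height makes dominated convergence apply with the constant 2
  n.\<close>

lemma L1_continuous_approx:
  fixes h :: "real \<Rightarrow> real"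
  assumes h: "h absolutely_integrable_on {a..b}" and e: "e > 0"
  obtains g where "continuous_on UNIV g" "(\<lambda>x. h x - g x) absolutely_integrable_on {a..b}"
    "integral {a..b} (\<lambda>x. \<bar>h x - g x\<bar>) < e"
proof -
  define c where "c n y = max (- real n) (min (real n) y)" for n y
  have habs: "(\<lambda>x. \<bar>h x\<bar>) integrable_on {a..b}"
    using h by (simp add: absolutely_integrable_on_def)
  have hm: "h \<in> borel_measurable (lebesgue_on {a..b})"
    using h by (rule absolutely_integrable_imp_borel_measurable) simp
  have c_bd: "\<bar>c n y\<bar> \<le> real n" for n y by (auto simp: c_def)
  have c_diff: "\<bar>y - c n y\<bar> \<le> \<bar>y\<bar>" for n y by (auto simp: c_def)
  have c_cont: "continuous_on UNIV (c n)" for n unfolding c_def by (intro continuous_intros)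
  have c_meas: "(\<lambda>x. c n (h x)) \<in> borel_measurable (lebesgue_on {a..b})" for n
    unfolding c_def by (intro borel_measurable_max borel_measurable_min borel_measurable_const hm)
  have int1: "(\<lambda>x. h x - c n (h x)) absolutely_integrable_on {a..b}" for n
    by (rule measurable_bounded_by_integrable_imp_absolutely_integrable[OF _ _ habs])
      (use c_diff hm c_meas in auto)
  have "(\<lambda>n. integral {a..b} (\<lambda>x. \<bar>h x - c n (h x)\<bar>)) \<longlonglongrightarrow> integral {a..b} (\<lambda>x. 0)"
  proof (rule dominated_convergence(2)[of _ _ "\<lambda>x. \<bar>h x\<bar>"])
    show "(\<lambda>x. \<bar>h x - c n (h x)\<bar>) integrable_on {a..b}" for n
      using int1[of n] by (simp add: absolutely_integrable_on_def)
    show "(\<lambda>x. \<bar>h x\<bar>) integrable_on {a..b}" by (rule habs)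
    show "norm \<bar>h x - c n (h x)\<bar> \<le> \<bar>h x\<bar>" for n x using c_diff by auto
    show "(\<lambda>n. \<bar>h x - c n (h x)\<bar>) \<longlonglongrightarrow> 0" for x
    proof (rule tendsto_eventually)
      obtain m where m: "\<bar>h x\<bar> \<le> real m" using real_arch_simple by blast
      show "\<forall>\<^sub>F n in sequentially. \<bar>h x - c n (h x)\<bar> = 0"
        using eventually_ge_at_top[of m]
      proof eventually_elim
        case (elim n)
        then have "\<bar>h x\<bar> \<le> real n" using m by (meson of_nat_mono order_trans)
        then show ?case by (auto simp: c_def)
      qed
    qed
  qed
  then have "\<forall>\<^sub>F n in sequentially. integral {a..b} (\<lambda>x. \<bar>h x - c n (h x)\<bar>) < e/2"
    using e by (intro order_tendstoD) auto
  then obtain n where n: "integral {a..b} (\<lambda>x. \<bar>h x - c n (h x)\<bar>) < e/2"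
    by (auto simp: eventually_sequentially)
  have "h measurable_on {a..b}" using hm by (simp add: measurable_on_iff_borel_measurable)
  then obtain N g where g: "negligible N" "\<And>n. continuous_on UNIV (g n)"
    "\<And>x. x \<notin> N \<Longrightarrow> (\<lambda>n. g n x) \<longlonglongrightarrow> (if x \<in> {a..b} then h x else 0)"
    unfolding measurable_on_def by blast
  have G_cont: "continuous_on UNIV (\<lambda>x. c n (g m x))" for m
    by (rule continuous_on_compose2[OF c_cont g(2)]) auto
  have int2: "(\<lambda>x. c n (h x) - c n (g m x)) absolutely_integrable_on {a..b}" for m
  proof (rule measurable_bounded_by_integrable_imp_absolutely_integrable[of _ _ "\<lambda>x. 2 * real n"])
    have "continuous_on {a..b} (\<lambda>x. c n (g m x))" using G_cont continuous_on_subset by blast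
    then show "(\<lambda>x. c n (h x) - c n (g m x)) \<in> borel_measurable (lebesgue_on {a..b})"
      by (intro borel_measurable_diff c_meas continuous_imp_measurable_on_sets_lebesgue) auto
    show "norm (c n (h x) - c n (g m x)) \<le> 2 * real n" for x
      using c_bd[of n "h x"] c_bd[of n "g m x"] by auto
  qed auto
  \<comment> \<open>Setting the integrand to 0 on the null set gives convergence at every point
    without changing the integral.\<close>
  have "(\<lambda>m. integral {a..b} (\<lambda>x. if x \<in> N then 0 else \<bar>c n (h x) - c n (g m x)\<bar>)) \<longlonglongrightarrow> integral {a..b} (\<lambda>x. 0)"
  proof (rule dominated_convergence(2)[of _ _ "\<lambda>x. 2 * real n"])
    show "(\<lambda>x. if x \<in> N then 0 else \<bar>c n (h x) - c n (g m x)\<bar>) integrable_on {a..b}" for m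
      by (rule integrable_spike[OF _ g(1), of "\<lambda>x. \<bar>c n (h x) - c n (g m x)\<bar>"])
         (use int2[of m] in \<open>auto simp: absolutely_integrable_on_def\<close>)
    show "norm (if x \<in> N then 0 else \<bar>c n (h x) - c n (g m x)\<bar>) \<le> 2 * real n" for m x
      using c_bd[of n "h x"] c_bd[of n "g m x"] by auto
    show "(\<lambda>m. if x \<in> N then 0 else \<bar>c n (h x) - c n (g m x)\<bar>) \<longlonglongrightarrow> 0" if x: "x \<in> {a..b}" for x
    proof (cases "x \<in> N")
      case False
      then have "(\<lambda>m. g m x) \<longlonglongrightarrow> h x" using g(3)[of x] x by simp
      then have "(\<lambda>m. c n (g m x)) \<longlonglongrightarrow> c n (h x)"
        using c_cont by (metis UNIV_I continuous_on_tendsto_compose eventuallyI)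
      then have "(\<lambda>m. \<bar>c n (h x) - c n (g m x)\<bar>) \<longlonglongrightarrow> \<bar>c n (h x) - c n (h x)\<bar>"
        by (intro tendsto_intros)
      then show ?thesis using False by simp
    qed simp
  qed auto
  moreover have "integral {a..b} (\<lambda>x. if x \<in> N then 0 else \<bar>c n (h x) - c n (g m x)\<bar>)
      = integral {a..b} (\<lambda>x. \<bar>c n (h x) - c n (g m x)\<bar>)" for m
    by (rule integral_spike[OF g(1)]) auto
  ultimately have "(\<lambda>m. integral {a..b} (\<lambda>x. \<bar>c n (h x) - c n (g m x)\<bar>)) \<longlonglongrightarrow> 0" by simp
  then have "\<forall>\<^sub>F m in sequentially. integral {a..b} (\<lambda>x. \<bar>c n (h x) - c n (g m x)\<bar>) < e/2"
    using e by (intro order_tendstoD) auto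
  then obtain m where m: "integral {a..b} (\<lambda>x. \<bar>c n (h x) - c n (g m x)\<bar>) < e/2"
    by (auto simp: eventually_sequentially)
  show thesis
  proof (rule that[OF G_cont[of m]])
    have eq: "(\<lambda>x. h x - c n (g m x)) = (\<lambda>x. (h x - c n (h x)) + (c n (h x) - c n (g m x)))" by auto
    show int3: "(\<lambda>x. h x - c n (g m x)) absolutely_integrable_on {a..b}"
      unfolding eq using int1 int2 by (rule set_integral_add)
    have "integral {a..b} (\<lambda>x. \<bar>h x - c n (g m x)\<bar>)
        \<le> integral {a..b} (\<lambda>x. \<bar>h x - c n (h x)\<bar> + \<bar>c n (h x) - c n (g m x)\<bar>)"
      using int1[of n] int2[of m] int3 by (intro integral_le integrable_add) (auto simp: absolutely_integrable_on_def)
    also have "\<dots> = integral {a..b} (\<lambda>x. \<bar>h x - c n (h x)\<bar>) + integral {a..b} (\<lambda>x. \<bar>c n (h x) - c n (g m x)\<bar>)"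
      using int1[of n] int2[of m] by (intro integral_add) (auto simp: absolutely_integrable_on_def)
    also have "\<dots> < e" using n m by simp
    finally show "integral {a..b} (\<lambda>x. \<bar>h x - c n (g m x)\<bar>) < e" .
  qed
qed

section \<open>Indefinite integrals and the Gronwall inequality\<close>

text \<open>Approximate \<open>h\<close> in L^1 by a continuous \<open>g\<close>: the error
  contributes less than e/2 on every family of intervals, and \<open>g\<close>, bounded by
  \<open>B\<close>, contributes at most \<open>B\<close> times the total length.\<close>

lemma AC_indefinite_integral:
  assumes h: "h absolutely_integrable_on {0..1::real}"
  shows "AC (\<lambda>x. integral {0..x} h)"
proof (rule AC_I)
  fix e :: real assume e: "e > 0"
  obtain g where g: "continuous_on UNIV g" "(\<lambda>x. h x - g x) absolutely_integrable_on {0..1}"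
    "integral {0..1} (\<lambda>x. \<bar>h x - g x\<bar>) < e/2"
    using L1_continuous_approx[OF h half_gt_zero[OF e]] by blast
  obtain B where B: "B > 0" "\<And>x. x \<in> {0..1} \<Longrightarrow> \<bar>g x\<bar> \<le> B"
    using continuous_on_bounded_01[OF continuous_on_subset[OF g(1)]] by blast
  have hint: "h integrable_on {0..1}" using h by (simp add: absolutely_integrable_on_def)
  have dint: "(\<lambda>x. \<bar>h x - g x\<bar>) integrable_on {0..1}"
    using g(2) by (simp add: absolutely_integrable_on_def)
  show "\<exists>\<delta>>0. \<forall>D S. D division_of S \<longrightarrow> S \<subseteq> {0..1} \<longrightarrow>
    (\<Sum>k\<in>D. Sup k - Inf k) < \<delta> \<longrightarrow> (\<Sum>k\<in>D. \<bar>integral {0..Sup k} h - integral {0..Inf k} h\<bar>) < e"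
  proof (intro exI[of _ "e / (2 * B)"] conjI allI impI)
    show "e / (2 * B) > 0" using e B by simp
    fix D :: "real set set" and S
    assume D: "D division_of S" "S \<subseteq> {0..1}" "(\<Sum>k\<in>D. Sup k - Inf k) < e / (2 * B)"
    have dS: "((\<lambda>x. \<bar>h x - g x\<bar>) has_integral (\<Sum>k\<in>D. integral k (\<lambda>x. \<bar>h x - g x\<bar>))) S"
    proof (rule has_integral_combine_division[OF D(1)])
      fix k assume "k \<in> D"
      note k = division_memD[OF D(1,2) this]
      have "(\<lambda>x. \<bar>h x - g x\<bar>) integrable_on {Inf k..Sup k}"
        by (rule integrable_subinterval_real[OF dint]) (use k(3,4) in auto)
      then have "(\<lambda>x. \<bar>h x - g x\<bar>) integrable_on k" using k(1) by simp
      then show "((\<lambda>x. \<bar>h x - g x\<bar>) has_integral integral k (\<lambda>x. \<bar>h x - g x\<bar>)) k" by blast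
    qed
    have "(\<Sum>k\<in>D. \<bar>integral {0..Sup k} h - integral {0..Inf k} h\<bar>)
        \<le> (\<Sum>k\<in>D. integral k (\<lambda>x. \<bar>h x - g x\<bar>) + B * (Sup k - Inf k))"
    proof (rule sum_mono)
      fix k assume "k \<in> D"
      note k = division_memD[OF D(1,2) this]
      let ?I = "{Inf k..Sup k}"
      have int: "h integrable_on ?I" "(\<lambda>x. \<bar>h x - g x\<bar>) integrable_on ?I"
        by (rule integrable_subinterval_real[OF hint] integrable_subinterval_real[OF dint], use k(3,4) in auto)+
      have "integral {0..Inf k} h + integral ?I h = integral {0..Sup k} h"
        by (rule Henstock_Kurzweil_Integration.integral_combine)
          (use k(2-4) in \<open>auto intro: integrable_subinterval_real[OF hint]\<close>)
      then have "\<bar>integral {0..Sup k} h - integral {0..Inf k} h\<bar> = norm (integral ?I h)" by simp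
      also have "\<dots> \<le> integral ?I (\<lambda>x. \<bar>h x - g x\<bar> + B)"
      proof (rule integral_norm_bound_integral[OF int(1)])
        show "(\<lambda>x. \<bar>h x - g x\<bar> + B) integrable_on ?I" by (intro integrable_add int) auto
        show "norm (h x) \<le> \<bar>h x - g x\<bar> + B" if "x \<in> ?I" for x
          using B(2)[of x] that k(3,4) by auto
      qed
      also have "\<dots> = integral ?I (\<lambda>x. \<bar>h x - g x\<bar>) + B * (Sup k - Inf k)"
        using k(2) by (subst integral_add) (auto simp: int)
      finally show "\<bar>integral {0..Sup k} h - integral {0..Inf k} h\<bar>
          \<le> integral k (\<lambda>x. \<bar>h x - g x\<bar>) + B * (Sup k - Inf k)"
        unfolding k(1)[symmetric] .
    qed
    also have "\<dots> = integral S (\<lambda>x. \<bar>h x - g x\<bar>) + B * (\<Sum>k\<in>D. Sup k - Inf k)"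
      using integral_unique[OF dS] by (simp add: sum.distrib sum_distrib_left)
    also have "\<dots> < e/2 + B * (e / (2 * B))"
    proof (rule add_strict_mono)
      have "integral S (\<lambda>x. \<bar>h x - g x\<bar>) \<le> integral {0..1} (\<lambda>x. \<bar>h x - g x\<bar>)"
        by (rule integral_subset_le[OF D(2)]) (use dS dint in auto)
      then show "integral S (\<lambda>x. \<bar>h x - g x\<bar>) < e/2" using g(3) by simp
      show "B * (\<Sum>k\<in>D. Sup k - Inf k) < B * (e / (2 * B))"
        using D(3) B(1) by (intro mult_strict_left_mono)
    qed
    also have "\<dots> = e" using B(1) by simp
    finally show "(\<Sum>k\<in>D. \<bar>integral {0..Sup k} h - integral {0..Inf k} h\<bar>) < e" .
  qed
qed

lemma right_lebesgue_differentiation: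
  fixes H :: "real \<Rightarrow> real"
  assumes "\<And>a b. H integrable_on {a..b}"
  obtains N where "negligible N"
    "\<And>x e. x \<notin> N \<Longrightarrow> 0 < e \<Longrightarrow> \<exists>d>0. \<forall>h. 0 < h \<and> h < d \<longrightarrow> \<bar>integral {x..x+h} H / h - H x\<bar> < e"
proof -
  have "\<And>a b. H integrable_on cbox a b" using assms by simp
  from integrable_ccontinuous_explicit[OF this] obtain N where N: "negligible N"
    "\<And>x e. x \<notin> N \<Longrightarrow> 0 < e \<Longrightarrow> \<exists>d>0. \<forall>h. 0 < h \<and> h < d \<longrightarrow>
       norm (integral (cbox x (x + h *\<^sub>R One)) H /\<^sub>R h ^ DIM(real) - H x) < e"
    by metis
  show thesis
  proof (rule that[OF N(1)])
    fix x e :: real assume "x \<notin> N" "0 < e"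
    from N(2)[OF this] show "\<exists>d>0. \<forall>h. 0 < h \<and> h < d \<longrightarrow> \<bar>integral {x..x+h} H / h - H x\<bar> < e"
      by (simp add: divide_inverse mult.commute)
  qed
qed

text \<open>Right-hand averages converge off \<open>N\<close>. Left-hand averages are right-hand
  averages of the reflected function, whose exceptional set is reflected back as
  \<open>M'\<close>.\<close>

theorem ac_deriv_indefinite_integral:
  assumes h: "h absolutely_integrable_on {0..1::real}"
  shows "ac_deriv (\<lambda>x. c + integral {0..x} h) h"
proof -
  define H where "H x = (if x \<in> {0..1} then h x else 0)" for x
  have hint: "h integrable_on {0..1}" using h by (simp add: absolutely_integrable_on_def)
  have "H integrable_on UNIV"
    unfolding H_def using hint integrable_restrict_UNIV by blast
  then have Hint: "H integrable_on {a..b}" for a b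
    by (metis integrable_on_subcbox box_real(2) subset_UNIV)
  have Rint: "(\<lambda>x. H (- x)) integrable_on {a..b}" for a b
    using Hint[of "-b" "-a"] Henstock_Kurzweil_Integration.integrable_reflect_real[of H "-a" "-b"] by simp
  obtain N where N: "negligible N"
    "\<And>x e. x \<notin> N \<Longrightarrow> 0 < e \<Longrightarrow> \<exists>d>0. \<forall>h. 0 < h \<and> h < d \<longrightarrow> \<bar>integral {x..x+h} H / h - H x\<bar> < e"
    using right_lebesgue_differentiation[OF Hint] by blast
  obtain M where M: "negligible M"
    "\<And>x e. x \<notin> M \<Longrightarrow> 0 < e \<Longrightarrow>
      \<exists>d>0. \<forall>h. 0 < h \<and> h < d \<longrightarrow> \<bar>integral {x..x+h} (\<lambda>x. H (- x)) / h - H (- x)\<bar> < e"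
    using right_lebesgue_differentiation[OF Rint] by blast
  define M' where "M' = uminus ` M"
  have "negligible M'" unfolding M'_def
  proof (rule negligible_locally_Lipschitz_image[OF _ M(1)])
    fix x :: real
    show "\<exists>T B. open T \<and> x \<in> T \<and> (\<forall>y\<in>M \<inter> T. norm (- y - - x) \<le> B * norm (y - x))"
      by (intro exI[of _ UNIV] exI[of _ 1]) (auto simp: norm_minus_commute)
  qed simp
  have F_AC: "AC (\<lambda>x. integral {0..x} h)" by (rule AC_indefinite_integral[OF h])
  have "AC (\<lambda>x. c + integral {0..x} h)"
    by (rule AC_dominated[OF F_AC F_AC, of _ 1]) auto
  then show ?thesis
  proof (rule ac_derivI)
    show "negligible (N \<union> M')" using N(1) \<open>negligible M'\<close> by simp
    fix x :: real assume x: "0 < x" "x < 1" "x \<notin> N \<union> M'"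
    then have xM: "- x \<notin> M" unfolding M'_def by (metis UnCI image_eqI minus_minus)
    have inc: "integral {0..v} h - integral {0..u} h = integral {u..v} H" if "0 \<le> u" "u \<le> v" "v \<le> 1" for u v
    proof -
      have "integral {0..u} h + integral {u..v} h = integral {0..v} h"
        by (rule Henstock_Kurzweil_Integration.integral_combine)
          (use that in \<open>auto intro: integrable_subinterval_real[OF hint]\<close>)
      moreover have "integral {u..v} H = integral {u..v} h"
        by (rule Henstock_Kurzweil_Integration.integral_cong) (use that in \<open>auto simp: H_def\<close>)
      ultimately show ?thesis by simp
    qed
    have "(\<lambda>t. (integral {0..x+t} h - integral {0..x} h) / t) \<midarrow>0\<rightarrow> h x"
    proof (rule LIM_I)
      fix r :: real assume r: "0 < r"
      obtain d1 where d1: "d1 > 0" "\<And>t. 0 < t \<Longrightarrow> t < d1 \<Longrightarrow> \<bar>integral {x..x+t} H / t - H x\<bar> < r"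
        using N(2)[of x r] x r by auto
      obtain d2 where d2: "d2 > 0"
        "\<And>t. 0 < t \<Longrightarrow> t < d2 \<Longrightarrow> \<bar>integral {-x..-x+t} (\<lambda>x. H (- x)) / t - H x\<bar> < r"
        using M(2)[of "-x" r] xM r by auto
      have Hx: "H x = h x" using x by (simp add: H_def)
      define d where "d = min (min d1 d2) (min x (1 - x))"
      show "\<exists>s>0. \<forall>t. t \<noteq> 0 \<and> norm (t - 0) < s \<longrightarrow>
          norm ((integral {0..x+t} h - integral {0..x} h) / t - h x) < r"
      proof (intro exI[of _ d] conjI allI impI)
        show "d > 0" using d1 d2 x by (simp add: d_def)
        fix t :: real assume t: "t \<noteq> 0 \<and> norm (t - 0) < d"
        show "norm ((integral {0..x+t} h - integral {0..x} h) / t - h x) < r"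
        proof (cases "t > 0")
          case True
          then have "integral {0..x+t} h - integral {0..x} h = integral {x..x+t} H"
            using t x by (intro inc) (auto simp: d_def)
          then show ?thesis using d1(2)[of t] t True Hx by (simp add: d_def)
        next
          case False
          then have t': "0 < -t" "-t < d2" "0 \<le> x + t" using t by (auto simp: d_def)
          have "integral {0..x} h - integral {0..x+t} h = integral {x+t..x} H"
            using t' x False by (intro inc) auto
          also have "\<dots> = integral {-x..-(x+t)} (\<lambda>x. H (- x))"
            by (simp only: Henstock_Kurzweil_Integration.integral_reflect_real)
          finally have "(integral {0..x+t} h - integral {0..x} h) / t
              = integral {-x..-x+(-t)} (\<lambda>x. H (- x)) / (-t)"
            by (simp add: minus_divide_left[symmetric] minus_divide_right[symmetric] algebra_simps)
          then show ?thesis using d2(2)[OF t'(1,2)] Hx by simp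
        qed
      qed
    qed
    then show "((\<lambda>x. c + integral {0..x} h) has_real_derivative h x) (at x)"
      by (simp add: DERIV_def)
  qed
qed

lemma absolutely_integrable_mult_continuous:
  fixes f q :: "real \<Rightarrow> real"
  assumes "continuous_on {a..b} f" "q absolutely_integrable_on {a..b}"
  shows "(\<lambda>x. q x * f x) absolutely_integrable_on {a..b}"
proof -
  have "(\<lambda>x. f x * q x) absolutely_integrable_on {a..b}"
    using assms compact_continuous_image[OF assms(1)]
    by (intro absolutely_integrable_bounded_measurable_product_real continuous_imp_measurable_on_sets_lebesgue)
      (auto intro: compact_imp_bounded)
  then show ?thesis by (simp add: mult.commute)
qed

text \<open>With \<open>F\<close> the right-hand side of the hypothesis and \<open>P\<close> the
  integral of \<open>p\<close>, the derivative of F exp(-P) is p (f - F) exp(-P), which is at most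
  0. Only integrability of \<open>p\<close> enters, as potentials in L^1 require.\<close>

lemma gronwall:
  fixes f p :: "real \<Rightarrow> real"
  assumes f: "continuous_on {0..1} f" and p: "p absolutely_integrable_on {0..1}"
    and p0: "\<And>x. x \<in> {0..1} \<Longrightarrow> 0 \<le> p x"
    and le: "\<And>x. x \<in> {0..1} \<Longrightarrow> f x \<le> a + integral {0..x} (\<lambda>t. p t * f t)"
    and x: "x \<in> {0..1}"
  shows "f x \<le> a * exp (integral {0..x} p)"
proof -
  define P where "P x = integral {0..x} p" for x
  define F where "F x = a + integral {0..x} (\<lambda>t. p t * f t)" for x
  have pint: "p integrable_on {0..1}" using p by (simp add: absolutely_integrable_on_def)
  have P: "ac_deriv P p" unfolding P_def using ac_deriv_indefinite_integral[OF p, of 0] by simp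
  have F: "ac_deriv F (\<lambda>t. p t * f t)" unfolding F_def
    by (rule ac_deriv_indefinite_integral[OF absolutely_integrable_mult_continuous[OF f p]])
  have E: "ac_deriv (\<lambda>x. exp (- P x)) (\<lambda>x. - p x * exp (- P x))"
    using ac_deriv_exp[OF ac_deriv_cmult[OF P, of "-1"]] by (simp add: mult.commute)
  \<comment> \<open>The leading \<open>0 -\<close> turns a decreasing function into the increasing
    one that \<open>ac_deriv_mono\<close> expects.\<close>
  have G: "ac_deriv (\<lambda>x. 0 - F x * exp (- P x))
      (\<lambda>x. 0 - ((p x * f x) * exp (- P x) + F x * (- p x * exp (- P x))))"
    by (intro ac_deriv_diff ac_deriv_const ac_deriv_mult F E)
  have "0 - F 0 * exp (- P 0) \<le> 0 - F x * exp (- P x)"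
  proof (rule ac_deriv_mono[OF G])
    fix t assume "t \<in> {0..x}"
    then have t: "t \<in> {0..1}" using x by auto
    have "p t * (F t - f t) * exp (- P t) \<ge> 0"
      using p0[OF t] le[OF t] by (auto simp: F_def)
    then show "0 \<le> 0 - ((p t * f t) * exp (- P t) + F t * (- p t * exp (- P t)))"
      by (simp add: algebra_simps)
  qed (use x in auto)
  then have "F x * exp (- P x) \<le> a" by (simp add: F_def P_def)
  then have "F x * exp (- P x) * exp (P x) \<le> a * exp (P x)" by (rule mult_right_mono) simp
  then have "F x \<le> a * exp (P x)" by (simp add: mult.assoc flip: exp_add)
  moreover have "f x \<le> F x" using le[OF x] by (simp add: F_def)
  ultimately show ?thesis by (simp add: P_def)
qed

text \<open>Approximate \<open>q\<close> in L^1 by a continuous function and that one uniformly by a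
  polynomial, for which integration by parts gains a factor 1/c. The phase \<open>d\<close> covers
  the sine as well as the cosine.\<close>

lemma riemann_lebesgue:
  fixes q :: "real \<Rightarrow> real"
  assumes q: "q absolutely_integrable_on {0..1}"
  shows "((\<lambda>c. integral {0..1} (\<lambda>x. q x * cos (c * x + d))) \<longlongrightarrow> 0) at_top"
proof (rule tendstoI)
  fix e :: real assume e: "e > 0"
  have e3: "e/3 > 0" using e by simp
  obtain g where g: "continuous_on UNIV g" "(\<lambda>x. q x - g x) absolutely_integrable_on {0..1}"
    "integral {0..1} (\<lambda>x. \<bar>q x - g x\<bar>) < e/3"
    using L1_continuous_approx[OF q e3] by blast
  obtain p where p: "real_polynomial_function p" "\<And>x. x \<in> {0..1} \<Longrightarrow> \<bar>g x - p x\<bar> < e/3"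
    using Stone_Weierstrass_real_polynomial_function[OF compact_Icc continuous_on_subset[OF g(1)] e3, of 0 1]
    by auto
  obtain p' where p': "real_polynomial_function p'" "\<And>x. (p has_real_derivative p' x) (at x)"
    using has_real_derivative_polynomial_function[OF p(1)] by blast
  have pc: "continuous_on S p" "continuous_on S p'" for S
    using p(1) p'(1) continuous_on_polymonial_function real_polynomial_function_eq by metis+
  obtain B where B: "B > 0" "\<And>x. x \<in> {0..1} \<Longrightarrow> \<bar>p x\<bar> \<le> B"
    using continuous_on_bounded_01[OF pc(1)] by blast
  obtain B' where B': "B' > 0" "\<And>x. x \<in> {0..1} \<Longrightarrow> \<bar>p' x\<bar> \<le> B'"
    using continuous_on_bounded_01[OF pc(2)] by blast
  have dint: "(\<lambda>x. \<bar>q x - g x\<bar>) integrable_on {0..1}"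
    using g(2) by (simp add: absolutely_integrable_on_def)
  \<comment> \<open>Beyond this threshold the bound (2 B + B') / c from integration by parts is
    below e/3; the other two thirds pay for the two approximations.\<close>
  have small: "\<bar>integral {0..1} (\<lambda>x. q x * cos (c * x + d))\<bar> < e"
    if c: "c > 3 * (2 * B + B') / e" for c
  proof -
    have "3 * (2 * B + B') / e > 0" using e B(1) B'(1) by (intro divide_pos_pos) auto
    then have c0: "c > 0" using c by linarith
    define F where "F x = p x * sin (c * x + d)" for x
    have cont: "continuous_on {0..1} (\<lambda>x. p' x * sin (c * x + d))"
      "continuous_on {0..1} (\<lambda>x. p x * cos (c * x + d))"
      by (intro continuous_intros pc)+
    have "((\<lambda>x. p' x * sin (c * x + d) + c * (p x * cos (c * x + d))) has_integral F 1 - F 0) {0..1}"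
    proof (rule fundamental_theorem_of_calculus)
      fix x :: real
      have "(F has_real_derivative p' x * sin (c * x + d) + c * (p x * cos (c * x + d))) (at x)"
        unfolding F_def by (rule derivative_eq_intros p' refl | simp)+
      then show "(F has_vector_derivative p' x * sin (c * x + d) + c * (p x * cos (c * x + d))) (at x within {0..1})"
        by (simp add: has_real_derivative_iff_has_vector_derivative[symmetric] has_field_derivative_at_within)
    qed simp
    then have "F 1 - F 0 = integral {0..1} (\<lambda>x. p' x * sin (c * x + d) + c * (p x * cos (c * x + d)))"
      by (rule integral_unique[symmetric])
    also have "\<dots> = integral {0..1} (\<lambda>x. p' x * sin (c * x + d)) + integral {0..1} (\<lambda>x. c * (p x * cos (c * x + d)))"
      using cont by (intro integral_add integrable_continuous_interval continuous_on_mult_left)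
    finally have "F 1 - F 0 = integral {0..1} (\<lambda>x. p' x * sin (c * x + d)) + c * integral {0..1} (\<lambda>x. p x * cos (c * x + d))"
      by simp
    moreover have "\<bar>F x\<bar> \<le> B" if "x \<in> {0..1}" for x
      using mult_mono[OF B(2)[OF that] abs_sin_le_one[of "c * x + d"]] B(1) by (simp add: F_def abs_mult)
    then have "\<bar>F 1\<bar> \<le> B" "\<bar>F 0\<bar> \<le> B" by auto
    moreover have "norm (integral {0..1} (\<lambda>x. p' x * sin (c * x + d))) \<le> integral {0..1} (\<lambda>x::real. B')"
    proof (rule integral_norm_bound_integral)
      show "norm (p' x * sin (c * x + d)) \<le> B'" if "x \<in> {0..1}" for x
        using mult_mono[OF B'(2)[OF that] abs_sin_le_one[of "c*x+d"]] B'(1) by (simp add: abs_mult)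
    qed (use cont integrable_continuous_interval in auto)
    ultimately have "c * \<bar>integral {0..1} (\<lambda>x. p x * cos (c * x + d))\<bar> \<le> 2 * B + B'"
      using c0 by (simp add: abs_mult[of c, symmetric, simplified abs_of_pos[OF c0]])
    also have "\<dots> < c * (e/3)" using c e by (simp add: field_simps)
    finally have pb: "\<bar>integral {0..1} (\<lambda>x. p x * cos (c * x + d))\<bar> < e/3" using c0 by simp
    have qc: "(\<lambda>x. q x * cos (c * x + d)) integrable_on {0..1}"
      by (rule set_lebesgue_integral_eq_integral(1)[OF absolutely_integrable_mult_continuous[OF _ q]])
        (intro continuous_intros)
    have pi: "(\<lambda>x. p x * cos (c * x + d)) integrable_on {0..1}"
      using cont(2) by (rule integrable_continuous_interval)
    have "norm (integral {0..1} (\<lambda>x. q x * cos (c * x + d) - p x * cos (c * x + d)))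
        \<le> integral {0..1} (\<lambda>x. \<bar>q x - g x\<bar> + e/3)"
    proof (rule integral_norm_bound_integral)
      show "(\<lambda>x. q x * cos (c * x + d) - p x * cos (c * x + d)) integrable_on {0..1}"
        using qc pi by (rule integrable_diff)
      show "(\<lambda>x. \<bar>q x - g x\<bar> + e/3) integrable_on {0..1}" using dint by (intro integrable_add) auto
      fix x :: real assume x: "x \<in> {0..1}"
      have "q x * cos (c * x + d) - p x * cos (c * x + d) = (q x - p x) * cos (c * x + d)"
        by (simp add: algebra_simps)
      then have "norm (q x * cos (c * x + d) - p x * cos (c * x + d)) \<le> \<bar>q x - p x\<bar> * 1"
        using abs_cos_le_one[of "c*x+d"] by (simp add: abs_mult mult_left_le)
      then show "norm (q x * cos (c * x + d) - p x * cos (c * x + d)) \<le> \<bar>q x - g x\<bar> + e/3"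
        using p(2)[OF x] abs_triangle_ineq[of "q x - g x" "g x - p x"] by simp
    qed
    also have "\<dots> = integral {0..1} (\<lambda>x. \<bar>q x - g x\<bar>) + e/3"
      using dint by (subst integral_add) auto
    finally have "\<bar>integral {0..1} (\<lambda>x. q x * cos (c * x + d)) - integral {0..1} (\<lambda>x. p x * cos (c * x + d))\<bar>
        \<le> integral {0..1} (\<lambda>x. \<bar>q x - g x\<bar>) + e/3"
      using integral_diff[OF qc pi] by simp
    then show ?thesis using pb g(3) by linarith
  qed
  show "\<forall>\<^sub>F c in at_top. dist (integral {0..1} (\<lambda>x. q x * cos (c * x + d))) 0 < e"
    using eventually_gt_at_top[of "3 * (2 * B + B') / e"] by eventually_elim (use small in auto)
qed

section \<open>Existence of solutions\<close>

text \<open>The equation as a first-order pair: \<open>g\<close> stands for f'. The derivative of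
  \<open>f\<close> is one-sided at the ends, so \<open>g 0\<close> and \<open>g 1\<close> are the
  derivatives in the matching conditions.\<close>

definition sturm_solution :: "(real \<Rightarrow> real) \<Rightarrow> real \<Rightarrow> (real \<Rightarrow> real) \<Rightarrow> (real \<Rightarrow> real) \<Rightarrow> bool" where
  "sturm_solution q l f g \<longleftrightarrow>
     (\<forall>x\<in>{0..1}. (f has_real_derivative g x) (at x within {0..1})) \<and>
     ac_deriv g (\<lambda>x. (q x - l) * f x)"

text \<open>The integral operator contracts by \<open>1/2\<close> on all of \<open>[0,1]\<close> in the sup norm weighted with
  \<open>exp (- 2 \<integral>|q - l|)\<close> (Bielecki).\<close>

lemma sturm_solution_exists:
  fixes a b l :: real
  assumes q: "q absolutely_integrable_on {0..1}"
  obtains f g where "sturm_solution q l f g" "f 0 = a" "g 0 = b"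
proof -
  define r where "r x = q x - l" for x
  have r: "r absolutely_integrable_on {0..1}"
    unfolding r_def using q by (rule set_integral_diff(1)) (auto simp: absolutely_integrable_on_def)
  have p: "(\<lambda>x. \<bar>r x\<bar>) absolutely_integrable_on {0..1}" using r by (rule set_integrable_abs)
  define P where "P x = integral {0..x} (\<lambda>x. \<bar>r x\<bar>)" for x
  have P: "ac_deriv P (\<lambda>x. \<bar>r x\<bar>)"
    unfolding P_def using ac_deriv_indefinite_integral[OF p, of 0] by simp
  \<comment> \<open>The exponent 2 produces the contraction factor 1/2: the integral of w |r| from 0
    to t is (w t - 1) / 2.\<close>
  define w where "w x = exp (2 * P x)" for x
  have w: "ac_deriv w (\<lambda>x. w x * (2 * \<bar>r x\<bar>))"
    unfolding w_def using ac_deriv_exp[OF ac_deriv_cmult[OF P]] by simp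
  have wc: "continuous_on {0..1} w" using w by (rule ac_deriv_continuous_on)
  have w0: "w 0 = 1" by (simp add: w_def P_def)
  have wpos: "0 < w x" for x by (simp add: w_def)
  have wmono: "w x \<le> w y" if "0 \<le> x" "x \<le> y" "y \<le> 1" for x y
    by (rule ac_deriv_mono[OF w]) (use that less_imp_le[OF wpos] in auto)
  have w1: "((\<lambda>x. w x * \<bar>r x\<bar>) has_integral (w t - 1) / 2) {0..t}" if "0 \<le> t" "t \<le> 1" for t
    using has_integral_cmul[OF ac_deriv_has_integral[OF w, of 0 t], of "1/2"] that w0
    by (simp add: algebra_simps)
  define I where "I \<phi> t = integral {0..t} (\<lambda>x. r x * (w x * \<phi> x))" for \<phi> :: "real \<Rightarrow> real" and t
  have rI: "(\<lambda>x. r x * (w x * \<phi> x)) absolutely_integrable_on {0..1}" if "continuous_on {0..1} \<phi>" for \<phi>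
    by (rule absolutely_integrable_mult_continuous[OF _ r]) (intro continuous_intros wc that)
  have I: "ac_deriv (\<lambda>t. b + I \<phi> t) (\<lambda>x. r x * (w x * \<phi> x))" if "continuous_on {0..1} \<phi>" for \<phi>
    unfolding I_def by (rule ac_deriv_indefinite_integral[OF rI[OF that]])
  have Ic: "continuous_on {0..1} (I \<phi>)" if "continuous_on {0..1} \<phi>" for \<phi>
    using continuous_on_diff[OF ac_deriv_continuous_on[OF I[OF that]] continuous_on_const, of b] by simp
  define J where "J \<phi> x = integral {0..x} (I \<phi>)" for \<phi> x
  have J: "(J \<phi> has_real_derivative I \<phi> x) (at x within {0..1})"
    if "continuous_on {0..1} \<phi>" "x \<in> {0..1}" for \<phi> x
    unfolding J_def by (rule integral_has_real_derivative[OF Ic[OF that(1)] that(2)])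
  \<comment> \<open>The unknown is f / w, so the weighted sup norm of f becomes the plain one; f is
    to solve the twice integrated equation f = a + b x + \<integral>\<integral> r f.\<close>
  define u where "u \<phi> x = (a + b * x + J \<phi> x) / w x" for \<phi> x
  have uc: "continuous_on {0..1} (u \<phi>)" if "continuous_on {0..1} \<phi>" for \<phi>
  proof -
    have "continuous_on {0..1} (J \<phi>)"
      using J[OF that] by (meson DERIV_continuous_on)
    then show ?thesis unfolding u_def
      by (intro continuous_intros wc) (use wpos in \<open>auto simp: less_imp_neq[symmetric]\<close>)
  qed
  \<comment> \<open>Clamping to [0,1] carries functions on the interval into the complete space of
    bounded continuous functions on the line.\<close>
  define cl where "cl x = max 0 (min 1 x)" for x :: real
  have clr: "cl x \<in> {0..1}" for x by (auto simp: cl_def)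
  have cl_id: "cl x = x" if "x \<in> {0..1}" for x using that by (auto simp: cl_def)
  have cont: "continuous_on {0..1} (apply_bcontfun \<phi>)" for \<phi> :: "real \<Rightarrow>\<^sub>C real"
    by simp
  have bc: "(\<lambda>x. u \<phi> (cl x)) \<in> bcontfun" if \<phi>: "continuous_on {0..1} \<phi>" for \<phi>
  proof -
    have "continuous_on UNIV cl" unfolding cl_def by (intro continuous_intros)
    then have "continuous_on UNIV (\<lambda>x. u \<phi> (cl x))"
      by (rule continuous_on_compose2[OF uc[OF \<phi>]]) (use clr in auto)
    moreover obtain B where "\<And>x. x \<in> {0..1} \<Longrightarrow> \<bar>u \<phi> x\<bar> \<le> B"
      using continuous_on_bounded_01[OF uc[OF \<phi>]] by blast
    ultimately show ?thesis using clr by (intro bcontfun_normI[of _ B]) auto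
  qed
  define T where "T \<phi> = Bcontfun (\<lambda>x. u (apply_bcontfun \<phi>) (cl x))" for \<phi>
  have T: "apply_bcontfun (T \<phi>) x = u (apply_bcontfun \<phi>) (cl x)" for \<phi> x
    unfolding T_def using Bcontfun_inverse[OF bc[OF cont]] by simp
  have contr: "dist (T \<phi>) (T \<psi>) \<le> 1/2 * dist \<phi> \<psi>" for \<phi> \<psi>
  proof (rule dist_bound)
    fix x0 :: real
    define x where "x = cl x0"
    have x: "x \<in> {0..1}" unfolding x_def by (rule clr)
    let ?d = "dist \<phi> \<psi>"
    have Id: "\<bar>I \<phi> t - I \<psi> t\<bar> \<le> ?d * ((w t - 1) / 2)" if t: "t \<in> {0..1}" for t
    proof -
      have int: "(\<lambda>x. r x * (w x * \<phi> x)) integrable_on {0..t}" for \<phi> :: "real \<Rightarrow>\<^sub>C real"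
        by (rule integrable_subinterval_real[OF set_lebesgue_integral_eq_integral(1)[OF rI[OF cont]]])
         (use t in auto)
      have "I \<phi> t - I \<psi> t = integral {0..t} (\<lambda>x. r x * (w x * \<phi> x) - r x * (w x * \<psi> x))"
        unfolding I_def using int by (simp add: integral_diff)
      also have "norm \<dots> \<le> integral {0..t} (\<lambda>x. ?d * (w x * \<bar>r x\<bar>))"
      proof (rule integral_norm_bound_integral)
        show "(\<lambda>x. r x * (w x * \<phi> x) - r x * (w x * \<psi> x)) integrable_on {0..t}"
          by (intro integrable_diff int)
        show "(\<lambda>x. ?d * (w x * \<bar>r x\<bar>)) integrable_on {0..t}"
          using w1[of t] t by (intro integrable_on_mult_right) auto
        fix x
        have "r x * (w x * \<phi> x) - r x * (w x * \<psi> x) = (w x * r x) * (\<phi> x - \<psi> x)" by (simp add: algebra_simps)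
        then have "norm (r x * (w x * \<phi> x) - r x * (w x * \<psi> x)) = (w x * \<bar>r x\<bar>) * dist (\<phi> x) (\<psi> x)"
          using wpos[of x] by (simp add: abs_mult dist_real_def)
        also have "\<dots> \<le> (w x * \<bar>r x\<bar>) * ?d"
          using wpos[of x] by (intro mult_left_mono dist_bounded) auto
        finally show "norm (r x * (w x * \<phi> x) - r x * (w x * \<psi> x)) \<le> ?d * (w x * \<bar>r x\<bar>)"
          by (simp add: mult.commute)
      qed
      also have "\<dots> = ?d * ((w t - 1) / 2)"
        using integral_unique[OF w1[of t]] t by simp
      finally show ?thesis by simp
    qed
    have int: "I \<phi> integrable_on {0..x}" for \<phi> :: "real \<Rightarrow>\<^sub>C real"
      by (rule integrable_subinterval_real[OF integrable_continuous_interval[OF Ic[OF cont]]]) (use x in auto)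
    have "J \<phi> x - J \<psi> x = integral {0..x} (\<lambda>t. I \<phi> t - I \<psi> t)"
      unfolding J_def using int by (simp add: integral_diff)
    also have "norm \<dots> \<le> integral {0..x} (\<lambda>t. ?d * (w x / 2))"
    proof (rule integral_norm_bound_integral)
      show "(\<lambda>t. I \<phi> t - I \<psi> t) integrable_on {0..x}" by (intro integrable_diff int)
      fix t assume t: "t \<in> {0..x}"
      then have "\<bar>I \<phi> t - I \<psi> t\<bar> \<le> ?d * ((w t - 1) / 2)" using x by (intro Id) auto
      also have "\<dots> \<le> ?d * (w x / 2)" using wmono[of t x] t x by (intro mult_left_mono) auto
      finally show "norm (I \<phi> t - I \<psi> t) \<le> ?d * (w x / 2)" by simp
    qed auto
    also have "\<dots> = x * (?d * (w x / 2))" using x by simp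
    also have "\<dots> \<le> 1 * (?d * (w x / 2))" using x wpos[of x] by (intro mult_right_mono) auto
    finally have "\<bar>J \<phi> x - J \<psi> x\<bar> \<le> ?d / 2 * w x" by simp
    then have "\<bar>J \<phi> x - J \<psi> x\<bar> / w x \<le> ?d / 2" using wpos[of x] by (simp add: pos_divide_le_eq)
    moreover have "u \<phi> x - u \<psi> x = (J \<phi> x - J \<psi> x) / w x"
      by (simp add: u_def diff_divide_distrib[symmetric])
    ultimately show "dist (T \<phi> x0) (T \<psi> x0) \<le> 1/2 * dist \<phi> \<psi>"
      using wpos[of x] by (simp add: T x_def[symmetric] dist_real_def)
  qed
  obtain \<phi> where fp: "T \<phi> = \<phi>"
    using banach_fix_type[of "1/2" T] contr by auto
  define f where "f x = a + b * x + J \<phi> x" for x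
  have f: "f x = w x * \<phi> x" if "x \<in> {0..1}" for x
    using T[of \<phi> x] fp cl_id[OF that] wpos[of x] by (simp add: u_def f_def)
  show thesis
  proof (rule that)
    have "(f has_real_derivative b + I \<phi> x) (at x within {0..1})" if "x \<in> {0..1}" for x
      unfolding f_def by (rule derivative_eq_intros J[OF cont that] refl | simp)+
    moreover have "ac_deriv (\<lambda>t. b + I \<phi> t) (\<lambda>x. (q x - l) * f x)"
      by (rule ac_deriv_cong[OF I[OF cont]]) (auto simp: f r_def)
    ultimately show "sturm_solution q l f (\<lambda>t. b + I \<phi> t)"
      by (simp add: sturm_solution_def)
    show "f 0 = a" by (simp add: f_def J_def)
    show "b + I \<phi> 0 = b" by (simp add: I_def)
  qed
qed

section \<open>Solutions on an edge\<close>

lemma sturm_solution_deriv: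
  "sturm_solution q l f g \<Longrightarrow> x \<in> {0..1} \<Longrightarrow> (f has_real_derivative g x) (at x within {0..1})"
  by (simp add: sturm_solution_def)

lemma sturm_solution_ac2: "sturm_solution q l f g \<Longrightarrow> ac_deriv g (\<lambda>x. (q x - l) * f x)"
  by (simp add: sturm_solution_def)

lemma sturm_solution_ac1:
  assumes "sturm_solution q l f g"
  shows "ac_deriv f g"
  using sturm_solution_deriv[OF assms] ac_deriv_continuous_on[OF sturm_solution_ac2[OF assms]]
  by (rule ac_deriv_C1)

lemma sturm_solution_continuous_on:
  assumes "sturm_solution q l f g"
  shows "continuous_on {0..1} f" "continuous_on {0..1} g"
  using ac_deriv_continuous_on[OF sturm_solution_ac1[OF assms]]
    ac_deriv_continuous_on[OF sturm_solution_ac2[OF assms]] .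

lemma sturm_solution_lincomb:
  assumes "sturm_solution q l f g" "sturm_solution q l h k"
  shows "sturm_solution q l (\<lambda>x. a * f x + b * h x) (\<lambda>x. a * g x + b * k x)"
  unfolding sturm_solution_def
proof (intro conjI ballI)
  show "((\<lambda>x. a * f x + b * h x) has_real_derivative a * g x + b * k x) (at x within {0..1})"
    if "x \<in> {0..1}" for x
    by (rule derivative_eq_intros sturm_solution_deriv[OF assms(1) that]
        sturm_solution_deriv[OF assms(2) that] refl | simp)+
  show "ac_deriv (\<lambda>x. a * g x + b * k x) (\<lambda>x. (q x - l) * (a * f x + b * h x))"
    by (rule ac_deriv_cong[OF ac_deriv_add[OF ac_deriv_cmult[OF sturm_solution_ac2[OF assms(1)], of a]
      ac_deriv_cmult[OF sturm_solution_ac2[OF assms(2)], of b]]]) (auto simp: algebra_simps)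
qed

lemma sturm_solution_cong:
  assumes "sturm_solution q l f g" "\<And>x. x \<in> {0..1} \<Longrightarrow> f x = h x" "\<And>x. x \<in> {0..1} \<Longrightarrow> g x = k x"
  shows "sturm_solution q l h k"
  unfolding sturm_solution_def
proof (intro conjI ballI)
  show "(h has_real_derivative k x) (at x within {0..1})" if "x \<in> {0..1}" for x
    by (rule has_field_derivative_transform_within[of f _ _ _ 1])
      (use sturm_solution_deriv[OF assms(1) that] assms(2,3) that in auto)
  show "ac_deriv k (\<lambda>x. (q x - l) * h x)"
    by (rule ac_deriv_cong[OF sturm_solution_ac2[OF assms(1)]]) (use assms in auto)
qed

text \<open>The derivative of a Wronskian. Equal equations make it constant, different
  \<open>l\<close> and \<open>m\<close> give orthogonality of eigenfunctions, and
  \<open>r = 0\<close> gives Green's identity against a cosine.\<close>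

lemma sturm_solution_lagrange:
  assumes "sturm_solution q l f g" "sturm_solution r m h k"
  shows "ac_deriv (\<lambda>x. g x * h x - f x * k x) (\<lambda>x. ((q x - l) - (r x - m)) * (f x * h x))"
  by (rule ac_deriv_cong[OF ac_deriv_diff[OF
      ac_deriv_mult[OF sturm_solution_ac2[OF assms(1)] sturm_solution_ac1[OF assms(2)]]
      ac_deriv_mult[OF sturm_solution_ac1[OF assms(1)] sturm_solution_ac2[OF assms(2)]]]])
    (auto simp: algebra_simps)

lemma sturm_solution_wronskian:
  assumes "sturm_solution q l f g" "sturm_solution q l h k" "x \<in> {0..1}"
  shows "g x * h x - f x * k x = g 0 * h 0 - f 0 * k 0"
  using ac_deriv_integral[OF sturm_solution_lagrange[OF assms(1,2)], of x] assms(3) by simp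

text \<open>No absolute value is differentiated: |d| + |e| is the largest of the four combinations s
  d + t e with signs s and t, and each of these is integrated. The inhomogeneity \<open>c\<close>
  joins the initial value because x \<le> 1.\<close>

lemma gronwall_pair:
  fixes d e d' e' p :: "real \<Rightarrow> real"
  assumes d: "ac_deriv d d'" and e: "ac_deriv e e'"
    and p: "p absolutely_integrable_on {0..1}" and p0: "\<And>x. x \<in> {0..1} \<Longrightarrow> 0 \<le> p x" and c: "0 \<le> c"
    and le: "\<And>x. x \<in> {0..1} \<Longrightarrow> \<bar>d' x\<bar> + \<bar>e' x\<bar> \<le> p x * (\<bar>d x\<bar> + \<bar>e x\<bar>) + c"
    and x: "x \<in> {0..1}"
  shows "\<bar>d x\<bar> + \<bar>e x\<bar> \<le> (\<bar>d 0\<bar> + \<bar>e 0\<bar> + c) * exp (integral {0..1} p)"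
proof -
  let ?f = "\<lambda>x. \<bar>d x\<bar> + \<bar>e x\<bar>"
  have f: "continuous_on {0..1} ?f"
    by (intro continuous_intros ac_deriv_continuous_on[OF d] ac_deriv_continuous_on[OF e])
  have pf: "(\<lambda>t. p t * ?f t) integrable_on {0..1}"
    by (rule set_lebesgue_integral_eq_integral(1)[OF absolutely_integrable_mult_continuous[OF f p]])
  have pint: "p integrable_on {0..1}" using p by (rule set_lebesgue_integral_eq_integral(1))
  have est: "?f x \<le> (\<bar>d 0\<bar> + \<bar>e 0\<bar> + c) + integral {0..x} (\<lambda>t. p t * ?f t)" if x: "x \<in> {0..1}" for x
  proof -
    have pfx: "(\<lambda>t. p t * ?f t) integrable_on {0..x}"
      by (rule integrable_subinterval_real[OF pf]) (use x in auto)
    have key: "s * d x + t * e x \<le> (s * d 0 + t * e 0) + (integral {0..x} (\<lambda>t. p t * ?f t) + c)"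
      if st: "\<bar>s\<bar> = 1" "\<bar>t\<bar> = 1" for s t :: real
    proof -
      have "((\<lambda>y. s * d' y + t * e' y) has_integral (s * d x + t * e x) - (s * d 0 + t * e 0)) {0..x}"
        by (rule ac_deriv_has_integral[OF ac_deriv_add[OF ac_deriv_cmult[OF d] ac_deriv_cmult[OF e]]])
          (use x in auto)
      moreover have "((\<lambda>t. p t * ?f t + c) has_integral integral {0..x} (\<lambda>t. p t * ?f t) + c * x) {0..x}"
        using has_integral_add[OF integrable_integral[OF pfx] has_integral_const_real[of c 0 x]] x
        by (simp add: mult.commute)
      ultimately have "(s * d x + t * e x) - (s * d 0 + t * e 0) \<le> integral {0..x} (\<lambda>t. p t * ?f t) + c * x"
      proof (rule has_integral_le)
        fix y assume "y \<in> {0..x}"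
        then have "\<bar>d' y\<bar> + \<bar>e' y\<bar> \<le> p y * ?f y + c" using x by (intro le) auto
        moreover have "s * d' y \<le> \<bar>d' y\<bar>" "t * e' y \<le> \<bar>e' y\<bar>"
          using st abs_ge_self[of "s * d' y"] abs_ge_self[of "t * e' y"] by (simp_all add: abs_mult)
        ultimately show "s * d' y + t * e' y \<le> p y * ?f y + c" by linarith
      qed
      moreover have "c * x \<le> c" using x c by (simp add: mult_left_le)
      ultimately show ?thesis by linarith
    qed
    have "?f x = (if d x \<ge> 0 then 1 else -1) * d x + (if e x \<ge> 0 then 1 else -1) * e x" by auto
    also have "\<dots> \<le> ((if d x \<ge> 0 then 1 else -1) * d 0 + (if e x \<ge> 0 then 1 else -1) * e 0)
        + (integral {0..x} (\<lambda>t. p t * ?f t) + c)"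
      by (rule key) auto
    also have "\<dots> \<le> (\<bar>d 0\<bar> + \<bar>e 0\<bar>) + (integral {0..x} (\<lambda>t. p t * ?f t) + c)"
      by (intro add_mono order_refl) auto
    finally show ?thesis by simp
  qed
  have "?f x \<le> (\<bar>d 0\<bar> + \<bar>e 0\<bar> + c) * exp (integral {0..x} p)"
    by (rule gronwall[OF f p p0 est x])
  also have "\<dots> \<le> (\<bar>d 0\<bar> + \<bar>e 0\<bar> + c) * exp (integral {0..1} p)"
  proof -
    have "integral {0..x} p \<le> integral {0..1} p"
      by (rule integral_subset_le) (use x p0 pint in \<open>auto intro: integrable_subinterval_real[OF pint]\<close>)
    then show ?thesis using c by (intro mult_left_mono) auto
  qed
  finally show ?thesis .
qed

section \<open>Initial value problems and their dependence on the spectral parameter\<close>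

definition sl_sol :: "(real \<Rightarrow> real) \<Rightarrow> real \<Rightarrow> real \<Rightarrow> real \<Rightarrow> (real \<Rightarrow> real) \<times> (real \<Rightarrow> real)" where
  "sl_sol q l a b = (SOME p. sturm_solution q l (fst p) (snd p) \<and> fst p 0 = a \<and> snd p 0 = b)"

lemma sl_sol:
  assumes "q absolutely_integrable_on {0..1}"
  shows "sturm_solution q l (fst (sl_sol q l a b)) (snd (sl_sol q l a b))"
    "fst (sl_sol q l a b) 0 = a" "snd (sl_sol q l a b) 0 = b"
proof -
  obtain f g where "sturm_solution q l f g" "f 0 = a" "g 0 = b"
    using sturm_solution_exists[OF assms] by blast
  then have "\<exists>p. sturm_solution q l (fst p) (snd p) \<and> fst p 0 = a \<and> snd p 0 = b"
    by (intro exI[of _ "(f, g)"]) simp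
  from someI_ex[OF this] show "sturm_solution q l (fst (sl_sol q l a b)) (snd (sl_sol q l a b))"
    "fst (sl_sol q l a b) 0 = a" "snd (sl_sol q l a b) 0 = b"
    unfolding sl_sol_def by auto
qed

text \<open>The difference of the two solutions starts at 0 and solves the equation with
  inhomogeneity (m - l) f. The bound \<open>B\<close> concerns the fixed solution and
  \<open>R\<close> frees the exponent from \<open>m\<close>, so the estimate is uniform along a
  bounded sequence of parameters.\<close>

lemma sturm_solution_dependence:
  assumes q: "q absolutely_integrable_on {0..1}"
    and f: "sturm_solution q l f g" and h: "sturm_solution q m h k" "h 0 = f 0" "k 0 = g 0"
    and B: "\<And>x. x \<in> {0..1} \<Longrightarrow> \<bar>f x\<bar> \<le> B" and m: "\<bar>m\<bar> \<le> R" and x: "x \<in> {0..1}"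
  shows "\<bar>f x - h x\<bar> + \<bar>g x - k x\<bar> \<le> \<bar>m - l\<bar> * B * exp (integral {0..1} (\<lambda>x. 1 + R + \<bar>q x\<bar>))"
proof -
  have B0: "0 \<le> B" using B[of 0] by auto
  have "\<bar>f x - h x\<bar> + \<bar>g x - k x\<bar>
      \<le> (\<bar>f 0 - h 0\<bar> + \<bar>g 0 - k 0\<bar> + \<bar>m - l\<bar> * B) * exp (integral {0..1} (\<lambda>x. 1 + R + \<bar>q x\<bar>))"
  proof (rule gronwall_pair[OF ac_deriv_diff[OF sturm_solution_ac1[OF f] sturm_solution_ac1[OF h(1)]]
        ac_deriv_diff[OF sturm_solution_ac2[OF f] sturm_solution_ac2[OF h(1)]] _ _ _ _ x])
    show "(\<lambda>x. 1 + R + \<bar>q x\<bar>) absolutely_integrable_on {0..1}"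
      using q by (intro set_integral_add set_integrable_abs) (auto simp: absolutely_integrable_on_def)
    fix y :: real assume y: "y \<in> {0..1}"
    show "0 \<le> 1 + R + \<bar>q y\<bar>" using m by auto
    have "(q y - l) * f y - (q y - m) * h y = (q y - m) * (f y - h y) + (m - l) * f y"
      by (simp add: algebra_simps)
    then have "\<bar>(q y - l) * f y - (q y - m) * h y\<bar> \<le> \<bar>q y - m\<bar> * \<bar>f y - h y\<bar> + \<bar>m - l\<bar> * \<bar>f y\<bar>"
      by (metis abs_mult abs_triangle_ineq)
    also have "\<dots> \<le> (R + \<bar>q y\<bar>) * \<bar>f y - h y\<bar> + \<bar>m - l\<bar> * B"
      using m B[OF y] by (intro add_mono mult_right_mono mult_left_mono) auto
    finally have "\<bar>(q y - l) * f y - (q y - m) * h y\<bar> \<le> (R + \<bar>q y\<bar>) * \<bar>f y - h y\<bar> + \<bar>m - l\<bar> * B" .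
    moreover have "0 \<le> (R + \<bar>q y\<bar>) * \<bar>g y - k y\<bar>" using m by auto
    ultimately show "\<bar>g y - k y\<bar> + \<bar>(q y - l) * f y - (q y - m) * h y\<bar>
        \<le> (1 + R + \<bar>q y\<bar>) * (\<bar>f y - h y\<bar> + \<bar>g y - k y\<bar>) + \<bar>m - l\<bar> * B"
      using abs_ge_zero[of "f y - h y"] by (simp add: algebra_simps del: abs_ge_zero)
  qed (use B0 in auto)
  then show ?thesis using h(2,3) by simp
qed

text \<open>Joint continuity in parameter and point; moving points serve to follow places where a
  sine solution fails to be positive.\<close>

lemma sl_sol_tendsto:
  assumes q: "q absolutely_integrable_on {0..1}" and L: "L \<longlonglongrightarrow> l"
    and X: "\<And>n. X n \<in> {0..1}" "X \<longlonglongrightarrow> x"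
  shows "(\<lambda>n. fst (sl_sol q (L n) a b) (X n)) \<longlonglongrightarrow> fst (sl_sol q l a b) x"
    "(\<lambda>n. snd (sl_sol q (L n) a b) (X n)) \<longlonglongrightarrow> snd (sl_sol q l a b) x"
proof -
  let ?f = "fst (sl_sol q l a b)" and ?g = "snd (sl_sol q l a b)"
  note s = sl_sol[OF q]
  have x: "x \<in> {0..1}" using closed_sequentially[of "{0..1}" X x] X by auto
  obtain B where B: "B > 0" "\<And>x. x \<in> {0..1} \<Longrightarrow> \<bar>?f x\<bar> \<le> B"
    using continuous_on_bounded_01[OF sturm_solution_continuous_on(1)[OF s(1)]] by blast
  obtain R where R: "\<And>n. \<bar>L n\<bar> \<le> R"
    using L convergent_imp_Bseq[of L] unfolding convergent_def Bseq_def by auto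
  define K where "K = B * exp (integral {0..1} (\<lambda>x. 1 + R + \<bar>q x\<bar>))"
  have le: "\<bar>?f (X n) - fst (sl_sol q (L n) a b) (X n)\<bar> + \<bar>?g (X n) - snd (sl_sol q (L n) a b) (X n)\<bar>
      \<le> \<bar>L n - l\<bar> * K" for n
    using sturm_solution_dependence[OF q s(1)[of l a b] s(1)[of "L n" a b] _ _ B(2) R[of n] X(1)[of n]] s(2,3)
    by (simp add: K_def mult.assoc)
  have "(\<lambda>n. \<bar>L n - l\<bar> * K) \<longlonglongrightarrow> \<bar>l - l\<bar> * K" by (intro tendsto_intros L)
  then have K0: "(\<lambda>n. \<bar>L n - l\<bar> * K) \<longlonglongrightarrow> 0" by simp
  have d1: "(\<lambda>n. ?f (X n) - fst (sl_sol q (L n) a b) (X n)) \<longlonglongrightarrow> 0"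
    by (rule Lim_null_comparison[OF _ K0], intro always_eventually allI order_trans[OF _ le]) simp
  have d2: "(\<lambda>n. ?g (X n) - snd (sl_sol q (L n) a b) (X n)) \<longlonglongrightarrow> 0"
    by (rule Lim_null_comparison[OF _ K0], intro always_eventually allI order_trans[OF _ le]) simp
  have ev: "\<forall>\<^sub>F n in sequentially. X n \<in> {0..1}" using X(1) by (intro always_eventually) blast
  have f: "(\<lambda>n. ?f (X n)) \<longlonglongrightarrow> ?f x"
    by (rule continuous_on_tendsto_compose[OF sturm_solution_continuous_on(1)[OF s(1)] X(2) x ev])
  have g: "(\<lambda>n. ?g (X n)) \<longlonglongrightarrow> ?g x"
    by (rule continuous_on_tendsto_compose[OF sturm_solution_continuous_on(2)[OF s(1)] X(2) x ev])
  show "(\<lambda>n. fst (sl_sol q (L n) a b) (X n)) \<longlonglongrightarrow> ?f x"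
    using tendsto_diff[OF f d1] by simp
  show "(\<lambda>n. snd (sl_sol q (L n) a b) (X n)) \<longlonglongrightarrow> ?g x"
    using tendsto_diff[OF g d2] by simp
qed

text \<open>Cramer's rule: the Wronskians of \<open>f\<close> with the two fundamental solutions are
  constant, hence given by \<open>g 0\<close> and \<open>f 0\<close>, and the fundamental solutions
  have Wronskian 1 up to sign. In particular the initial data determine a solution.\<close>

lemma sturm_solution_expand:
  assumes q: "q absolutely_integrable_on {0..1}" and f: "sturm_solution q l f g" and x: "x \<in> {0..1}"
  shows "f x = f 0 * fst (sl_sol q l 1 0) x + g 0 * fst (sl_sol q l 0 1) x"
    "g x = f 0 * snd (sl_sol q l 1 0) x + g 0 * snd (sl_sol q l 0 1) x"
proof -
  let ?c = "fst (sl_sol q l 1 0) x" and ?c' = "snd (sl_sol q l 1 0) x"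
  let ?s = "fst (sl_sol q l 0 1) x" and ?s' = "snd (sl_sol q l 0 1) x"
  note s = sl_sol[OF q]
  have w: "?c' * ?s - ?c * ?s' = - 1" "g x * ?c - f x * ?c' = g 0" "g x * ?s - f x * ?s' = - f 0"
    using sturm_solution_wronskian[OF s(1)[of l 1 0] s(1)[of l 0 1] x]
      sturm_solution_wronskian[OF f s(1)[of l 1 0] x] sturm_solution_wronskian[OF f s(1)[of l 0 1] x]
    by (simp_all add: s)
  have w3: "f x * ?s' - g x * ?s = f 0" using w(3) by linarith
  have w1: "?c * ?s' - ?c' * ?s = 1" using w(1) by linarith
  have "f x = f x * (?c * ?s' - ?c' * ?s)" using w1 by simp
  also have "\<dots> = (f x * ?s' - g x * ?s) * ?c + (g x * ?c - f x * ?c') * ?s" by (simp add: algebra_simps)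
  finally show "f x = f 0 * ?c + g 0 * ?s" unfolding w3 w(2) .
  have "g x = g x * (?c * ?s' - ?c' * ?s)" using w1 by simp
  also have "\<dots> = (f x * ?s' - g x * ?s) * ?c' + (g x * ?c - f x * ?c') * ?s'" by (simp add: algebra_simps)
  finally show "g x = f 0 * ?c' + g 0 * ?s'" unfolding w3 w(2) .
qed

section \<open>Translation between \<open>edge_solution\<close> and
  \<open>sturm_solution\<close>\<close>

lemma absolutely_integrable_on_Icc_iff_Ioo:
  fixes f :: "real \<Rightarrow> real"
  shows "f absolutely_integrable_on {a..b} \<longleftrightarrow> f absolutely_integrable_on {a<..<b}"
  by (simp add: absolutely_integrable_on_def integrable_on_Icc_iff_Ioo)

lemma edge_solution_imp_sturm_solution:
  assumes "edge_solution q l f"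
  shows "sturm_solution q l f (edge_deriv f)"
  unfolding sturm_solution_def
proof (intro conjI ballI)
  show "(f has_real_derivative edge_deriv f x) (at x within {0..1})" if "x \<in> {0..1}" for x
    using assms that unfolding edge_solution_def edge_deriv_def differentiable_on_def
    by (simp add: has_real_derivative_iff_has_vector_derivative vector_derivative_works[symmetric])
  have "AE x in lebesgue. x \<in> {0<..<1} \<longrightarrow>
      (\<exists>d. (edge_deriv f has_real_derivative d) (at x) \<and> - d + q x * f x = l * f x)"
    using assms by (simp add: edge_solution_def)
  then obtain N where N: "N \<in> null_sets lebesgue" "{x. \<not> (x \<in> {0<..<1} \<longrightarrow>
      (\<exists>d. (edge_deriv f has_real_derivative d) (at x) \<and> - d + q x * f x = l * f x))} \<subseteq> N"
    by (auto simp: eventually_ae_filter)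
  show "ac_deriv (edge_deriv f) (\<lambda>x. (q x - l) * f x)"
  proof (rule ac_derivI)
    show "AC (edge_deriv f)" using assms by (simp add: edge_solution_def)
    show "negligible N" using N(1) by (simp add: negligible_iff_null_sets)
    fix x :: real assume "0 < x" "x < 1" "x \<notin> N"
    then obtain d where "(edge_deriv f has_real_derivative d) (at x)" "- d + q x * f x = l * f x"
      using N(2) by auto
    moreover from this(2) have "d = (q x - l) * f x" by (simp add: algebra_simps)
    ultimately show "(edge_deriv f has_real_derivative (q x - l) * f x) (at x)" by simp
  qed
qed

lemma edge_deriv_eqI:
  assumes "(f has_real_derivative d) (at x within {0..1})" "x \<in> {0..1}"
  shows "edge_deriv f x = d"
  unfolding edge_deriv_def using assms
  by (intro vector_derivative_within_closed_interval)
    (auto simp: has_real_derivative_iff_has_vector_derivative)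

lemma sturm_solution_imp_edge_solution:
  assumes "sturm_solution q l f g"
  shows "edge_solution q l f" "\<And>x. x \<in> {0..1} \<Longrightarrow> edge_deriv f x = g x"
proof -
  show eq: "edge_deriv f x = g x" if "x \<in> {0..1}" for x
    using edge_deriv_eqI[OF sturm_solution_deriv[OF assms that] that] .
  have ac: "ac_deriv (edge_deriv f) (\<lambda>x. (q x - l) * f x)"
    by (rule ac_deriv_cong[OF sturm_solution_ac2[OF assms]]) (use eq in auto)
  obtain N where N: "AC (edge_deriv f)" "negligible N"
    "\<And>x. 0 < x \<Longrightarrow> x < 1 \<Longrightarrow> x \<notin> N \<Longrightarrow> (edge_deriv f has_real_derivative (q x - l) * f x) (at x)"
    using ac_derivE[OF ac] by blast
  have "AE x in lebesgue. x \<in> {0<..<1} \<longrightarrow>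
      (\<exists>d. (edge_deriv f has_real_derivative d) (at x) \<and> - d + q x * f x = l * f x)"
  proof (rule AE_I')
    show "N \<in> null_sets lebesgue" using N(2) by (simp add: negligible_iff_null_sets)
    show "{x \<in> space lebesgue. \<not> (x \<in> {0<..<1} \<longrightarrow>
      (\<exists>d. (edge_deriv f has_real_derivative d) (at x) \<and> - d + q x * f x = l * f x))} \<subseteq> N"
    proof (clarsimp, rule ccontr)
      fix x :: real assume x: "0 < x" "x < 1" "x \<notin> N"
        "\<forall>d. (edge_deriv f has_real_derivative d) (at x) \<longrightarrow> q x * f x - d \<noteq> l * f x"
      then show False using N(3)[of x] by (auto simp: algebra_simps)
    qed
  qed
  moreover have "f differentiable_on {0..1}"
    unfolding differentiable_on_def real_differentiable_def
    using sturm_solution_deriv[OF assms] by blast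
  ultimately show "edge_solution q l f"
    using N(1) sturm_solution_ac1[OF assms] by (simp add: edge_solution_def ac_deriv_def)
qed

section \<open>The boundary form of an edge\<close>

text \<open>Named after the case \<open>q = 0\<close>, l = \<nu>^2 > 0, where on [0,1]
  \<open>cs\<close> is cos(\<nu> x) and \<open>sn\<close> is sin(\<nu> x) / \<nu>.\<close>

abbreviation cs :: "(real \<Rightarrow> real) \<Rightarrow> real \<Rightarrow> real \<Rightarrow> real" where "cs q l \<equiv> fst (sl_sol q l 1 0)"
abbreviation cs' :: "(real \<Rightarrow> real) \<Rightarrow> real \<Rightarrow> real \<Rightarrow> real" where "cs' q l \<equiv> snd (sl_sol q l 1 0)"
abbreviation sn :: "(real \<Rightarrow> real) \<Rightarrow> real \<Rightarrow> real \<Rightarrow> real" where "sn q l \<equiv> fst (sl_sol q l 0 1)"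
abbreviation sn' :: "(real \<Rightarrow> real) \<Rightarrow> real \<Rightarrow> real \<Rightarrow> real" where "sn' q l \<equiv> snd (sl_sol q l 0 1)"

text \<open>By Sturm's theory this says that \<open>l\<close> lies below the lowest Dirichlet
  eigenvalue of the edge, the first pole of the boundary form in \<open>l\<close>.\<close>

definition positive_sine :: "(real \<Rightarrow> real) \<Rightarrow> real \<Rightarrow> bool" where
  "positive_sine q l \<longleftrightarrow> (\<forall>x. 0 < x \<longrightarrow> x \<le> 1 \<longrightarrow> 0 < sn q l x)"

lemma positive_sineD: "positive_sine q l \<Longrightarrow> 0 < x \<Longrightarrow> x \<le> 1 \<Longrightarrow> 0 < sn q l x"
  by (simp add: positive_sine_def)

lemma positive_sine_neq: "positive_sine q l \<Longrightarrow> sn q l 1 \<noteq> 0"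
  using positive_sineD[of q l 1] by simp

text \<open>For a solution \<open>f\<close> with \<open>f 0 = a\<close>, \<open>f 1 = b\<close>, this is \<open>f' 1 * b' - f' 0 * a'\<close>, provided
  \<open>sn q l 1 \<noteq> 0\<close>; otherwise it is the junk value \<open>0\<close>.\<close>

definition edge_form :: "(real \<Rightarrow> real) \<Rightarrow> real \<Rightarrow> real \<Rightarrow> real \<Rightarrow> real \<Rightarrow> real \<Rightarrow> real" where
  "edge_form q l a b a' b' = (cs q l 1 * a * a' - a * b' - b * a' + sn' q l 1 * b * b') / sn q l 1"

lemma sl_wronskian:
  assumes "q absolutely_integrable_on {0..1}" "x \<in> {0..1}"
  shows "cs q l x * sn' q l x - cs' q l x * sn q l x = 1"
  using sturm_solution_wronskian[OF sl_sol(1)[OF assms(1), of l 1 0] sl_sol(1)[OF assms(1), of l 0 1] assms(2)]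
  by (simp add: sl_sol[OF assms(1)])

lemma edge_form_eq:
  assumes q: "q absolutely_integrable_on {0..1}" and s: "sn q l 1 \<noteq> 0" and f: "sturm_solution q l f g"
  shows "g 1 * b - g 0 * a = edge_form q l (f 0) (f 1) a b"
proof -
  have f1: "f 1 = f 0 * cs q l 1 + g 0 * sn q l 1" and g1: "g 1 = f 0 * cs' q l 1 + g 0 * sn' q l 1"
    using sturm_solution_expand[OF q f, of 1] by auto
  have "g 0 * sn q l 1 = f 1 - f 0 * cs q l 1" using f1 by simp
  moreover have "g 1 * sn q l 1 = sn' q l 1 * f 1 - f 0"
  proof -
    have "g 1 * sn q l 1 = f 0 * (cs' q l 1 * sn q l 1) + g 0 * sn q l 1 * sn' q l 1"
      by (simp add: g1 algebra_simps)
    \<comment> \<open>The Wronskian eliminates \<open>cs'\<close>; it is the reason why the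
      off-diagonal coefficients agree and the form is symmetric.\<close>
    also have "cs' q l 1 * sn q l 1 = cs q l 1 * sn' q l 1 - 1" using sl_wronskian[OF q, of 1 l] by simp
    also have "f 0 * (cs q l 1 * sn' q l 1 - 1) + g 0 * sn q l 1 * sn' q l 1 = sn' q l 1 * f 1 - f 0"
      by (simp add: f1 algebra_simps)
    finally show ?thesis .
  qed
  moreover have "(g 1 * b - g 0 * a) * sn q l 1 = (g 1 * sn q l 1) * b - (g 0 * sn q l 1) * a"
    by (simp add: algebra_simps)
  ultimately have "(g 1 * b - g 0 * a) * sn q l 1
      = cs q l 1 * f 0 * a - f 0 * b - f 1 * a + sn' q l 1 * f 1 * b"
    by (simp only:) (simp add: algebra_simps)
  then show ?thesis using s by (simp add: edge_form_def eq_divide_eq)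
qed

lemma edge_bvp:
  assumes q: "q absolutely_integrable_on {0..1}" and s: "sn q l 1 \<noteq> 0"
  obtains u u' where "sturm_solution q l u u'" "u 0 = a" "u 1 = b"
proof
  show "sturm_solution q l (\<lambda>x. a * cs q l x + (b - a * cs q l 1) / sn q l 1 * sn q l x)
      (\<lambda>x. a * cs' q l x + (b - a * cs q l 1) / sn q l 1 * sn' q l x)"
    by (intro sturm_solution_lincomb sl_sol q)
qed (use s in \<open>simp_all add: sl_sol[OF q]\<close>)

lemma sn_positive_near_0:
  assumes q: "q absolutely_integrable_on {0..1}"
  obtains d where "0 < d" "d \<le> 1" "\<And>x. 0 < x \<Longrightarrow> x < d \<Longrightarrow> 0 < sn q l x"
proof -
  have "(sn q l has_real_derivative 1) (at 0 within {0..1})"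
    using sturm_solution_deriv[OF sl_sol(1)[OF q], of 0 l 0 1] sl_sol(3)[OF q] by simp
  from has_real_derivative_pos_inc_right[OF this] obtain d where
    d: "d > 0" "\<And>h. 0 < h \<Longrightarrow> 0 + h \<in> {0..1} \<Longrightarrow> h < d \<Longrightarrow> sn q l 0 < sn q l (0 + h)"
    by auto
  show thesis
    by (rule that[of "min d 1"]) (use d sl_sol(2)[OF q, of l 0 1] in auto)
qed

text \<open>With \<open>Q' = q - \<integral>q\<close>, the derivative of \<open>f f' - Q f\<^sup>2\<close> is
  \<open>(f' - Q f)\<^sup>2 + (\<integral>q - l - Q\<^sup>2) f\<^sup>2\<close>.\<close>

lemma form_energy:
  assumes q: "q absolutely_integrable_on {0..1}"
  obtains l0 Q where "Q 0 = 0" "Q 1 = (0::real)"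
    "\<And>y l f g x. l < l0 \<Longrightarrow> sturm_solution q l f g \<Longrightarrow> 0 < x \<Longrightarrow> x \<le> 1 \<Longrightarrow> y \<in> {0..x} \<Longrightarrow> f y \<noteq> 0 \<Longrightarrow>
       f 0 * g 0 - Q 0 * (f 0)\<^sup>2 < f x * g x - Q x * (f x)\<^sup>2"
proof -
  define qb where "qb = integral {0..1} q"
  \<comment> \<open>An integrable \<open>q\<close> need not be bounded below, but its primitive is
    bounded. Subtracting the mean makes the primitive vanish at both ends, so the correction leaves
    the boundary terms of the edge intact.\<close>
  define Q where "Q x = 0 + integral {0..x} (\<lambda>x. q x - qb)" for x
  have "(\<lambda>x. q x - qb) absolutely_integrable_on {0..1}"
    using q by (rule set_integral_diff(1)) (auto simp: absolutely_integrable_on_def)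
  then have Q: "ac_deriv Q (\<lambda>x. q x - qb)"
    unfolding Q_def by (rule ac_deriv_indefinite_integral)
  have Q0: "Q 0 = 0" by (simp add: Q_def)
  have "q integrable_on {0..1}" using q by (rule set_lebesgue_integral_eq_integral(1))
  from Henstock_Kurzweil_Integration.integral_diff[OF this integrable_const_ivl[of qb 0 1]]
  have Q1: "Q 1 = 0" by (simp add: Q_def qb_def)
  obtain M where M: "\<And>x. x \<in> {0..1} \<Longrightarrow> \<bar>Q x\<bar> \<le> M"
    using continuous_on_bounded_01[OF ac_deriv_continuous_on[OF Q]] by blast
  \<comment> \<open>Since \<open>M\<close> bounds |Q|, for \<open>l\<close> below qb - M^2 the
    coefficient of f^2 in the energy derivative is at least a positive constant.\<close>
  show thesis
  proof (rule that[OF Q0 Q1, of "qb - M\<^sup>2"])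
    fix y l f g x
    assume l: "l < qb - M\<^sup>2" and f: "sturm_solution q l f g" and x: "0 < x" "x \<le> 1"
      and y: "y \<in> {0..x}" "f y \<noteq> (0::real)"
    note a1 = sturm_solution_ac1[OF f] and a2 = sturm_solution_ac2[OF f]
    have h: "ac_deriv (\<lambda>x. f x * g x - Q x * (f x * f x))
        (\<lambda>x. (g x * g x + f x * ((q x - l) * f x)) - ((q x - qb) * (f x * f x) + Q x * (g x * f x + f x * g x)))"
      by (intro ac_deriv_diff ac_deriv_mult a1 a2 Q)
    have fc: "continuous_on {0..x} f"
      using sturm_solution_continuous_on(1)[OF f] x by (auto intro: continuous_on_subset)
    let ?k = "qb - M\<^sup>2 - l"
    have i1: "((\<lambda>x. (g x * g x + f x * ((q x - l) * f x)) - ((q x - qb) * (f x * f x) + Q x * (g x * f x + f x * g x)))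
        has_integral (f x * g x - Q x * (f x * f x)) - (f 0 * g 0 - Q 0 * (f 0 * f 0))) {0..x}"
      by (rule ac_deriv_has_integral[OF h]) (use x in auto)
    have fi: "((\<lambda>x. ?k * (f x)\<^sup>2) has_integral integral {0..x} (\<lambda>x. ?k * (f x)\<^sup>2)) {0..x}"
      by (intro integrable_integral integrable_continuous_interval continuous_intros fc)
    have "integral {0..x} (\<lambda>x. ?k * (f x)\<^sup>2)
        \<le> (f x * g x - Q x * (f x * f x)) - (f 0 * g 0 - Q 0 * (f 0 * f 0))"
    proof (rule has_integral_le[OF fi i1])
      fix t assume "t \<in> {0..x}"
      then have "\<bar>Q t\<bar>\<^sup>2 \<le> M\<^sup>2" using M[of t] x by (intro power_mono) auto
      then have "?k * (f t)\<^sup>2 \<le> (qb - l - (Q t)\<^sup>2) * (f t)\<^sup>2" by (intro mult_right_mono) auto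
      also have "\<dots> \<le> (g t - Q t * f t)\<^sup>2 + (qb - l - (Q t)\<^sup>2) * (f t)\<^sup>2" by simp
      also have "\<dots> = (g t * g t + f t * ((q t - l) * f t)) - ((q t - qb) * (f t * f t) + Q t * (g t * f t + f t * g t))"
        by (simp add: power2_eq_square algebra_simps)
      finally show "?k * (f t)\<^sup>2 \<le> (g t * g t + f t * ((q t - l) * f t))
          - ((q t - qb) * (f t * f t) + Q t * (g t * f t + f t * g t))" .
    qed
    moreover have "0 < integral {0..x} (\<lambda>x. ?k * (f x)\<^sup>2)"
    proof -
      have "0 \<le> integral {0..x} (\<lambda>x. ?k * (f x)\<^sup>2)"
        by (rule has_integral_nonneg[OF fi]) (use l in auto)
      moreover have "integral {0..x} (\<lambda>x. ?k * (f x)\<^sup>2) \<noteq> 0"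
      proof
        assume "integral {0..x} (\<lambda>x. ?k * (f x)\<^sup>2) = 0"
        then have "\<forall>t\<in>{0..x}. ?k * (f t)\<^sup>2 = 0"
          by (subst (asm) integral_eq_0_iff) (use x l fc in \<open>auto intro!: continuous_intros\<close>)
        then show False using y l by auto
      qed
      ultimately show ?thesis by linarith
    qed
    ultimately show "f 0 * g 0 - Q 0 * (f 0)\<^sup>2 < f x * g x - Q x * (f x)\<^sup>2"
      by (simp add: power2_eq_square)
  qed
qed

text \<open>A sine solution that stops being positive has a zero t > 0 after a positive start; the
  energy then vanishes at 0 and at t although it strictly increases. At the ends of the edge the
  energy of \<open>u\<close> is u u', whose increment is the boundary form.\<close>

lemma edge_form_positive_eventually:
  assumes q: "q absolutely_integrable_on {0..1}"
  obtains l0 where "\<And>l. l < l0 \<Longrightarrow> positive_sine q l"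
    "\<And>l a b. l < l0 \<Longrightarrow> a \<noteq> 0 \<or> b \<noteq> 0 \<Longrightarrow> 0 < edge_form q l a b a b"
proof -
  obtain l0 Q where Q: "Q 0 = 0" "Q 1 = (0::real)"
    "\<And>y l f g x. l < l0 \<Longrightarrow> sturm_solution q l f g \<Longrightarrow> 0 < x \<Longrightarrow> x \<le> 1 \<Longrightarrow> y \<in> {0..x} \<Longrightarrow> f y \<noteq> 0 \<Longrightarrow>
       f 0 * g 0 - Q 0 * (f 0)\<^sup>2 < f x * g x - Q x * (f x)\<^sup>2"
    by (rule form_energy[OF q], rule that, assumption+)
  have pos: "positive_sine q l" if l: "l < l0" for l
  proof (rule ccontr)
    assume "\<not> positive_sine q l"
    then obtain x0 where x0: "0 < x0" "x0 \<le> 1" "sn q l x0 \<le> 0"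
      unfolding positive_sine_def by (meson not_less)
    obtain d where d: "0 < d" "d \<le> 1" "\<And>x. 0 < x \<Longrightarrow> x < d \<Longrightarrow> 0 < sn q l x"
      by (rule sn_positive_near_0[OF q, of l], rule that, assumption+)
    define z where "z = min d x0 / 2"
    have z: "0 < z" "z < d" "z < x0" using d x0 by (auto simp: z_def)
    have "continuous_on {z..x0} (sn q l)"
      by (rule continuous_on_subset[OF sturm_solution_continuous_on(1)[OF sl_sol(1)[OF q]]])
        (use z x0 in auto)
    then obtain t where t: "z \<le> t" "t \<le> x0" "sn q l t = 0"
      using IVT2'[of "sn q l" x0 0 z] x0 d(3)[OF z(1,2)] z by auto
    have "sn q l 0 * sn' q l 0 - Q 0 * (sn q l 0)\<^sup>2 < sn q l t * sn' q l t - Q t * (sn q l t)\<^sup>2"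
      by (rule Q(3)[OF l sl_sol(1)[OF q], of t z]) (use t z x0 d(3)[OF z(1,2)] in auto)
    then show False using t sl_sol(2)[OF q, of l 0 1] by simp
  qed
  moreover have "0 < edge_form q l a b a b" if l: "l < l0" and ab: "a \<noteq> 0 \<or> b \<noteq> 0" for l a b
  proof -
    have s: "sn q l 1 \<noteq> 0" using pos[OF l] by (rule positive_sine_neq)
    obtain u u' where u: "sturm_solution q l u u'" "u 0 = a" "u 1 = b" by (rule edge_bvp[OF q s])
    have "u 0 * u' 0 - Q 0 * (u 0)\<^sup>2 < u 1 * u' 1 - Q 1 * (u 1)\<^sup>2"
    proof (cases "a = 0")
      case True then show ?thesis using ab u by (intro Q(3)[OF l u(1), of 1 1]) auto
    next
      case False then show ?thesis using u by (intro Q(3)[OF l u(1), of 1 0]) auto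
    qed
    then show ?thesis using edge_form_eq[OF q s u(1), of b a] u(2,3) Q(1,2) by (simp add: mult.commute)
  qed
  ultimately show thesis using that by blast
qed

text \<open>Integrate the Riccati equation \<open>(w'/w)' = q - l - (w'/w)\<^sup>2\<close> for the solution with
  \<open>w 0 = w 1 = 1\<close>, which is positive because \<open>w / sn q l\<close> decreases.\<close>

lemma edge_form_test_function:
  assumes q: "q absolutely_integrable_on {0..1}" and pos: "positive_sine q l"
  shows "edge_form q l 1 1 1 1 \<le> integral {0..1} q - l"
    "edge_form q l 1 1 1 1 = integral {0..1} q - l \<Longrightarrow> AE x in lebesgue. x \<in> {0<..<1} \<longrightarrow> q x = l"
proof -
  have s: "sn q l 1 \<noteq> 0" using pos by (rule positive_sine_neq)
  obtain w w' where w: "sturm_solution q l w w'" "w 0 = 1" "w 1 = 1" by (rule edge_bvp[OF q s])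
  have s0: "sn q l 0 = 0" "sn' q l 0 = 1" using sl_sol(2,3)[OF q] by auto
  have wpos: "0 < w x" if x: "x \<in> {0..1}" for x
  proof (cases "x = 0 \<or> x = 1")
    case False
    then have x: "0 < x" "x < 1" using x by auto
    have spos: "0 < sn q l t" if "t \<in> {x..1}" for t using positive_sineD[OF pos] that x by simp
    have W: "w t * sn' q l t - w' t * sn q l t = 1" if "t \<in> {0..1}" for t
      using sturm_solution_wronskian[OF w(1) sl_sol(1)[OF q] that, of 0 1] w(2) s0 by simp
    \<comment> \<open>The Wronskian of \<open>w\<close> and \<open>sn q l\<close> is constantly w(0)
      = 1, so this quotient has derivative -1 / sn^2.\<close>
    have "w 1 / sn q l 1 < w x / sn q l x"
    proof (rule DERIV_neg_imp_decreasing_open[OF x(2)])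
      fix t assume t: "x < t" "t < 1"
      then have t01: "t \<in> {0..1}" using x by auto
      have at: "at t within {0..1} = at t" using t x by (intro at_within_Icc_at) auto
      have "((\<lambda>t. w t / sn q l t) has_real_derivative
          (w' t * sn q l t - w t * sn' q l t) / (sn q l t * sn q l t)) (at t)"
        by (rule DERIV_divide)
          (use sturm_solution_deriv[OF w(1) t01] sturm_solution_deriv[OF sl_sol(1)[OF q] t01, of l 0 1]
            spos[of t] t at in auto)
      moreover have "(w' t * sn q l t - w t * sn' q l t) / (sn q l t * sn q l t) < 0"
        using W[OF t01] spos[of t] t by (intro divide_neg_pos) auto
      ultimately show "\<exists>y. ((\<lambda>t. w t / sn q l t) has_real_derivative y) (at t) \<and> y < 0" by blast
    next
      show "continuous_on {x..1} (\<lambda>t. w t / sn q l t)"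
        by (intro continuous_on_divide continuous_on_subset[OF sturm_solution_continuous_on(1)[OF w(1)]]
            continuous_on_subset[OF sturm_solution_continuous_on(1)[OF sl_sol(1)[OF q]]])
          (use x spos in \<open>auto simp: less_imp_neq[symmetric]\<close>)
    qed
    moreover have "0 < w 1 / sn q l 1" using w(3) spos[of 1] x by simp
    ultimately have "0 < w x / sn q l x" by linarith
    then show ?thesis using spos[of x] x by (simp add: zero_less_divide_iff)
  qed (use w in auto)
  have qi: "q integrable_on {0..1}" using q by (rule set_lebesgue_integral_eq_integral(1))
  have wc: "continuous_on {0..1} w" "continuous_on {0..1} w'"
    using sturm_solution_continuous_on[OF w(1)] by auto
  have wc2: "continuous_on {0..1} (\<lambda>x. (w' x / w x)\<^sup>2)" "continuous_on {0..1} (\<lambda>x. - (w' x / (w x * w x)))"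
    by (intro continuous_intros wc, use wpos in force)+
  have "ac_deriv (\<lambda>x. inverse (w x)) (\<lambda>x. - (w' x / (w x * w x)))"
  proof (rule ac_deriv_C1[OF _ wc2(2)])
    fix x :: real assume x: "x \<in> {0..1}"
    show "((\<lambda>x. inverse (w x)) has_real_derivative - (w' x / (w x * w x))) (at x within {0..1})"
      using DERIV_inverse_fun[OF sturm_solution_deriv[OF w(1) x]] wpos[OF x]
      by (simp add: divide_inverse mult.assoc mult.left_commute)
  qed
  from ac_deriv_mult[OF sturm_solution_ac2[OF w(1)] this]
  have "ac_deriv (\<lambda>x. w' x * inverse (w x)) (\<lambda>x. q x - l - (w' x / w x)\<^sup>2)"
    by (rule ac_deriv_cong) (use wpos in \<open>auto simp: power2_eq_square field_simps less_imp_neq[symmetric]\<close>)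
  from ac_deriv_has_integral[OF this, of 0 1]
  have i1: "((\<lambda>x. q x - l - (w' x / w x)\<^sup>2) has_integral (w' 1 - w' 0)) {0..1}"
    using w by simp
  have i2: "((\<lambda>x. (w' x / w x)\<^sup>2) has_integral integral {0..1} (\<lambda>x. (w' x / w x)\<^sup>2)) {0..1}"
    by (intro integrable_integral integrable_continuous_interval wc2)
  have i3: "((\<lambda>x. q x - l) has_integral (integral {0..1} q - l)) {0..1}"
    using has_integral_diff[OF integrable_integral[OF qi] has_integral_const_real[of l 0 1]] by simp
  have "integral {0..1} q - l = (w' 1 - w' 0) + integral {0..1} (\<lambda>x. (w' x / w x)\<^sup>2)"
    using has_integral_unique[OF i3] has_integral_add[OF i1 i2] by simp
  moreover have "edge_form q l 1 1 1 1 = w' 1 - w' 0"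
    using edge_form_eq[OF q s w(1), of 1 1] w(2,3) by simp
  ultimately have eq: "integral {0..1} q - l = edge_form q l 1 1 1 1 + integral {0..1} (\<lambda>x. (w' x / w x)\<^sup>2)"
    by simp
  have "0 \<le> integral {0..1} (\<lambda>x. (w' x / w x)\<^sup>2)" by (rule has_integral_nonneg[OF i2]) auto
  then show "edge_form q l 1 1 1 1 \<le> integral {0..1} q - l" using eq by simp
  \<comment> \<open>Equality kills the integral of (w'/w)^2, so w' vanishes throughout and the
    equation leaves (q - l) w = 0 almost everywhere, with w > 0.\<close>
  assume "edge_form q l 1 1 1 1 = integral {0..1} q - l"
  then have "integral {0..1} (\<lambda>x. (w' x / w x)\<^sup>2) = 0" using eq by simp
  then have "\<forall>x\<in>{0..1}. (w' x / w x)\<^sup>2 = 0"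
    by (subst (asm) integral_eq_0_iff) (use wc2 in auto)
  then have w'0: "w' x = 0" if "x \<in> {0..1}" for x using wpos[OF that] that by force
  obtain N where "AC w'" and N: "negligible N"
    "\<And>x. 0 < x \<Longrightarrow> x < 1 \<Longrightarrow> x \<notin> N \<Longrightarrow> (w' has_real_derivative (q x - l) * w x) (at x)"
    by (rule ac_derivE[OF sturm_solution_ac2[OF w(1)]], rule that, assumption+)
  show "AE x in lebesgue. x \<in> {0<..<1} \<longrightarrow> q x = l"
  proof (rule AE_I')
    show "N \<in> null_sets lebesgue" using N(1) by (simp add: negligible_iff_null_sets)
    show "{x \<in> space lebesgue. \<not> (x \<in> {0<..<1} \<longrightarrow> q x = l)} \<subseteq> N"
    proof (clarify, rule ccontr)
      fix x :: real assume x: "x \<in> {0<..<1}" "q x \<noteq> l" "x \<notin> N"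
      have "(w' has_real_derivative 0) (at x)"
        by (rule has_field_derivative_transform_within_open[of "\<lambda>_. 0" 0 x "{0<..<1}"])
          (use x w'0 in auto)
      then have "(q x - l) * w x = 0" using N(2)[of x] x DERIV_unique by force
      then show False using wpos[of x] x by simp
    qed
  qed
qed

section \<open>The form on vertex functions\<close>

lemma finite_family_convergent_subseq:
  fixes f :: "'i \<Rightarrow> nat \<Rightarrow> real"
  assumes "finite I" "\<And>i n. i \<in> I \<Longrightarrow> \<bar>f i n\<bar> \<le> B i"
  shows "\<exists>r lim. strict_mono (r :: nat \<Rightarrow> nat) \<and> (\<forall>i\<in>I. (\<lambda>n. f i (r n)) \<longlonglongrightarrow> lim i)"
  using assms
proof (induction I)
  case empty
  then show ?case by (auto intro!: exI[of _ id] simp: strict_mono_def)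
next
  case (insert j I)
  have "\<And>i n. i \<in> I \<Longrightarrow> \<bar>f i n\<bar> \<le> B i" using insert.prems by simp
  from insert.IH[OF this] obtain r lim where
    r: "strict_mono (r :: nat \<Rightarrow> nat)" "\<forall>i\<in>I. (\<lambda>n. f i (r n)) \<longlonglongrightarrow> lim i"
    by blast
  have "\<forall>n. f j (r n) \<in> {- B j..B j}"
    using insert.prems[of j] by (auto simp: abs_le_iff minus_le_iff)
  then obtain l s where s: "strict_mono (s :: nat \<Rightarrow> nat)" "((\<lambda>n. f j (r n)) \<circ> s) \<longlonglongrightarrow> l"
    using compact_Icc[of "- B j" "B j"] unfolding compact_def by meson
  show ?case
  proof (intro exI conjI ballI)
    show "strict_mono (r \<circ> s)" using r(1) s(1) by (rule strict_mono_o)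
    fix i assume i: "i \<in> insert j I"
    show "(\<lambda>n. f i ((r \<circ> s) n)) \<longlonglongrightarrow> (if i = j then l else lim i)"
    proof (cases "i = j")
      case False
      then have "i \<in> I" using i by simp
      from LIMSEQ_subseq_LIMSEQ[OF r(2)[rule_format, OF this] s(1)] show ?thesis using False by (simp add: o_def)
    qed (use s(2) in \<open>simp add: o_def\<close>)
  qed
qed

lemma cs_sn_tendsto:
  assumes "q absolutely_integrable_on {0..1}" "L \<longlonglongrightarrow> l"
  shows "(\<lambda>n. cs q (L n) 1) \<longlonglongrightarrow> cs q l 1" "(\<lambda>n. sn q (L n) 1) \<longlonglongrightarrow> sn q l 1"
    "(\<lambda>n. sn' q (L n) 1) \<longlonglongrightarrow> sn' q l 1"
  using sl_sol_tendsto[OF assms, of "\<lambda>_. 1" 1] by auto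

text \<open>A limit of positive sines can vanish only at \<open>1\<close>, and there the boundary form would tend to
  \<open>-\<infinity>\<close> at \<open>(1, 1)\<close>.\<close>

lemma positive_sine_limit:
  assumes q: "q absolutely_integrable_on {0..1}" and L: "L \<longlonglongrightarrow> l"
    and pos: "\<And>n. positive_sine q (L n)"
    and C: "C \<longlonglongrightarrow> C'" "\<And>n. - C n \<le> edge_form q (L n) 1 1 1 1"
  shows "positive_sine q l"
  unfolding positive_sine_def
proof (intro allI impI)
  have s0: "sn q l 0 = 0" "sn' q l 0 = 1" for l using sl_sol(2,3)[OF q] by auto
  have nonneg: "0 \<le> sn q l x" if x: "x \<in> {0..1}" for x
  proof (rule LIMSEQ_le_const[OF sl_sol_tendsto(1)[OF q L, of "\<lambda>_. x" x]])
    have "0 \<le> sn q (L n) x" for n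
      using positive_sineD[OF pos[of n], of x] x s0(1)[of "L n"] by (cases "x = 0") auto
    then show "\<exists>N. \<forall>n\<ge>N. 0 \<le> sn q (L n) x" by blast
  qed (use x in auto)
  fix x :: real assume x: "0 < x" "x \<le> 1"
  then have x01: "x \<in> {0..1}" by simp
  have der: "(sn q l has_real_derivative sn' q l t) (at t within {0..1})" if "t \<in> {0..1}" for t
    by (rule sturm_solution_deriv[OF sl_sol(1)[OF q] that])
  have "sn q l x \<noteq> 0"
  proof
    assume zero: "sn q l x = 0"
    show False
    proof (cases "x = 1")
      case True
      \<comment> \<open>At a zero at 1 the product of \<open>cs\<close> and \<open>sn'\<close> is 1,
        and a nonnegative sine reaching 0 from the left has slope at most 0. So both factors are
        negative, against the limit of the form bound, which says that their sum is at least
        2.\<close>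
      have W: "cs q l 1 * sn' q l 1 = 1"
        using sl_wronskian[OF q, of 1 l] zero True by simp
      \<comment> \<open>Clearing the denominator lets the inequality pass to a limit in which it
        tends to 0.\<close>
      have "- C n * sn q (L n) 1 \<le> cs q (L n) 1 + sn' q (L n) 1 - 2" for n
        using C(2)[of n] positive_sineD[OF pos[of n], of 1] by (simp add: edge_form_def pos_le_divide_eq)
      then have "- C' * sn q l 1 \<le> cs q l 1 + sn' q l 1 - 2"
        by (intro LIMSEQ_le[OF tendsto_mult[OF tendsto_minus[OF C(1)] cs_sn_tendsto(2)[OF q L]]
          tendsto_diff[OF tendsto_add[OF cs_sn_tendsto(1)[OF q L] cs_sn_tendsto(3)[OF q L]] tendsto_const]])
          auto
      then have ge: "2 \<le> cs q l 1 + sn' q l 1" using zero True by simp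
      have "sn' q l 1 \<le> 0"
      proof (rule ccontr)
        assume "\<not> sn' q l 1 \<le> 0"
        then obtain d where d: "d > 0" "\<And>h. 0 < h \<Longrightarrow> 1 - h \<in> {0..1} \<Longrightarrow> h < d \<Longrightarrow> sn q l (1 - h) < sn q l 1"
          using has_real_derivative_pos_inc_left[OF der[of 1]] by auto
        have "sn q l (1 - min (d/2) 1) < sn q l 1" using d(1) by (intro d(2)) auto
        then show False using nonneg[of "1 - min (d/2) 1"] zero True d(1) by auto
      qed
      moreover from this W have "cs q l 1 < 0"
        using mult_nonneg_nonpos[of "cs q l 1" "sn' q l 1"] by force
      ultimately show False using ge by linarith
    next
      case False
      \<comment> \<open>An interior zero of a nonnegative function is a minimum, hence a double
        zero, which the Wronskian excludes.\<close>
      then have "(sn q l has_real_derivative sn' q l x) (at x)"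
        using der[OF x01] at_within_Icc_at[of 0 x 1] x by simp
      moreover have "\<forall>y. \<bar>x - y\<bar> < min x (1 - x) \<longrightarrow> sn q l x \<le> sn q l y"
      proof (intro allI impI)
        fix y assume "\<bar>x - y\<bar> < min x (1 - x)"
        then have "y \<in> {0..1}" by (auto simp: abs_less_iff)
        then show "sn q l x \<le> sn q l y" using nonneg zero by simp
      qed
      ultimately have "sn' q l x = 0"
        using DERIV_local_min[of "sn q l" "sn' q l x" x "min x (1 - x)"] x False by auto
      then show False using sl_wronskian[OF q x01, of l] zero by simp
    qed
  qed
  then show "0 < sn q l x" using nonneg[OF x01] by simp
qed

text \<open>Points where positivity fails accumulate at some x. For x > 0 continuity contradicts
  positivity at \<open>l\<close>. At x = 0, where every sine vanishes, failure forces points T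
  tending to 0 with nonpositive slope, against slope 1 at 0.\<close>

lemma positive_sine_open:
  assumes q: "q absolutely_integrable_on {0..1}" and L: "L \<longlonglongrightarrow> l" and pos: "positive_sine q l"
  shows "\<forall>\<^sub>F n in sequentially. positive_sine q (L n)"
proof (rule ccontr)
  assume "\<not> ?thesis"
  from not_eventually_sequentiallyD[OF this]
  obtain r :: "nat \<Rightarrow> nat" where r: "strict_mono r" "\<And>n. \<not> positive_sine q (L (r n))" by blast
  then have "\<forall>n. \<exists>x. 0 < x \<and> x \<le> 1 \<and> sn q (L (r n)) x \<le> 0"
    unfolding positive_sine_def by (meson not_less)
  then obtain X where X: "\<And>n. 0 < X n" "\<And>n. X n \<le> 1" "\<And>n. sn q (L (r n)) (X n) \<le> 0" by metis
  have "\<forall>n. X n \<in> {0..1}" using X by (simp add: less_imp_le)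
  then obtain x s where s: "x \<in> {0..1}" "strict_mono (s :: nat \<Rightarrow> nat)" "(X \<circ> s) \<longlonglongrightarrow> x"
    using compact_Icc[of 0 "1::real"] unfolding compact_def by meson
  have L': "(\<lambda>n. L (r (s n))) \<longlonglongrightarrow> l"
    using LIMSEQ_subseq_LIMSEQ[OF L strict_mono_o[OF r(1) s(2)]] by (simp add: o_def)
  have X': "(\<lambda>n. X (s n)) \<longlonglongrightarrow> x" using s(3) by (simp add: o_def)
  have s0: "sn q l 0 = 0" "sn' q l 0 = 1" for l using sl_sol(2,3)[OF q] by auto
  show False
  proof (cases "x = 0")
    case False
    have "(\<lambda>n. sn q (L (r (s n))) (X (s n))) \<longlonglongrightarrow> sn q l x"
      by (rule sl_sol_tendsto(1)[OF q L' _ X']) (use X in \<open>simp add: less_imp_le\<close>)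
    then have "sn q l x \<le> 0" by (rule LIMSEQ_le_const2) (use X(3) in blast)
    then show False using positive_sineD[OF pos, of x] False s(1) by auto
  next
    case True
    have "\<exists>t. 0 \<le> t \<and> t \<le> X (s n) \<and> sn' q (L (r (s n))) t \<le> 0" for n
    proof (rule ccontr)
      let ?l = "L (r (s n))"
      assume neg: "\<not> (\<exists>t. 0 \<le> t \<and> t \<le> X (s n) \<and> sn' q ?l t \<le> 0)"
      have "sn q ?l 0 < sn q ?l (X (s n))"
      proof (rule DERIV_pos_imp_increasing_open[OF X(1)])
        fix t assume t: "0 < t" "t < X (s n)"
        then have "t < 1" using X(2)[of "s n"] by linarith
        then have "(sn q ?l has_real_derivative sn' q ?l t) (at t)"
          using sturm_solution_deriv[OF sl_sol(1)[OF q], of t ?l 0 1] at_within_Icc_at[of 0 t 1] t by simp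
        moreover have "0 < sn' q ?l t" using neg t by (meson less_imp_le not_less)
        ultimately show "\<exists>y. (sn q ?l has_real_derivative y) (at t) \<and> 0 < y" by blast
      next
        show "continuous_on {0..X (s n)} (sn q ?l)"
          by (rule continuous_on_subset[OF sturm_solution_continuous_on(1)[OF sl_sol(1)[OF q]]])
            (use X(2) in auto)
      qed
      then show False using X(3)[of "s n"] s0 by simp
    qed
    then obtain T where T: "\<And>n. 0 \<le> T n" "\<And>n. T n \<le> X (s n)" "\<And>n. sn' q (L (r (s n))) (T n) \<le> 0"
      by metis
    have "T \<longlonglongrightarrow> 0"
      by (rule tendsto_sandwich[OF _ _ tendsto_const X'[unfolded True]]) (use T in auto)
    then have "(\<lambda>n. sn' q (L (r (s n))) (T n)) \<longlonglongrightarrow> sn' q l 0"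
      using T(1) order_trans[OF T(2) X(2)] by (intro sl_sol_tendsto(2)[OF q L']) auto
    then have "sn' q l 0 \<le> 0" by (rule LIMSEQ_le_const2) (use T(3) in blast)
    then show False using s0 by simp
  qed
qed

section \<open>Vertex functions on a connected graph and their quadratic form\<close>

lemma connected_propagate:
  assumes "Digraph_Component.connected G" and "\<And>e. e \<in> arcs G \<Longrightarrow> \<xi> (head G e) = \<xi> (tail G e)"
    and "u \<in> verts G" "v \<in> verts G"
  shows "\<xi> u = \<xi> v"
proof -
  have "u \<rightarrow>\<^sup>*\<^bsub>with_proj (mk_symmetric G)\<^esub> v"
    using assms(1,3,4) unfolding Digraph_Component.connected_def strongly_connected_def by simp
  then have "(u, v) \<in> rtrancl_on (verts G) (parcs (mk_symmetric G))"
    unfolding reachable_def by simp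
  then show ?thesis
    by induction (use assms(2) in \<open>auto simp: parcs_mk_symmetric\<close>)
qed

lemma connected_incident:
  assumes "fin_digraph G" "Digraph_Component.connected G" "card (arcs G) \<ge> 1" "v \<in> verts G"
  obtains e where "e \<in> arcs G" "tail G e = v \<or> head G e = v"
proof (rule ccontr)
  interpret fin_digraph G by fact
  assume *: "\<not> thesis"
  note witness = that
  have no: "tail G e \<noteq> v \<and> head G e \<noteq> v" if "e \<in> arcs G" for e
    using * witness[OF that] by blast
  obtain e where e: "e \<in> arcs G" using assms(3) by fastforce
  \<comment> \<open>For an isolated \<open>v\<close> the predicate of being \<open>v\<close> is the
    same at both ends of every arc, so connectedness would make it constant on the graph.\<close>
  have "(v = v) = (tail G e = v)"
    by (rule connected_propagate[OF assms(2), of "\<lambda>u. u = v"]) (use no e assms(4) in auto)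
  then show False using no[OF e] by simp
qed

text \<open>If no sine solution vanishes at 1, solve the equation on each edge with the values of
  \<open>\<xi>\<close> at its ends; the form pairs \<open>\<eta>\<close> with the Kirchhoff defects
  of the result, the entering minus the leaving derivatives at each vertex.\<close>

definition graph_form ::
    "('v, 'e) pre_digraph \<Rightarrow> ('e \<Rightarrow> real \<Rightarrow> real) \<Rightarrow> real \<Rightarrow> ('v \<Rightarrow> real) \<Rightarrow> ('v \<Rightarrow> real) \<Rightarrow> real" where
  "graph_form G q l \<xi> \<eta> =
     (\<Sum>e\<in>arcs G. edge_form (q e) l (\<xi> (tail G e)) (\<xi> (head G e)) (\<eta> (tail G e)) (\<eta> (head G e)))"

lemma graph_form_add_scaled:
  "graph_form G q l (\<lambda>v. \<xi> v + t * \<eta> v) (\<lambda>v. \<xi> v + t * \<eta> v)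
     = graph_form G q l \<xi> \<xi> + 2 * t * graph_form G q l \<xi> \<eta> + t\<^sup>2 * graph_form G q l \<eta> \<eta>"
proof -
  have "edge_form p l (a + t * a') (b + t * b') (a + t * a') (b + t * b')
      = edge_form p l a b a b + 2 * t * edge_form p l a b a' b' + t\<^sup>2 * edge_form p l a' b' a' b'"
    for p a b a' b'
  proof -
    have "cs p l 1 * (a + t * a') * (a + t * a') - (a + t * a') * (b + t * b') - (b + t * b') * (a + t * a')
          + sn' p l 1 * (b + t * b') * (b + t * b')
        = (cs p l 1 * a * a - a * b - b * a + sn' p l 1 * b * b)
          + 2 * t * (cs p l 1 * a * a' - a * b' - b * a' + sn' p l 1 * b * b')
          + t\<^sup>2 * (cs p l 1 * a' * a' - a' * b' - b' * a' + sn' p l 1 * b' * b')"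
      by (simp add: power2_eq_square algebra_simps)
    moreover have "(x + 2 * t * y + t\<^sup>2 * z) / w = x / w + 2 * t * (y / w) + t\<^sup>2 * (z / w)" for x y z w :: real
      by (simp add: add_divide_distrib)
    ultimately show ?thesis unfolding edge_form_def by (simp only:)
  qed
  then show ?thesis by (simp add: graph_form_def sum.distrib sum_distrib_left)
qed

text \<open>\<open>\<xi>\<close> minimises a semidefinite form, so the first variation vanishes in
  every direction.\<close>

lemma graph_form_null:
  assumes psd: "\<And>\<eta>. 0 \<le> graph_form G q l \<eta> \<eta>" and null: "graph_form G q l \<xi> \<xi> = 0"
  shows "graph_form G q l \<xi> \<eta> = 0"
proof (rule ccontr)
  let ?b = "graph_form G q l \<xi> \<eta>" and ?c = "graph_form G q l \<eta> \<eta>"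
  assume b: "?b \<noteq> 0"
  have le: "0 \<le> 2 * t * ?b + t\<^sup>2 * ?c" for t
    using psd[of "\<lambda>v. \<xi> v + t * \<eta> v"] null unfolding graph_form_add_scaled by simp
  have c: "0 \<le> ?c" by (rule psd)
  \<comment> \<open>The minimiser t = -b/c is undefined for c = 0. With k = c + 1 the choice t =
    -b/k is always available and still brings the value down to at most -b^2/k.\<close>
  define k where "k = ?c + 1"
  have k: "0 < k" "?c \<le> k" using c by (auto simp: k_def)
  have "0 \<le> 2 * (- ?b / k) * ?b + (- ?b / k)\<^sup>2 * ?c" by (rule le)
  also have "\<dots> \<le> 2 * (- ?b / k) * ?b + (- ?b / k)\<^sup>2 * k"
    using k(2) by (intro add_left_mono mult_left_mono) auto
  also have "\<dots> = - (?b\<^sup>2 / k)" using k(1) by (simp add: power2_eq_square)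
  finally show False using b k(1) by (simp add: divide_le_0_iff)
qed

text \<open>Extend the null vector edge by edge: continuity holds by construction, and testing with
  the indicator of a vertex gives the Kirchhoff condition there.\<close>

lemma eigenvalue_of_null_vector:
  fixes G :: "('v, 'e) pre_digraph"
  assumes G: "fin_digraph G" and q: "\<And>e. e \<in> arcs G \<Longrightarrow> q e absolutely_integrable_on {0..1}"
    and s: "\<And>e. e \<in> arcs G \<Longrightarrow> sn (q e) l 1 \<noteq> 0"
    and null: "\<And>\<eta>. graph_form G q l \<xi> \<eta> = 0"
    and e0: "e0 \<in> arcs G" "\<xi> (tail G e0) \<noteq> 0 \<or> \<xi> (head G e0) \<noteq> 0"
  shows "is_eigenvalue G q l"
proof -
  interpret fin_digraph G by fact
  have "\<exists>u u'. e \<in> arcs G \<longrightarrow> sturm_solution (q e) l u u' \<and> u 0 = \<xi> (tail G e) \<and> u 1 = \<xi> (head G e)" for e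
    using edge_bvp[OF q s, of e] by metis
  then obtain u u' where u: "\<And>e. e \<in> arcs G \<Longrightarrow> sturm_solution (q e) l (u e) (u' e)"
    "\<And>e. e \<in> arcs G \<Longrightarrow> u e 0 = \<xi> (tail G e)" "\<And>e. e \<in> arcs G \<Longrightarrow> u e 1 = \<xi> (head G e)"
    by metis
  define y where "y e x = (if e \<in> arcs G \<and> x \<in> {0..1} then u e x else 0)" for e x
  have y: "sturm_solution (q e) l (y e) (u' e)" if "e \<in> arcs G" for e
    by (rule sturm_solution_cong[OF u(1)[OF that]]) (use that in \<open>auto simp: y_def\<close>)
  have yd: "edge_deriv (y e) x = u' e x" if "e \<in> arcs G" "x \<in> {0..1}" for e x
    by (rule sturm_solution_imp_edge_solution(2)[OF y[OF that(1)] that(2)])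
  have y01: "y e 0 = \<xi> (tail G e)" "y e 1 = \<xi> (head G e)" if "e \<in> arcs G" for e
    using u that by (auto simp: y_def)
  have "(\<Sum>e\<in>out_arcs G v. edge_deriv (y e) 0) = (\<Sum>e\<in>in_arcs G v. edge_deriv (y e) 1)" for v
  proof -
    let ?\<eta> = "\<lambda>w. if w = v then 1 else 0 :: real"
    have "graph_form G q l \<xi> ?\<eta> = (\<Sum>e\<in>arcs G. u' e 1 * ?\<eta> (head G e) - u' e 0 * ?\<eta> (tail G e))"
      unfolding graph_form_def
      by (rule sum.cong[OF refl]) (use edge_form_eq[OF q s u(1)] u(2,3) in simp)
    also have "\<dots> = (\<Sum>e\<in>arcs G. if head G e = v then u' e 1 else 0) - (\<Sum>e\<in>arcs G. if tail G e = v then u' e 0 else 0)"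
      unfolding sum_subtractf by (intro arg_cong2[where f="(-)"] sum.cong) auto
    also have "\<dots> = (\<Sum>e\<in>in_arcs G v. u' e 1) - (\<Sum>e\<in>out_arcs G v. u' e 0)"
      by (simp add: in_arcs_def out_arcs_def sum.inter_filter)
    finally show ?thesis using yd null[of ?\<eta>] by simp
  qed
  moreover have "y e \<kappa> = y e' \<kappa>'" if "attached G v e \<kappa>" "attached G v e' \<kappa>'" for v e e' \<kappa> \<kappa>'
    using that y01 unfolding attached_def by auto
  ultimately have "standard_matching G y" unfolding standard_matching_def by blast
  moreover have "edge_solution (q e) l (y e)" if "e \<in> arcs G" for e
    by (rule sturm_solution_imp_edge_solution(1)[OF y[OF that]])
  ultimately have "y \<in> eigenspace G q l" by (auto simp: eigenspace_def y_def)
  moreover have "y \<noteq> 0"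
  proof
    assume "y = 0"
    then have "y e0 0 = 0" "y e0 1 = 0" by simp_all
    then show False using e0 y01[OF e0(1)] by simp
  qed
  ultimately show ?thesis unfolding is_eigenvalue_def by blast
qed

section \<open>Definiteness of the form as the spectral parameter varies\<close>

definition form_positive :: "('v, 'e) pre_digraph \<Rightarrow> ('e \<Rightarrow> real \<Rightarrow> real) \<Rightarrow> real \<Rightarrow> bool" where
  "form_positive G q l \<longleftrightarrow> (\<forall>e\<in>arcs G. positive_sine (q e) l) \<and>
     (\<forall>\<xi>. (\<exists>v\<in>verts G. \<xi> v \<noteq> 0) \<longrightarrow> 0 < graph_form G q l \<xi> \<xi>)"

lemma graph_form_tendsto:
  assumes q: "\<And>e. e \<in> arcs G \<Longrightarrow> q e absolutely_integrable_on {0..1}" and L: "L \<longlonglongrightarrow> l"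
    and s: "\<And>e. e \<in> arcs G \<Longrightarrow> sn (q e) l 1 \<noteq> 0"
    and \<xi>: "\<And>e. e \<in> arcs G \<Longrightarrow> (\<lambda>n. \<Xi> n (tail G e)) \<longlonglongrightarrow> \<xi> (tail G e)"
      "\<And>e. e \<in> arcs G \<Longrightarrow> (\<lambda>n. \<Xi> n (head G e)) \<longlonglongrightarrow> \<xi> (head G e)"
  shows "(\<lambda>n. graph_form G q (L n) (\<Xi> n) (\<Xi> n)) \<longlonglongrightarrow> graph_form G q l \<xi> \<xi>"
  unfolding graph_form_def edge_form_def
  by (intro tendsto_sum tendsto_divide tendsto_add tendsto_diff tendsto_mult \<xi> s cs_sn_tendsto[OF q L])

text \<open>Positivity at the constant 1 bounds the form of one edge below by minus the forms of the
  others, and the test-function inequality bounds these above by a convergent sequence. This is what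
  \<open>positive_sine_limit\<close> asks for, so the limit is no pole.\<close>

lemma form_positive_limit:
  assumes G: "fin_digraph G" and q: "\<And>e. e \<in> arcs G \<Longrightarrow> q e absolutely_integrable_on {0..1}"
    and ne: "verts G \<noteq> {}" and L: "L \<longlonglongrightarrow> l" and pos: "\<And>n. form_positive G q (L n)"
  shows "\<And>e. e \<in> arcs G \<Longrightarrow> positive_sine (q e) l" "\<And>\<xi>. 0 \<le> graph_form G q l \<xi> \<xi>"
proof -
  interpret fin_digraph G by fact
  have ps: "positive_sine (q e) (L n)" if "e \<in> arcs G" for e n
    using pos[of n] that by (simp add: form_positive_def)
  show psl: "positive_sine (q e) l" if e: "e \<in> arcs G" for e
  proof (rule positive_sine_limit[OF q[OF e] L ps[OF e]])
    show "(\<lambda>n. \<Sum>f\<in>arcs G - {e}. integral {0..1} (q f) - L n)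
        \<longlonglongrightarrow> (\<Sum>f\<in>arcs G - {e}. integral {0..1} (q f) - l)"
      by (intro tendsto_intros L)
    fix n
    have "0 < graph_form G q (L n) (\<lambda>_. 1) (\<lambda>_. 1)"
      using pos[of n] ne unfolding form_positive_def by auto
    also have "\<dots> = edge_form (q e) (L n) 1 1 1 1 + (\<Sum>f\<in>arcs G - {e}. edge_form (q f) (L n) 1 1 1 1)"
      unfolding graph_form_def using e by (simp add: sum.remove)
    also have "\<dots> \<le> edge_form (q e) (L n) 1 1 1 1 + (\<Sum>f\<in>arcs G - {e}. integral {0..1} (q f) - L n)"
      by (intro add_left_mono sum_mono edge_form_test_function(1) q ps) auto
    finally show "- (\<Sum>f\<in>arcs G - {e}. integral {0..1} (q f) - L n) \<le> edge_form (q e) (L n) 1 1 1 1"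
      by linarith
  qed
  fix \<xi> :: "'a \<Rightarrow> real"
  have "0 \<le> graph_form G q (L n) \<xi> \<xi>" for n
  proof (cases "\<exists>v\<in>verts G. \<xi> v \<noteq> 0")
    case True
    then show ?thesis using pos[of n] by (simp add: form_positive_def less_imp_le)
  next
    case False
    then have "\<xi> (tail G e) = 0" "\<xi> (head G e) = 0" if "e \<in> arcs G" for e
      using that by auto
    then show ?thesis by (simp add: graph_form_def edge_form_def)
  qed
  then show "0 \<le> graph_form G q l \<xi> \<xi>"
    by (intro LIMSEQ_le_const[OF graph_form_tendsto[OF q L positive_sine_neq[OF psl] tendsto_const tendsto_const]])
      auto
qed

text \<open>Counterexamples normalised to the unit sphere of vertex functions have a limit point,
  which violates strict positivity at \<open>l\<close>.\<close>

lemma form_positive_open: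
  assumes G: "fin_digraph G" and q: "\<And>e. e \<in> arcs G \<Longrightarrow> q e absolutely_integrable_on {0..1}"
    and L: "L \<longlonglongrightarrow> l" and pos: "form_positive G q l"
  shows "\<forall>\<^sub>F n in sequentially. form_positive G q (L n)"
proof (rule ccontr)
  interpret fin_digraph G by fact
  assume no: "\<not> ?thesis"
  have psl: "positive_sine (q e) l" if "e \<in> arcs G" for e
    using pos that by (simp add: form_positive_def)
  have ev: "\<forall>\<^sub>F n in sequentially. \<forall>e\<in>arcs G. positive_sine (q e) (L n)"
    by (intro eventually_ball_finite ballI finite_arcs positive_sine_open[OF q L psl])
  have "\<not> (\<forall>\<^sub>F n in sequentially. (\<forall>\<xi>. (\<exists>v\<in>verts G. \<xi> v \<noteq> 0) \<longrightarrow> 0 < graph_form G q (L n) \<xi> \<xi>))"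
  proof
    assume "\<forall>\<^sub>F n in sequentially. (\<forall>\<xi>. (\<exists>v\<in>verts G. \<xi> v \<noteq> 0) \<longrightarrow> 0 < graph_form G q (L n) \<xi> \<xi>)"
    with ev have "\<forall>\<^sub>F n in sequentially. form_positive G q (L n)"
      unfolding form_positive_def by (rule eventually_conj)
    with no show False by blast
  qed
  from not_eventually_sequentiallyD[OF this] obtain r :: "nat \<Rightarrow> nat" where r: "strict_mono r"
    "\<forall>n. \<not> (\<forall>\<xi>. (\<exists>v\<in>verts G. \<xi> v \<noteq> 0) \<longrightarrow> 0 < graph_form G q (L (r n)) \<xi> \<xi>)"
    by blast
  then have "\<forall>n. \<exists>\<xi>. (\<exists>v\<in>verts G. \<xi> v \<noteq> 0) \<and> graph_form G q (L (r n)) \<xi> \<xi> \<le> 0"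
    by (simp add: not_less)
  from choice[OF this] obtain Z where
    Z: "\<And>n. \<exists>v\<in>verts G. Z n v \<noteq> 0" "\<And>n. graph_form G q (L (r n)) (Z n) (Z n) \<le> 0" by auto
  define S where "S n = (\<Sum>v\<in>verts G. (Z n v)\<^sup>2)" for n
  have S: "0 < S n" for n
  proof -
    obtain v where "v \<in> verts G" "Z n v \<noteq> 0" using Z(1) by blast
    then show ?thesis unfolding S_def by (intro sum_pos2[of _ v]) auto
  qed
  define Y where "Y v n = Z n v / sqrt (S n)" for v n
  have Y1: "(\<Sum>v\<in>verts G. (Y v n)\<^sup>2) = 1" for n
    using S[of n] by (simp add: Y_def power_divide S_def sum_divide_distrib[symmetric])
  have Yb: "\<bar>Y v n\<bar> \<le> 1" if "v \<in> verts G" for v n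
  proof -
    have "(Y v n)\<^sup>2 \<le> (\<Sum>v\<in>verts G. (Y v n)\<^sup>2)" using that by (intro member_le_sum) auto
    then show ?thesis using Y1[of n] by (simp add: abs_square_le_1)
  qed
  have YF: "graph_form G q (L (r n)) (\<lambda>v. Y v n) (\<lambda>v. Y v n) \<le> 0" for n
  proof -
    have "edge_form p m (a / c) (b / c) (a / c) (b / c) = edge_form p m a b a b / (c * c)" for p m a b c
      unfolding edge_form_def by (simp add: add_divide_distrib diff_divide_distrib ac_simps)
    then have "graph_form G q (L (r n)) (\<lambda>v. Y v n) (\<lambda>v. Y v n)
        = graph_form G q (L (r n)) (Z n) (Z n) / (sqrt (S n) * sqrt (S n))"
      by (simp add: graph_form_def Y_def sum_divide_distrib)
    also have "\<dots> \<le> 0" using Z(2)[of n] S[of n] by (intro divide_nonpos_nonneg) auto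
    finally show ?thesis .
  qed
  obtain s lim where s: "strict_mono (s :: nat \<Rightarrow> nat)" "\<forall>v\<in>verts G. (\<lambda>n. Y v (s n)) \<longlonglongrightarrow> lim v"
    using finite_family_convergent_subseq[OF finite_verts, of Y "\<lambda>_. 1"] Yb by blast
  have L': "(\<lambda>n. L (r (s n))) \<longlonglongrightarrow> l"
    using LIMSEQ_subseq_LIMSEQ[OF L strict_mono_o[OF r(1) s(1)]] by (simp add: o_def)
  have "(\<lambda>n. graph_form G q (L (r (s n))) (\<lambda>v. Y v (s n)) (\<lambda>v. Y v (s n))) \<longlonglongrightarrow> graph_form G q l lim lim"
    by (rule graph_form_tendsto[OF q L' positive_sine_neq[OF psl]]) (use s(2) in auto)
  then have "graph_form G q l lim lim \<le> 0"
    by (rule LIMSEQ_le_const2) (use YF in blast)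
  moreover have "(\<lambda>n. \<Sum>v\<in>verts G. (Y v (s n))\<^sup>2) \<longlonglongrightarrow> (\<Sum>v\<in>verts G. (lim v)\<^sup>2)"
    by (intro tendsto_intros) (use s(2) in auto)
  then have "(\<Sum>v\<in>verts G. (lim v)\<^sup>2) = 1" unfolding Y1 by (simp add: LIMSEQ_const_iff)
  then have "\<exists>v\<in>verts G. lim v \<noteq> 0"
    by (metis (no_types, lifting) sum.neutral zero_neq_one zero_power2)
  then have "0 < graph_form G q l lim lim" using pos by (simp add: form_positive_def)
  ultimately show False by simp
qed

lemma form_positive_below:
  assumes G: "fin_digraph G" "Digraph_Component.connected G" "card (arcs G) \<ge> 1"
    and q: "\<And>e. e \<in> arcs G \<Longrightarrow> q e absolutely_integrable_on {0..1}"
  shows "\<exists>l0. \<forall>l<l0. form_positive G q l"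
proof -
  interpret fin_digraph G by fact
  have "\<forall>e. \<exists>l0. e \<in> arcs G \<longrightarrow> (\<forall>l<l0. positive_sine (q e) l \<and>
      (\<forall>a b. a \<noteq> 0 \<or> b \<noteq> 0 \<longrightarrow> 0 < edge_form (q e) l a b a b))"
  proof
    fix e
    show "\<exists>l0. e \<in> arcs G \<longrightarrow> (\<forall>l<l0. positive_sine (q e) l \<and>
      (\<forall>a b. a \<noteq> 0 \<or> b \<noteq> 0 \<longrightarrow> 0 < edge_form (q e) l a b a b))"
    proof (cases "e \<in> arcs G")
      case True
      show ?thesis by (rule edge_form_positive_eventually[OF q[OF True]]) blast
    qed simp
  qed
  from choice[OF this] obtain m where m: "\<And>e l. e \<in> arcs G \<Longrightarrow> l < m e \<Longrightarrow> positive_sine (q e) l"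
    "\<And>e l a b. e \<in> arcs G \<Longrightarrow> l < m e \<Longrightarrow> a \<noteq> 0 \<or> b \<noteq> 0 \<Longrightarrow> 0 < edge_form (q e) l a b a b"
    by blast
  have "form_positive G q l" if l: "l < Min (m ` arcs G)" for l
  proof -
    have lm: "l < m e" if "e \<in> arcs G" for e
      using l that by (meson Min_le finite_arcs finite_imageI image_eqI less_le_trans)
    have nn: "0 \<le> edge_form (q e) l a b a b" if "e \<in> arcs G" for e a b
    proof (cases "a = 0 \<and> b = 0")
      case False then show ?thesis using m(2)[OF that lm[OF that], of a b] by auto
    qed (simp add: edge_form_def)
    have "0 < graph_form G q l \<xi> \<xi>" if v: "v \<in> verts G" "\<xi> v \<noteq> 0" for v \<xi>
    proof -
      obtain e where e: "e \<in> arcs G" "tail G e = v \<or> head G e = v"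
        using connected_incident[OF G v(1)] by blast
      have "0 < edge_form (q e) l (\<xi> (tail G e)) (\<xi> (head G e)) (\<xi> (tail G e)) (\<xi> (head G e))"
        by (rule m(2)[OF e(1) lm[OF e(1)]]) (use e v in auto)
      then show ?thesis unfolding graph_form_def
        by (intro sum_pos2[OF finite_arcs e(1)] nn) auto
    qed
    then show ?thesis unfolding form_positive_def using m(1) lm by blast
  qed
  then show ?thesis by blast
qed

theorem nonnegative_smallest_eigenvalue:
  fixes G :: "('v, 'e) pre_digraph"
  assumes G: "fin_digraph G" "Digraph_Component.connected G" "card (arcs G) \<ge> 1"
    and q: "\<And>e. e \<in> arcs G \<Longrightarrow> q e absolutely_integrable_on {0..1}"
    and small: "\<And>\<mu>. is_eigenvalue G q \<mu> \<Longrightarrow> 0 \<le> \<mu>"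
    and le: "(\<Sum>e\<in>arcs G. integral {0..1} (q e)) \<le> 0"
  shows "\<forall>e\<in>arcs G. AE x in lebesgue. x \<in> {0<..<1} \<longrightarrow> q e x = 0"
proof -
  interpret fin_digraph G by fact
  have ne: "verts G \<noteq> {}"
    using G(2) unfolding Digraph_Component.connected_def strongly_connected_def by auto
  have good: "form_positive G q l" if "l < 0" for l
  proof (rule ccontr)
    assume bad: "\<not> form_positive G q l"
    \<comment> \<open>Continuity method on l < 0: at the infimum \<open>m\<close> of the failures
      positivity holds, by the limit argument together with the eigenvalue hypothesis, and openness
      then contradicts failures tending to \<open>m\<close>.\<close>
    define N where "N = {l. l < 0 \<and> \<not> form_positive G q l}"
    have N: "N \<noteq> {}" using bad \<open>l < 0\<close> by (auto simp: N_def)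
    have "\<exists>l0. \<forall>l<l0. form_positive G q l" by (rule form_positive_below[OF G q])
    then obtain l0 where l0: "\<And>l. l < l0 \<Longrightarrow> form_positive G q l" by blast
    have bdd: "bdd_below N" by (rule bdd_belowI[of _ l0]) (use l0 in \<open>force simp: N_def\<close>)
    define m where "m = Inf N"
    have "m \<le> l" unfolding m_def by (rule cInf_lower[OF _ bdd]) (use bad \<open>l < 0\<close> in \<open>simp add: N_def\<close>)
    then have m0: "m < 0" using \<open>l < 0\<close> by simp
    have below: "form_positive G q k" if "k < m" for k
      using cInf_lower[OF _ bdd, of k] that m0 by (force simp: N_def m_def)
    define L where "L n = m - inverse (real (Suc n))" for n
    have "L \<longlonglongrightarrow> m - 0" unfolding L_def by (intro tendsto_intros LIMSEQ_inverse_real_of_nat)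
    then have L: "L \<longlonglongrightarrow> m" by simp
    have Lpos: "form_positive G q (L n)" for n by (rule below) (simp add: L_def)
    have lim1: "positive_sine (q e) m" if "e \<in> arcs G" for e
      by (rule form_positive_limit(1)[OF G(1) q ne L Lpos that])
    have lim2: "0 \<le> graph_form G q m \<xi> \<xi>" for \<xi>
      by (rule form_positive_limit(2)[OF G(1) q ne L Lpos])
    have "0 < graph_form G q m \<xi> \<xi>" if v: "v \<in> verts G" "\<xi> v \<noteq> 0" for v \<xi>
    proof (rule ccontr)
      assume "\<not> 0 < graph_form G q m \<xi> \<xi>"
      then have "graph_form G q m \<xi> \<xi> = 0" using lim2[of \<xi>] by linarith
      then have null: "graph_form G q m \<xi> \<eta> = 0" for \<eta> by (rule graph_form_null[OF lim2])
      obtain e where e: "e \<in> arcs G" "tail G e = v \<or> head G e = v"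
        using connected_incident[OF G v(1)] by blast
      have "is_eigenvalue G q m"
        by (rule eigenvalue_of_null_vector[where q=q, OF G(1) q positive_sine_neq[OF lim1] null e(1)])
          (use e v in auto)
      then show False using small m0 by force
    qed
    then have gm: "form_positive G q m" using lim1 by (auto simp: form_positive_def)
    have "\<exists>k\<in>N. k < m + inverse (real (Suc n))" for n
      using cInf_lessD[OF N, of "m + inverse (real (Suc n))"] by (simp add: m_def)
    then obtain K where K: "\<And>n. K n \<in> N" "\<And>n. K n < m + inverse (real (Suc n))" by metis
    have KL: "K \<longlonglongrightarrow> m"
    proof (rule tendsto_sandwich)
      show "\<forall>\<^sub>F n in sequentially. m \<le> K n"
        using K(1) cInf_lower[OF _ bdd] by (auto simp: m_def)
      show "\<forall>\<^sub>F n in sequentially. K n \<le> m + inverse (real (Suc n))" using K(2) by (auto simp: less_imp_le)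
      show "(\<lambda>n. m + inverse (real (Suc n))) \<longlonglongrightarrow> m"
        using tendsto_add[OF tendsto_const LIMSEQ_inverse_real_of_nat, of m] by simp
    qed simp
    have "\<forall>\<^sub>F n in sequentially. form_positive G q (K n)"
      by (rule form_positive_open[OF G(1) q KL gm])
    then obtain n where "form_positive G q (K n)" by (auto simp: eventually_sequentially)
    then show False using K(1)[of n] by (simp add: N_def)
  qed
  \<comment> \<open>At 0 itself semidefiniteness is what passes to the limit, and testing with the
    constant function asks for no more.\<close>
  define L where "L n = - inverse (real (Suc n))" for n
  have L: "L \<longlonglongrightarrow> 0" unfolding L_def using tendsto_minus[OF LIMSEQ_inverse_real_of_nat] by simp
  have Lpos: "form_positive G q (L n)" for n by (rule good) (simp add: L_def)
  have lim1: "positive_sine (q e) 0" if "e \<in> arcs G" for e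
    by (rule form_positive_limit(1)[OF G(1) q ne L Lpos that])
  have lim2: "0 \<le> graph_form G q 0 \<xi> \<xi>" for \<xi>
    by (rule form_positive_limit(2)[OF G(1) q ne L Lpos])
  have le1: "edge_form (q e) 0 1 1 1 1 \<le> integral {0..1} (q e)" if "e \<in> arcs G" for e
    using edge_form_test_function(1)[OF q[OF that] lim1[OF that]] by simp
  have ge: "0 \<le> (\<Sum>e\<in>arcs G. edge_form (q e) 0 1 1 1 1)"
    using lim2[of "\<lambda>_. 1"] by (simp add: graph_form_def)
  have "(\<Sum>e\<in>arcs G. edge_form (q e) 0 1 1 1 1) \<le> (\<Sum>e\<in>arcs G. integral {0..1} (q e))"
    by (rule sum_mono[OF le1])
  \<comment> \<open>Each edge has nonnegative slack and the total slack is at most 0, so every edge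
    is in the equality case of the test-function inequality.\<close>
  then have "(\<Sum>e\<in>arcs G. integral {0..1} (q e) - edge_form (q e) 0 1 1 1 1) = 0"
    using le ge by (simp add: sum_subtractf)
  then have zero: "\<forall>e\<in>arcs G. integral {0..1} (q e) - edge_form (q e) 0 1 1 1 1 = 0"
    by (subst (asm) sum_nonneg_eq_0_iff) (use le1 in auto)
  show ?thesis
  proof (intro ballI)
    fix e assume e: "e \<in> arcs G"
    then have "edge_form (q e) 0 1 1 1 1 = integral {0..1} (q e) - 0"
      using zero by simp
    then show "AE x in lebesgue. x \<in> {0<..<1} \<longrightarrow> q e x = 0"
      by (rule edge_form_test_function(2)[OF q[OF e] lim1[OF e]])
  qed
qed

section \<open>Orthonormal eigenfunctions and circulations\<close>

text \<open>Gaussian elimination: an equation with a nonzero coefficient removes a pivot unknown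
  \<open>p\<close> from the others, which preserves the excess of unknowns over equations.\<close>

lemma underdetermined_system:
  fixes A :: "'j \<Rightarrow> 'i \<Rightarrow> real"
  assumes "finite J" "finite I" "card J < card I"
  shows "\<exists>x. (\<exists>i\<in>I. x i \<noteq> 0) \<and> (\<forall>j\<in>J. (\<Sum>i\<in>I. A j i * x i) = 0)"
  using assms
proof (induction J arbitrary: I A rule: finite_induct)
  case empty
  then show ?case by (auto intro!: exI[of _ "\<lambda>_. 1"] simp: card_gt_0_iff)
next
  case (insert k J)
  show ?case
  proof (cases "\<forall>i\<in>I. A k i = 0")
    case True
    have "card J < card I" using insert by simp
    from insert.IH[OF insert.prems(1) this, of A]
    obtain x where "\<exists>i\<in>I. x i \<noteq> 0" "\<forall>j\<in>J. (\<Sum>i\<in>I. A j i * x i) = 0" by blast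
    then show ?thesis using True by (intro exI[of _ x]) simp
  next
    case False
    then obtain p where p: "p \<in> I" "A k p \<noteq> 0" by blast
    define I' where "I' = I - {p}"
    have fin: "finite I'" "p \<notin> I'" "I = insert p I'" using insert.prems p by (auto simp: I'_def)
    have "card J < card I'" using insert fin by simp
    from insert.IH[OF fin(1) this, of "\<lambda>j i. A j i - A j p * A k i / A k p"]
    obtain x where x: "\<exists>i\<in>I'. x i \<noteq> 0"
      "\<forall>j\<in>J. (\<Sum>i\<in>I'. (A j i - A j p * A k i / A k p) * x i) = 0" by blast
    define s where "s = (\<Sum>i\<in>I'. A k i * x i)"
    \<comment> \<open>Back substitution: this value of the pivot unknown solves equation
      \<open>k\<close>.\<close>
    define y where "y = x(p := - s / A k p)"
    have sum: "(\<Sum>i\<in>I. A j i * y i) = (\<Sum>i\<in>I'. A j i * x i) - A j p * s / A k p" for j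
    proof -
      have "(\<Sum>i\<in>I'. A j i * y i) = (\<Sum>i\<in>I'. A j i * x i)"
        by (rule sum.cong) (use fin in \<open>auto simp: y_def\<close>)
      then show ?thesis using fin by (simp add: y_def)
    qed
    have "(\<Sum>i\<in>I. A j i * y i) = 0" if "j \<in> insert k J" for j
    proof (cases "j = k")
      case True then show ?thesis using p(2) by (simp add: sum s_def)
    next
      case False
      then have "0 = (\<Sum>i\<in>I'. (A j i - A j p * A k i / A k p) * x i)" using x(2) that by simp
      also have "\<dots> = (\<Sum>i\<in>I'. A j i * x i - A j p / A k p * (A k i * x i))"
        by (rule sum.cong) (auto simp: algebra_simps)
      also have "\<dots> = (\<Sum>i\<in>I'. A j i * x i) - A j p / A k p * s"
        by (simp add: sum_subtractf s_def sum_distrib_left)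
      finally show ?thesis by (simp add: sum)
    qed
    moreover have "\<exists>i\<in>I. y i \<noteq> 0" using x(1) fin by (auto simp: y_def)
    ultimately show ?thesis by blast
  qed
qed

lemma (in fin_digraph) sum_arcs_head:
  fixes f :: "'b \<Rightarrow> real"
  shows "(\<Sum>e\<in>arcs G. f e * p (head G e)) = (\<Sum>v\<in>verts G. p v * (\<Sum>e\<in>in_arcs G v. f e))"
proof -
  have "(\<Sum>e\<in>arcs G. f e * p (head G e)) = (\<Sum>v\<in>verts G. \<Sum>e\<in>{e \<in> arcs G. head G e = v}. f e * p (head G e))"
    by (rule sum.group[symmetric]) auto
  also have "\<dots> = (\<Sum>v\<in>verts G. p v * (\<Sum>e\<in>in_arcs G v. f e))"
    unfolding in_arcs_def sum_distrib_left by (intro sum.cong) auto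
  finally show ?thesis .
qed

lemma (in fin_digraph) sum_arcs_tail:
  fixes f :: "'b \<Rightarrow> real"
  shows "(\<Sum>e\<in>arcs G. f e * p (tail G e)) = (\<Sum>v\<in>verts G. p v * (\<Sum>e\<in>out_arcs G v. f e))"
proof -
  have "(\<Sum>e\<in>arcs G. f e * p (tail G e)) = (\<Sum>v\<in>verts G. \<Sum>e\<in>{e \<in> arcs G. tail G e = v}. f e * p (tail G e))"
    by (rule sum.group[symmetric]) auto
  also have "\<dots> = (\<Sum>v\<in>verts G. p v * (\<Sum>e\<in>out_arcs G v. f e))"
    unfolding out_arcs_def sum_distrib_left by (intro sum.cong) auto
  finally show ?thesis .
qed

text \<open>The coboundaries of vertex functions vanishing at a base point form a space of dimension
  \<open>|V| - 1\<close> orthogonal to the circulations, so there is no room for \<open>|E| - |V| + 2\<close> of the latter.\<close>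

lemma orthogonal_circulations_bound:
  fixes b :: "nat \<Rightarrow> 'e \<Rightarrow> real" and G :: "('v, 'e) pre_digraph"
  assumes G: "fin_digraph G" "Digraph_Component.connected G"
    and M: "int M = int (card (arcs G)) - int (card (verts G)) + 2"
    and circ: "\<And>j v. j < M \<Longrightarrow> v \<in> verts G \<Longrightarrow> (\<Sum>e\<in>out_arcs G v. b j e) = (\<Sum>e\<in>in_arcs G v. b j e)"
    and orth: "\<And>j k. j < M \<Longrightarrow> k < M \<Longrightarrow> (\<Sum>e\<in>arcs G. b j e * b k e) = (if j = k then c else 0)"
    and c: "c \<noteq> 0"
  shows False
proof -
  interpret fin_digraph G by fact
  have "verts G \<noteq> {}"
    using G(2) unfolding Digraph_Component.connected_def strongly_connected_def by auto
  then obtain v0 where v0: "v0 \<in> verts G" by blast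
  define V where "V = verts G - {v0}"
  have V: "finite V" "card V = card (verts G) - 1" using v0 by (auto simp: V_def)
  have "0 < card (verts G)" using v0 by (auto simp: card_gt_0_iff)
  \<comment> \<open>These are M + (|V| - 1) = |E| + 1 unknowns against one equation per arc:
    coefficients of the circulations on the left, a potential vanishing at \<open>v0\<close> on the
    right.\<close>
  define I :: "(nat + 'v) set" where "I = Inl ` {..<M} \<union> Inr ` V"
  have "card I = card (Inl ` {..<M} :: (nat + 'v) set) + card (Inr ` V :: (nat + 'v) set)"
    unfolding I_def using V(1) by (intro card_Un_disjoint) auto
  then have "card I = M + card V" by (simp add: card_image)
  then have cardI: "card (arcs G) < card I" using V(2) M \<open>0 < card (verts G)\<close> by linarith
  have finI: "finite I" using V(1) by (simp add: I_def)
  define A where "A e i = (case i of Inl j \<Rightarrow> b j e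
      | Inr v \<Rightarrow> (if head G e = v then 1 else 0) - (if tail G e = v then 1 else 0))" for e and i :: "nat + 'v"
  obtain x where x: "\<exists>i\<in>I. x i \<noteq> 0" "\<forall>e\<in>arcs G. (\<Sum>i\<in>I. A e i * x i) = 0"
    using underdetermined_system[OF finite_arcs finI cardI, of A] by blast
  define p where "p v = (if v \<in> V then x (Inr v) else 0)" for v
  have sumI: "(\<Sum>i\<in>I. A e i * x i) = (\<Sum>j<M. b j e * x (Inl j)) + (p (head G e) - p (tail G e))" for e
  proof -
    have "(\<Sum>i\<in>I. A e i * x i) = (\<Sum>i\<in>Inl ` {..<M}. A e i * x i) + (\<Sum>i\<in>Inr ` V. A e i * x i)"
      unfolding I_def using V(1) by (intro sum.union_disjoint) auto
    also have "(\<Sum>i\<in>Inl ` {..<M}. A e i * x i) = (\<Sum>j<M. b j e * x (Inl j))"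
      by (subst sum.reindex) (auto simp: A_def)
    also have "(\<Sum>i\<in>Inr ` V. A e i * x i)
        = (\<Sum>v\<in>V. (if head G e = v then x (Inr v) else 0) - (if tail G e = v then x (Inr v) else 0))"
      by (subst sum.reindex) (auto simp: A_def intro!: sum.cong)
    also have "\<dots> = p (head G e) - p (tail G e)"
      unfolding sum_subtractf using V(1) by (simp add: p_def sum.delta')
    finally show ?thesis .
  qed
  have rel: "(\<Sum>j<M. b j e * x (Inl j)) + (p (head G e) - p (tail G e)) = 0" if "e \<in> arcs G" for e
    using x(2) that sumI by simp
  \<comment> \<open>Pairing the relation with circulation \<open>k\<close> kills the potential
    differences by summation by parts and isolates \<open>c * x (Inl k)\<close>.\<close>
  have x0: "x (Inl k) = 0" if k: "k < M" for k
  proof -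
    have "0 = (\<Sum>e\<in>arcs G. b k e * ((\<Sum>j<M. b j e * x (Inl j)) + (p (head G e) - p (tail G e))))"
      using rel by simp
    also have "\<dots> = (\<Sum>e\<in>arcs G. (\<Sum>j<M. b k e * b j e * x (Inl j)))
        + ((\<Sum>e\<in>arcs G. b k e * p (head G e)) - (\<Sum>e\<in>arcs G. b k e * p (tail G e)))"
      by (simp add: distrib_left right_diff_distrib sum.distrib sum_subtractf sum_distrib_left mult.assoc)
    also have "(\<Sum>e\<in>arcs G. b k e * p (head G e)) - (\<Sum>e\<in>arcs G. b k e * p (tail G e)) = 0"
      unfolding sum_arcs_head sum_arcs_tail using circ[OF k] by simp
    also have "(\<Sum>e\<in>arcs G. (\<Sum>j<M. b k e * b j e * x (Inl j))) = (\<Sum>j<M. (\<Sum>e\<in>arcs G. b k e * b j e) * x (Inl j))"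
      by (subst sum.swap) (simp add: sum_distrib_right)
    also have "\<dots> = (\<Sum>j<M. if k = j then c * x (Inl j) else 0)"
      by (rule sum.cong) (use orth k in auto)
    also have "\<dots> = c * x (Inl k)" using k by simp
    finally show ?thesis using c by simp
  qed
  \<comment> \<open>What remains is a potential that is constant by connectedness and vanishes at
    \<open>v0\<close>.\<close>
  have "p (head G e) = p (tail G e)" if "e \<in> arcs G" for e
    using rel[OF that] x0 by simp
  then have "p v = p v0" if "v \<in> verts G" for v
    using connected_propagate[OF G(2), of p v v0] that v0 by simp
  then have "p v = 0" if "v \<in> V" for v using that by (simp add: V_def p_def[of v0])
  then have "x (Inr v) = 0" if "v \<in> V" for v using that by (simp add: p_def)
  with x0 have "x i = 0" if "i \<in> I" for i using that by (auto simp: I_def)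
  then show False using x(1) by blast
qed

section \<open>Matching conditions, eigenspaces and orthogonality\<close>

lemma standard_matching_vertex_values:
  assumes "fin_digraph G" "standard_matching G y"
  obtains Y where "\<And>e. e \<in> arcs G \<Longrightarrow> y e 0 = Y (tail G e)" "\<And>e. e \<in> arcs G \<Longrightarrow> y e 1 = Y (head G e)"
proof -
  interpret fin_digraph G by fact
  define Y where "Y v = (SOME t. \<exists>e \<kappa>. attached G v e \<kappa> \<and> t = y e \<kappa>)" for v
  have "y e \<kappa> = Y v" if "attached G v e \<kappa>" "v \<in> verts G" for v e \<kappa>
  proof -
    have "\<exists>t. \<exists>e \<kappa>. attached G v e \<kappa> \<and> t = y e \<kappa>" using that by blast
    from someI_ex[OF this] obtain e' \<kappa>' where "attached G v e' \<kappa>'" "Y v = y e' \<kappa>'"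
      unfolding Y_def by blast
    then show ?thesis using assms(2) that unfolding standard_matching_def by metis
  qed
  then show thesis by (intro that[of Y]) (auto simp: attached_def)
qed

text \<open>The Kirchhoff condition in weak form; it disposes of the boundary terms whenever Green's
  identity is summed over the edges.\<close>

lemma standard_matching_kirchhoff:
  assumes "fin_digraph G" "standard_matching G y"
  shows "(\<Sum>e\<in>arcs G. edge_deriv (y e) 1 * p (head G e) - edge_deriv (y e) 0 * p (tail G e)) = 0"
proof -
  interpret fin_digraph G by fact
  show ?thesis
    using assms(2) sum_arcs_head[of "\<lambda>e. edge_deriv (y e) 1" p] sum_arcs_tail[of "\<lambda>e. edge_deriv (y e) 0" p]
    by (simp add: sum_subtractf standard_matching_def)
qed

lemma eigenspaceD:
  assumes "y \<in> eigenspace G q l"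
  shows "\<And>e x. e \<notin> arcs G \<or> x \<notin> {0..1} \<Longrightarrow> y e x = 0" "standard_matching G y"
    "\<And>e. e \<in> arcs G \<Longrightarrow> sturm_solution (q e) l (y e) (edge_deriv (y e))"
  using assms edge_solution_imp_sturm_solution unfolding eigenspace_def by blast+

lemma eigenspace_lincomb:
  assumes y: "y \<in> eigenspace G q l" and z: "z \<in> eigenspace G q l"
  shows "(\<lambda>e x. a * y e x + b * z e x) \<in> eigenspace G q l"
proof -
  let ?w = "\<lambda>e x. a * y e x + b * z e x"
  have sol: "sturm_solution (q e) l (?w e) (\<lambda>x. a * edge_deriv (y e) x + b * edge_deriv (z e) x)"
    if "e \<in> arcs G" for e
    by (rule sturm_solution_lincomb[OF eigenspaceD(3)[OF y that] eigenspaceD(3)[OF z that]])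
  note w = sturm_solution_imp_edge_solution[OF sol]
  have "standard_matching G ?w"
    unfolding standard_matching_def
  proof (intro conjI ballI allI impI)
    fix v e e' \<kappa> \<kappa>' assume "v \<in> verts G" and "attached G v e \<kappa> \<and> attached G v e' \<kappa>'"
    then have "y e \<kappa> = y e' \<kappa>'" "z e \<kappa> = z e' \<kappa>'"
      using eigenspaceD(2)[OF y] eigenspaceD(2)[OF z] unfolding standard_matching_def by blast+
    then show "?w e \<kappa> = ?w e' \<kappa>'" by simp
  next
    fix v assume v: "v \<in> verts G"
    have "(\<Sum>e\<in>out_arcs G v. edge_deriv (?w e) 0)
        = a * (\<Sum>e\<in>out_arcs G v. edge_deriv (y e) 0) + b * (\<Sum>e\<in>out_arcs G v. edge_deriv (z e) 0)"
      unfolding sum_distrib_left sum.distrib[symmetric] by (rule sum.cong) (auto simp: w(2))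
    also have "\<dots> = a * (\<Sum>e\<in>in_arcs G v. edge_deriv (y e) 1) + b * (\<Sum>e\<in>in_arcs G v. edge_deriv (z e) 1)"
      using eigenspaceD(2)[OF y] eigenspaceD(2)[OF z] v unfolding standard_matching_def by simp
    also have "\<dots> = (\<Sum>e\<in>in_arcs G v. edge_deriv (?w e) 1)"
      unfolding sum_distrib_left sum.distrib[symmetric] by (rule sum.cong) (auto simp: w(2))
    finally show "(\<Sum>e\<in>out_arcs G v. edge_deriv (?w e) 0) = (\<Sum>e\<in>in_arcs G v. edge_deriv (?w e) 1)" .
  qed
  then show ?thesis
    using w(1) eigenspaceD(1)[OF y] eigenspaceD(1)[OF z] unfolding eigenspace_def by auto
qed

lemma zero_in_eigenspace: "0 \<in> eigenspace G q l"
proof -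
  have z: "ac_deriv (\<lambda>x. 0) (\<lambda>x. 0)" by (rule ac_deriv_const)
  have s: "sturm_solution (q e) l (\<lambda>x. 0) (\<lambda>x. 0)" for e
    unfolding sturm_solution_def using z by simp
  have "edge_deriv (\<lambda>x. 0) x = 0" if "x \<in> {0..1}" for x
    by (rule sturm_solution_imp_edge_solution(2)[OF s that])
  moreover have "edge_solution (q e) l (\<lambda>x. 0)" for e by (rule sturm_solution_imp_edge_solution(1)[OF s])
  ultimately show ?thesis
    unfolding eigenspace_def standard_matching_def by (simp add: zero_fun_def)
qed

lemma subspace_eigenspace: "graph_fun.subspace (eigenspace G q l)"
proof (rule graph_fun.subspaceI)
  show "0 \<in> eigenspace G q l" by (rule zero_in_eigenspace)
next
  fix y z assume "y \<in> eigenspace G q l" "z \<in> eigenspace G q l"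
  from eigenspace_lincomb[OF this, of 1 1] show "y + z \<in> eigenspace G q l"
    by (simp add: plus_fun_def)
next
  fix c y assume "y \<in> eigenspace G q l"
  from eigenspace_lincomb[OF this this, of c 0] show "scale_graph_fun c y \<in> eigenspace G q l"
    by (simp add: scale_graph_fun_def)
qed

definition graph_inner :: "('v, 'e) pre_digraph \<Rightarrow> ('e \<Rightarrow> real \<Rightarrow> real) \<Rightarrow> ('e \<Rightarrow> real \<Rightarrow> real) \<Rightarrow> real" where
  "graph_inner G y z = (\<Sum>e\<in>arcs G. integral {0..1} (\<lambda>x. y e x * z e x))"

lemma graph_inner_sym: "graph_inner G y z = graph_inner G z y"
  by (simp add: graph_inner_def mult.commute)

lemma eigenspace_continuous_on:
  "y \<in> eigenspace G q l \<Longrightarrow> e \<in> arcs G \<Longrightarrow> continuous_on {0..1} (y e)"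
  by (rule sturm_solution_continuous_on(1)[OF eigenspaceD(3)])

lemma graph_inner_add_left:
  assumes "y \<in> eigenspace G q l" "z \<in> eigenspace G q l" "w \<in> eigenspace G q l"
  shows "graph_inner G (y + scale_graph_fun c z) w = graph_inner G y w + c * graph_inner G z w"
proof -
  have "integral {0..1} (\<lambda>x. (y + scale_graph_fun c z) e x * w e x)
      = integral {0..1} (\<lambda>x. y e x * w e x) + c * integral {0..1} (\<lambda>x. z e x * w e x)"
    if e: "e \<in> arcs G" for e
  proof -
    note cont = eigenspace_continuous_on[OF assms(1) e] eigenspace_continuous_on[OF assms(2) e]
      eigenspace_continuous_on[OF assms(3) e]
    have i: "(\<lambda>x. y e x * w e x) integrable_on {0..1}" "(\<lambda>x. c * (z e x * w e x)) integrable_on {0..1}"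
      by (intro integrable_continuous_interval continuous_intros cont)+
    have "(\<lambda>x. (y + scale_graph_fun c z) e x * w e x) = (\<lambda>x. y e x * w e x + c * (z e x * w e x))"
      by (simp add: scale_graph_fun_def algebra_simps)
    then show ?thesis using Henstock_Kurzweil_Integration.integral_add[OF i] by simp
  qed
  then show ?thesis by (simp add: graph_inner_def sum.distrib sum_distrib_left)
qed

lemma graph_inner_pos:
  assumes G: "fin_digraph G" and y: "y \<in> eigenspace G q l" "y \<noteq> 0"
  shows "0 < graph_inner G y y"
proof -
  interpret fin_digraph G by fact
  obtain e x where ex: "y e x \<noteq> 0" using y(2) by (auto simp: fun_eq_iff)
  then have e: "e \<in> arcs G" "x \<in> {0..1}" using eigenspaceD(1)[OF y(1)] by blast+
  have c: "continuous_on {0..1} (\<lambda>x. y f x * y f x)" if "f \<in> arcs G" for f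
    by (intro continuous_intros eigenspace_continuous_on[OF y(1) that])
  have nn: "0 \<le> integral {0..1} (\<lambda>x. y f x * y f x)" if "f \<in> arcs G" for f
    by (rule integral_nonneg[OF integrable_continuous_interval[OF c[OF that]]]) auto
  moreover have "integral {0..1} (\<lambda>x. y e x * y e x) \<noteq> 0"
  proof
    assume "integral {0..1} (\<lambda>x. y e x * y e x) = 0"
    then have "\<forall>x\<in>{0..1}. y e x * y e x = 0"
      by (subst (asm) integral_eq_0_iff) (use c[OF e(1)] in auto)
    then show False using ex e(2) by auto
  qed
  ultimately show ?thesis unfolding graph_inner_def
    using e(1) by (intro sum_pos2[OF finite_arcs e(1)]) (auto simp: less_le)
qed

text \<open>Self-adjointness: in Lagrange's identity the boundary terms are the derivatives of one
  function tested with the vertex values of the other, so the weak Kirchhoff condition removes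
  them.\<close>

lemma graph_inner_eigenvectors:
  assumes G: "fin_digraph G" and y: "y \<in> eigenspace G q l" and z: "z \<in> eigenspace G q m" and "l \<noteq> m"
  shows "graph_inner G y z = 0"
proof -
  interpret fin_digraph G by fact
  obtain Y where Y: "\<And>e. e \<in> arcs G \<Longrightarrow> y e 0 = Y (tail G e)" "\<And>e. e \<in> arcs G \<Longrightarrow> y e 1 = Y (head G e)"
    using standard_matching_vertex_values[OF G eigenspaceD(2)[OF y]] by blast
  obtain Z where Z: "\<And>e. e \<in> arcs G \<Longrightarrow> z e 0 = Z (tail G e)" "\<And>e. e \<in> arcs G \<Longrightarrow> z e 1 = Z (head G e)"
    using standard_matching_vertex_values[OF G eigenspaceD(2)[OF z]] by blast
  let ?y' = "\<lambda>e. edge_deriv (y e)" and ?z' = "\<lambda>e. edge_deriv (z e)"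
  have "(m - l) * integral {0..1} (\<lambda>x. y e x * z e x)
      = (?y' e 1 * Z (head G e) - ?y' e 0 * Z (tail G e)) - (?z' e 1 * Y (head G e) - ?z' e 0 * Y (tail G e))"
    if e: "e \<in> arcs G" for e
  proof -
    have i0: "((\<lambda>x. ((q e x - l) - (q e x - m)) * (y e x * z e x)) has_integral
        (?y' e 1 * z e 1 - y e 1 * ?z' e 1) - (?y' e 0 * z e 0 - y e 0 * ?z' e 0)) {0..1}"
      by (rule ac_deriv_has_integral[OF sturm_solution_lagrange[OF eigenspaceD(3)[OF y e] eigenspaceD(3)[OF z e]]])
        auto
    have eq: "(\<lambda>x. ((q e x - l) - (q e x - m)) * (y e x * z e x)) = (\<lambda>x. (m - l) * (y e x * z e x))"
      by auto
    have "integral {0..1} (\<lambda>x. (m - l) * (y e x * z e x))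
        = (?y' e 1 * z e 1 - y e 1 * ?z' e 1) - (?y' e 0 * z e 0 - y e 0 * ?z' e 0)"
      by (rule integral_unique[OF i0[unfolded eq]])
    then have "(m - l) * integral {0..1} (\<lambda>x. y e x * z e x)
        = (?y' e 1 * z e 1 - y e 1 * ?z' e 1) - (?y' e 0 * z e 0 - y e 0 * ?z' e 0)"
      by simp
    then show ?thesis using Y[OF e] Z[OF e] by simp
  qed
  then have "(m - l) * graph_inner G y z
      = (\<Sum>e\<in>arcs G. ?y' e 1 * Z (head G e) - ?y' e 0 * Z (tail G e))
        - (\<Sum>e\<in>arcs G. ?z' e 1 * Y (head G e) - ?z' e 0 * Y (tail G e))"
    by (simp add: graph_inner_def sum_distrib_left sum_subtractf)
  also have "\<dots> = 0"
    unfolding standard_matching_kirchhoff[OF G eigenspaceD(2)[OF y]]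
      standard_matching_kirchhoff[OF G eigenspaceD(2)[OF z]] by simp
  finally show ?thesis using \<open>l \<noteq> m\<close> by simp
qed

text \<open>Gram-Schmidt inside one eigenspace. Fewer vectors than the dimension cannot span it, so
  there is a further vector to orthogonalise and normalise.\<close>

lemma orthonormal_in_eigenspace:
  assumes G: "fin_digraph G" and n: "n \<le> eigenvalue_multiplicity G q l"
  shows "\<exists>U. finite U \<and> card U = n \<and> U \<subseteq> eigenspace G q l \<and>
    (\<forall>u\<in>U. \<forall>v\<in>U. graph_inner G u v = (if u = v then 1 else 0))"
  using n
proof (induction n)
  case 0 then show ?case by (intro exI[of _ "{}"]) auto
next
  case (Suc n)
  let ?W = "eigenspace G q l"
  note sub = subspace_eigenspace[of G q l]
  obtain U where U: "finite U" "card U = n" "U \<subseteq> ?W"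
    "\<And>u v. u \<in> U \<Longrightarrow> v \<in> U \<Longrightarrow> graph_inner G u v = (if u = v then 1 else 0)"
    using Suc by force
  have "\<not> ?W \<subseteq> graph_fun.span U"
    using graph_fun.dim_le_card[of ?W U] U Suc.prems by (auto simp: eigenvalue_multiplicity_def)
  then obtain y where y: "y \<in> ?W" "y \<notin> graph_fun.span U" by blast
  define p where "p F = (\<Sum>u\<in>F. scale_graph_fun (graph_inner G y u) u)" for F
  \<comment> \<open>Additivity of the inner product relies on integrability, which comes from
    membership in the eigenspace; hence both facts are proved together, adding one vector at a
    time.\<close>
  have pW: "p F \<in> ?W \<and> (\<forall>v\<in>?W. graph_inner G (p F) v = (\<Sum>u\<in>F. graph_inner G y u * graph_inner G u v))"
    if "F \<subseteq> U" for F
    using finite_subset[OF that U(1)] that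
  proof (induction F rule: finite_induct)
    case empty
    have "graph_inner G 0 v = 0" for v by (simp add: graph_inner_def)
    then show ?case unfolding p_def sum.empty using zero_in_eigenspace by blast
  next
    case (insert u F)
    then have u: "u \<in> ?W" and F: "p F \<in> ?W"
      "\<And>v. v \<in> ?W \<Longrightarrow> graph_inner G (p F) v = (\<Sum>u\<in>F. graph_inner G y u * graph_inner G u v)"
      using U(3) by auto
    have eq: "p (insert u F) = p F + scale_graph_fun (graph_inner G y u) u"
      using insert.hyps by (simp add: p_def add.commute)
    have "p (insert u F) \<in> ?W" unfolding eq
      by (intro graph_fun.subspace_add[OF sub] graph_fun.subspace_scale[OF sub] F(1) u)
    moreover have "graph_inner G (p (insert u F)) v = (\<Sum>u\<in>insert u F. graph_inner G y u * graph_inner G u v)"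
      if "v \<in> ?W" for v
      unfolding eq graph_inner_add_left[OF F(1) u that] F(2)[OF that] using insert.hyps by simp
    ultimately show ?case by blast
  qed
  define z where "z = y + scale_graph_fun (-1) (p U)"
  have zW: "z \<in> ?W" unfolding z_def using pW[of U] y(1)
    by (intro graph_fun.subspace_add[OF sub] graph_fun.subspace_scale[OF sub]) auto
  have "p U \<in> graph_fun.span U" unfolding p_def
    by (intro graph_fun.span_sum graph_fun.span_scale graph_fun.span_base)
  have "z \<noteq> 0"
  proof
    assume "z = 0"
    then have "z e x = 0" for e x by simp
    then have "y = p U" by (intro ext) (simp add: z_def scale_graph_fun_def)
    with \<open>p U \<in> graph_fun.span U\<close> y(2) show False by simp
  qed
  then have zpos: "0 < graph_inner G z z" by (rule graph_inner_pos[OF G zW])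
  have zu: "graph_inner G z u = 0" if "u \<in> U" for u
  proof -
    have uW: "u \<in> ?W" using that U(3) by blast
    have "graph_inner G (p U) u = (\<Sum>v\<in>U. graph_inner G y v * graph_inner G v u)"
      using pW[of U] uW by blast
    also have "\<dots> = (\<Sum>v\<in>U. if v = u then graph_inner G y v else 0)"
      by (rule sum.cong) (use U(4) that in auto)
    also have "\<dots> = graph_inner G y u" using that U(1) by simp
    finally show ?thesis
      using graph_inner_add_left[OF y(1) conjunct1[OF pW[OF order_refl]] uW, of "-1"] by (simp add: z_def)
  qed
  define w where "w = scale_graph_fun (1 / sqrt (graph_inner G z z)) z"
  have wz: "w = 0 + scale_graph_fun (1 / sqrt (graph_inner G z z)) z" by (simp add: w_def)
  have wW: "w \<in> ?W" unfolding w_def by (rule graph_fun.subspace_scale[OF sub zW])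
  have wi: "graph_inner G w v = 1 / sqrt (graph_inner G z z) * graph_inner G z v" if "v \<in> ?W" for v
    unfolding wz graph_inner_add_left[OF zero_in_eigenspace zW that] by (simp add: graph_inner_def)
  have wu: "graph_inner G w u = 0" if "u \<in> U" for u
    using wi[of u] zu[OF that] that U(3) by auto
  have "graph_inner G w w = 1 / sqrt (graph_inner G z z) * (1 / sqrt (graph_inner G z z) * graph_inner G z z)"
    using wi[OF wW] wi[OF zW] graph_inner_sym[of G z w] by simp
  then have ww: "graph_inner G w w = 1" using zpos by (simp add: real_sqrt_mult[symmetric])
  have wU: "w \<notin> U" using wu ww by force
  show ?case
  proof (intro exI[of _ "insert w U"] conjI ballI)
    show "card (insert w U) = Suc n" using U wU by simp
    fix u v assume "u \<in> insert w U" "v \<in> insert w U"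
    then show "graph_inner G u v = (if u = v then 1 else 0)"
      using ww wu U(4) wU graph_inner_sym[of G u v] by auto
  qed (use U wW in auto)
qed

text \<open>The orthonormal families of the separate eigenspaces are mutually orthogonal, hence
  disjoint, so their sizes add up to the counted multiplicity; any \<open>M\<close> of the vectors
  are then numbered.\<close>

lemma eigenvalues_within_orthonormal:
  fixes G :: "('v, 'e) pre_digraph"
  assumes G: "fin_digraph G" and ev: "eigenvalues_within G q (int M) \<mu> \<epsilon>"
  shows "\<exists>Y L. (\<forall>j<M. \<bar>L j - \<mu>\<bar> \<le> \<epsilon> \<and> Y j \<in> eigenspace G q (L j)) \<and>
    (\<forall>j<M. \<forall>k<M. graph_inner G (Y j) (Y k) = (if j = k then 1 else 0))"
proof -
  obtain S where S: "finite S" "\<And>l. l \<in> S \<Longrightarrow> \<bar>l - \<mu>\<bar> \<le> \<epsilon>"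
    "M \<le> (\<Sum>l\<in>S. eigenvalue_multiplicity G q l)"
    using ev unfolding eigenvalues_within_def by (auto simp flip: of_nat_sum)
  have "\<forall>l. \<exists>U. finite U \<and> card U = eigenvalue_multiplicity G q l \<and> U \<subseteq> eigenspace G q l \<and>
    (\<forall>u\<in>U. \<forall>v\<in>U. graph_inner G u v = (if u = v then 1 else 0))"
    using orthonormal_in_eigenspace[OF G order_refl] by blast
  from choice[OF this] obtain U where U: "\<And>l. finite (U l)" "\<And>l. card (U l) = eigenvalue_multiplicity G q l"
    "\<And>l. U l \<subseteq> eigenspace G q l"
    "\<And>l u v. u \<in> U l \<Longrightarrow> v \<in> U l \<Longrightarrow> graph_inner G u v = (if u = v then 1 else 0)" by blast
  have orth: "graph_inner G u v = 0" if "u \<in> U l" "v \<in> U m" "l \<noteq> m" for u v l m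
    using graph_inner_eigenvectors[OF G _ _ that(3)] U(3) that by blast
  have disj: "U l \<inter> U m = {}" if "l \<noteq> m" for l m
    using orth[OF _ _ that] U(4) by force
  have "card (\<Union>l\<in>S. U l) = (\<Sum>l\<in>S. card (U l))"
    using S(1) U(1) disj by (intro card_UN_disjoint) auto
  then have "M \<le> card (\<Union>l\<in>S. U l)" using S(3) U(2) by simp
  then obtain T where T: "T \<subseteq> (\<Union>l\<in>S. U l)" "card T = M" "finite T"
    by (meson obtain_subset_with_card_n)
  obtain Y where Y: "bij_betw Y {..<M} T"
    using ex_bij_betw_nat_finite[OF T(3)] T(2) by (auto simp: lessThan_atLeast0)
  have YT: "Y j \<in> T" if "j < M" for j using Y that by (auto simp: bij_betw_def)
  have inj: "Y j = Y k \<longleftrightarrow> j = k" if "j < M" "k < M" for j k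
    using Y that by (auto simp: bij_betw_def inj_on_def)
  have "\<forall>j. \<exists>l. j < M \<longrightarrow> l \<in> S \<and> Y j \<in> U l" using YT T(1) by blast
  from choice[OF this] obtain L where L: "\<And>j. j < M \<Longrightarrow> L j \<in> S" "\<And>j. j < M \<Longrightarrow> Y j \<in> U (L j)" by blast
  show ?thesis
  proof (intro exI conjI allI impI)
    fix j assume j: "j < M"
    show "\<bar>L j - \<mu>\<bar> \<le> \<epsilon>" using S(2) L(1)[OF j] by blast
    show "Y j \<in> eigenspace G q (L j)" using U(3) L(2)[OF j] by blast
    fix k assume k: "k < M"
    show "graph_inner G (Y j) (Y k) = (if j = k then 1 else 0)"
    proof (cases "L j = L k")
      case True
      then show ?thesis using U(4)[of "Y j" "L k" "Y k"] L(2)[OF j] L(2)[OF k] inj[OF j k] by simp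
    next
      case False
      then show ?thesis using orth[OF L(2)[OF j] L(2)[OF k]] by auto
    qed
  qed
qed

section \<open>Asymptotics of solutions near the unperturbed frequencies\<close>

text \<open>Variation of constants: write \<open>f = A cos (\<nu> x) + B sin (\<nu> x)\<close> and
  \<open>f'/\<nu> = B cos (\<nu> x) - A sin (\<nu> x)\<close>; then \<open>A'\<close> and \<open>B'\<close> are bounded by \<open>|q - l + \<nu>\<^sup>2| |f| / \<nu>\<close>.\<close>

lemma mode_asymptotics:
  assumes q: "q absolutely_integrable_on {0..1}"
  obtains K where "K > 0"
    "\<And>\<nu> l f g x. 1 \<le> \<nu> \<Longrightarrow> \<bar>l - \<nu>\<^sup>2\<bar> \<le> 1 \<Longrightarrow> sturm_solution q l f g \<Longrightarrow> x \<in> {0..1} \<Longrightarrow>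
       \<bar>f x - (f 0 * cos (\<nu> * x) + g 0 / \<nu> * sin (\<nu> * x))\<bar> \<le> K * (\<bar>f 0\<bar> + \<bar>g 0 / \<nu>\<bar>) / \<nu>"
    "\<And>\<nu> l f g x. 1 \<le> \<nu> \<Longrightarrow> \<bar>l - \<nu>\<^sup>2\<bar> \<le> 1 \<Longrightarrow> sturm_solution q l f g \<Longrightarrow> x \<in> {0..1} \<Longrightarrow>
       \<bar>g x / \<nu> - (g 0 / \<nu> * cos (\<nu> * x) - f 0 * sin (\<nu> * x))\<bar> \<le> K * (\<bar>f 0\<bar> + \<bar>g 0 / \<nu>\<bar>) / \<nu>"
proof -
  \<comment> \<open>The summand 1 absorbs the distance of l from \<nu>^2, and the factor 2 counts
    the two amplitudes A and B.\<close>
  define p where "p x = 2 * (\<bar>q x\<bar> + 1)" for x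
  have p: "p absolutely_integrable_on {0..1}"
    unfolding p_def using q by (intro set_integrable_mult_right set_integral_add set_integrable_abs)
      (auto simp: absolutely_integrable_on_def)
  have pint: "p integrable_on {0..1}" using p by (rule set_lebesgue_integral_eq_integral(1))
  have p0: "0 \<le> p x" for x by (simp add: p_def)
  define I where "I = integral {0..1} p"
  have I0: "0 \<le> I" unfolding I_def by (rule integral_nonneg[OF pint]) (use p0 in auto)
  define K where "K = I * exp I + 1"
  have key: "\<bar>(f x * cos (\<nu> * x) - g x / \<nu> * sin (\<nu> * x)) - f 0\<bar>
      + \<bar>(f x * sin (\<nu> * x) + g x / \<nu> * cos (\<nu> * x)) - g 0 / \<nu>\<bar> \<le> K * (\<bar>f 0\<bar> + \<bar>g 0 / \<nu>\<bar>) / \<nu>"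
    if nu: "1 \<le> \<nu>" and l: "\<bar>l - \<nu>\<^sup>2\<bar> \<le> 1" and f: "sturm_solution q l f g" and x: "x \<in> {0..1}"
    for \<nu> l f g x
  proof -
    define A where "A x = f x * cos (\<nu> * x) - g x / \<nu> * sin (\<nu> * x)" for x
    define B where "B x = f x * sin (\<nu> * x) + g x / \<nu> * cos (\<nu> * x)" for x
    define A' where "A' x = - (q x - l + \<nu>\<^sup>2) * f x * sin (\<nu> * x) / \<nu>" for x
    define B' where "B' x = (q x - l + \<nu>\<^sup>2) * f x * cos (\<nu> * x) / \<nu>" for x
    define r where "r = \<bar>f 0\<bar> + \<bar>g 0 / \<nu>\<bar>"
    have nu0: "\<nu> \<noteq> 0" using nu by auto
    note a1 = sturm_solution_ac1[OF f]
    have a2: "ac_deriv (\<lambda>x. g x / \<nu>) (\<lambda>x. (q x - l) * f x / \<nu>)"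
      by (rule ac_deriv_cong[OF ac_deriv_cmult[OF sturm_solution_ac2[OF f], of "1/\<nu>"]]) auto
    have c: "ac_deriv (\<lambda>x. cos (\<nu> * x)) (\<lambda>x. - \<nu> * sin (\<nu> * x))"
      by (rule ac_deriv_C1) (auto intro!: derivative_eq_intros continuous_intros)
    have s: "ac_deriv (\<lambda>x. sin (\<nu> * x)) (\<lambda>x. \<nu> * cos (\<nu> * x))"
      by (rule ac_deriv_C1) (auto intro!: derivative_eq_intros continuous_intros)
    have A: "ac_deriv A A'"
      by (rule ac_deriv_cong[OF ac_deriv_diff[OF ac_deriv_mult[OF a1 c] ac_deriv_mult[OF a2 s]]])
        (use nu0 in \<open>auto simp: A_def A'_def field_simps power2_eq_square\<close>)
    have B: "ac_deriv B B'"
      by (rule ac_deriv_cong[OF ac_deriv_add[OF ac_deriv_mult[OF a1 s] ac_deriv_mult[OF a2 c]]])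
        (use nu0 in \<open>auto simp: B_def B'_def field_simps power2_eq_square\<close>)
    have fAB: "f x = A x * cos (\<nu> * x) + B x * sin (\<nu> * x)" for x
    proof -
      have "A x * cos (\<nu> * x) + B x * sin (\<nu> * x)
          = f x * (cos (\<nu> * x) * cos (\<nu> * x) + sin (\<nu> * x) * sin (\<nu> * x))"
        unfolding A_def B_def by (simp only: algebra_simps)
      then show ?thesis using sin_cos_squared_add2[of "\<nu> * x"] by (simp add: power2_eq_square)
    qed
    have fle: "\<bar>f x\<bar> \<le> \<bar>A x\<bar> + \<bar>B x\<bar>" for x
    proof -
      have "\<bar>f x\<bar> \<le> \<bar>A x\<bar> * \<bar>cos (\<nu> * x)\<bar> + \<bar>B x\<bar> * \<bar>sin (\<nu> * x)\<bar>"
        unfolding fAB[of x] by (metis abs_mult abs_triangle_ineq)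
      also have "\<dots> \<le> \<bar>A x\<bar> * 1 + \<bar>B x\<bar> * 1"
        by (intro add_mono mult_left_mono) auto
      finally show ?thesis by simp
    qed
    have A'le: "\<bar>A' x\<bar> + \<bar>B' x\<bar> \<le> p x * \<bar>f x\<bar> / \<nu>" for x
    proof -
      have ql: "\<bar>q x - l + \<nu>\<^sup>2\<bar> \<le> \<bar>q x\<bar> + 1" using l by linarith
      have "\<bar>A' x\<bar> = \<bar>q x - l + \<nu>\<^sup>2\<bar> * \<bar>f x\<bar> * \<bar>sin (\<nu> * x)\<bar> / \<nu>"
        using nu by (simp only: A'_def abs_divide abs_mult abs_minus_cancel)
      also have "\<dots> \<le> (\<bar>q x\<bar> + 1) * \<bar>f x\<bar> * 1 / \<nu>"
        using nu ql by (intro divide_right_mono mult_mono) auto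
      finally have 1: "\<bar>A' x\<bar> \<le> (\<bar>q x\<bar> + 1) * \<bar>f x\<bar> * 1 / \<nu>" .
      have "\<bar>B' x\<bar> = \<bar>q x - l + \<nu>\<^sup>2\<bar> * \<bar>f x\<bar> * \<bar>cos (\<nu> * x)\<bar> / \<nu>"
        using nu by (simp only: B'_def abs_divide abs_mult)
      also have "\<dots> \<le> (\<bar>q x\<bar> + 1) * \<bar>f x\<bar> * 1 / \<nu>"
        using nu ql by (intro divide_right_mono mult_mono) auto
      finally have 2: "\<bar>B' x\<bar> \<le> (\<bar>q x\<bar> + 1) * \<bar>f x\<bar> * 1 / \<nu>" .
      have "p x * \<bar>f x\<bar> / \<nu> = (\<bar>q x\<bar> + 1) * \<bar>f x\<bar> * 1 / \<nu> + (\<bar>q x\<bar> + 1) * \<bar>f x\<bar> * 1 / \<nu>"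
        by (simp add: p_def)
      with 1 2 show ?thesis by linarith
    qed
    have AB0: "A 0 = f 0" "B 0 = g 0 / \<nu>" by (simp_all add: A_def B_def)
    have AB: "\<bar>A x\<bar> + \<bar>B x\<bar> \<le> r * exp I" if x: "x \<in> {0..1}" for x
    proof -
      have "\<bar>A x\<bar> + \<bar>B x\<bar> \<le> (\<bar>A 0\<bar> + \<bar>B 0\<bar> + 0) * exp (integral {0..1} p)"
      proof (rule gronwall_pair[OF A B p p0 order_refl _ x])
        fix y :: real
        have "\<bar>A' y\<bar> + \<bar>B' y\<bar> \<le> p y * \<bar>f y\<bar> / \<nu>" by (rule A'le)
        also have "\<dots> \<le> p y * \<bar>f y\<bar> / 1" using p0[of y] nu by (intro divide_left_mono) auto
        also have "\<dots> \<le> p y * (\<bar>A y\<bar> + \<bar>B y\<bar>) + 0" using fle[of y] p0[of y] by (simp add: mult_left_mono)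
        finally show "\<bar>A' y\<bar> + \<bar>B' y\<bar> \<le> p y * (\<bar>A y\<bar> + \<bar>B y\<bar>) + 0" .
      qed
      then show ?thesis by (simp add: AB0 r_def I_def)
    qed
    \<comment> \<open>Second pass: the Gronwall bound gave away the factor 1/\<nu>. Inserting it
      into the integrated equations recovers this factor for the deviation of A and B from their
      initial values.\<close>
    have dif: "\<sigma> * (A x - A 0) + \<tau> * (B x - B 0) \<le> r * exp I / \<nu> * I"
      if st: "\<bar>\<sigma>\<bar> = 1" "\<bar>\<tau>\<bar> = 1" for \<sigma> \<tau>
    proof -
      have "((\<lambda>t. \<sigma> * A' t + \<tau> * B' t) has_integral (\<sigma> * A x + \<tau> * B x) - (\<sigma> * A 0 + \<tau> * B 0)) {0..x}"
        by (rule ac_deriv_has_integral[OF ac_deriv_add[OF ac_deriv_cmult[OF A] ac_deriv_cmult[OF B]]])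
          (use x in auto)
      moreover have px: "p integrable_on {0..x}" by (rule integrable_subinterval_real[OF pint]) (use x in auto)
      then have "((\<lambda>t. r * exp I / \<nu> * p t) has_integral r * exp I / \<nu> * integral {0..x} p) {0..x}"
        by (intro has_integral_mult_right integrable_integral)
      ultimately have "(\<sigma> * A x + \<tau> * B x) - (\<sigma> * A 0 + \<tau> * B 0) \<le> r * exp I / \<nu> * integral {0..x} p"
      proof (rule has_integral_le)
        fix t assume "t \<in> {0..x}"
        then have t: "t \<in> {0..1}" using x by auto
        have "\<sigma> * A' t + \<tau> * B' t \<le> \<bar>\<sigma> * A' t\<bar> + \<bar>\<tau> * B' t\<bar>" by linarith
        also have "\<dots> = \<bar>A' t\<bar> + \<bar>B' t\<bar>" using st by (simp add: abs_mult)
        also have "\<dots> \<le> p t * \<bar>f t\<bar> / \<nu>" by (rule A'le)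
        also have "\<dots> \<le> p t * (r * exp I) / \<nu>"
          using order_trans[OF fle AB[OF t]] p0[of t] nu by (intro divide_right_mono mult_left_mono) auto
        finally show "\<sigma> * A' t + \<tau> * B' t \<le> r * exp I / \<nu> * p t" by (simp add: mult.commute)
      qed
      also have "\<dots> \<le> r * exp I / \<nu> * I"
      proof (rule mult_left_mono)
        show "integral {0..x} p \<le> I" unfolding I_def
          by (rule integral_subset_le[OF _ px pint]) (use x p0 in auto)
        show "0 \<le> r * exp I / \<nu>" using nu by (simp add: r_def)
      qed
      finally show ?thesis by (simp add: algebra_simps)
    qed
    have "\<bar>A x - A 0\<bar> + \<bar>B x - B 0\<bar> \<le> r * exp I / \<nu> * I"
      using dif[of 1 1] dif[of 1 "-1"] dif[of "-1" 1] dif[of "-1" "-1"] by (simp add: abs_if)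
    also have "\<dots> = I * exp I * r / \<nu>" by simp
    also have "\<dots> \<le> K * r / \<nu>"
      using nu by (intro divide_right_mono mult_right_mono) (auto simp: K_def r_def)
    finally show ?thesis by (simp add: AB0 r_def) (simp add: A_def B_def)
  qed
  have combine: "\<bar>u * c + v * s\<bar> \<le> R" if "\<bar>u\<bar> + \<bar>v\<bar> \<le> R" "\<bar>c\<bar> \<le> 1" "\<bar>s\<bar> \<le> 1" for u v c s R :: real
  proof -
    have "\<bar>u * c + v * s\<bar> \<le> \<bar>u\<bar> * \<bar>c\<bar> + \<bar>v\<bar> * \<bar>s\<bar>" by (metis abs_mult abs_triangle_ineq)
    also have "\<dots> \<le> \<bar>u\<bar> * 1 + \<bar>v\<bar> * 1" using that by (intro add_mono mult_left_mono) auto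
    finally show ?thesis using that by simp
  qed
  show thesis
  proof (rule that[of K])
    show "K > 0" using I0 by (auto simp: K_def intro: add_nonneg_pos)
    fix \<nu> l f g x
    assume a: "1 \<le> \<nu>" "\<bar>l - \<nu>\<^sup>2\<bar> \<le> 1" "sturm_solution q l f g" "x \<in> {0..1::real}"
    define A where "A = f x * cos (\<nu> * x) - g x / \<nu> * sin (\<nu> * x)"
    define B where "B = f x * sin (\<nu> * x) + g x / \<nu> * cos (\<nu> * x)"
    have AB: "\<bar>A - f 0\<bar> + \<bar>B - g 0 / \<nu>\<bar> \<le> K * (\<bar>f 0\<bar> + \<bar>g 0 / \<nu>\<bar>) / \<nu>"
      unfolding A_def B_def by (rule key[OF a])
    have rot: "(u * c - v * s) * c + (u * s + v * c) * s = u" "(u * s + v * c) * c - (u * c - v * s) * s = v"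
      if "c * c + s * s = 1" for u v c s :: real
    proof -
      have "(u * c - v * s) * c + (u * s + v * c) * s = u * (c * c + s * s)"
        "(u * s + v * c) * c - (u * c - v * s) * s = v * (c * c + s * s)"
        by (simp_all add: algebra_simps)
      then show "(u * c - v * s) * c + (u * s + v * c) * s = u" "(u * s + v * c) * c - (u * c - v * s) * s = v"
        by (simp_all add: that)
    qed
    have cs1: "cos (\<nu> * x) * cos (\<nu> * x) + sin (\<nu> * x) * sin (\<nu> * x) = 1"
      using sin_cos_squared_add2[of "\<nu> * x"] by (simp add: power2_eq_square)
    have e1: "f x = A * cos (\<nu> * x) + B * sin (\<nu> * x)" and e2: "g x / \<nu> = B * cos (\<nu> * x) - A * sin (\<nu> * x)"
      unfolding A_def B_def by (rule rot[OF cs1, symmetric])+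
    have "f x - (f 0 * cos (\<nu> * x) + g 0 / \<nu> * sin (\<nu> * x))
        = (A - f 0) * cos (\<nu> * x) + (B - g 0 / \<nu>) * sin (\<nu> * x)"
      unfolding e1 by (simp add: left_diff_distrib)
    then show "\<bar>f x - (f 0 * cos (\<nu> * x) + g 0 / \<nu> * sin (\<nu> * x))\<bar> \<le> K * (\<bar>f 0\<bar> + \<bar>g 0 / \<nu>\<bar>) / \<nu>"
      using combine[OF AB] by simp
    have "g x / \<nu> - (g 0 / \<nu> * cos (\<nu> * x) - f 0 * sin (\<nu> * x))
        = (A - f 0) * (- sin (\<nu> * x)) + (B - g 0 / \<nu>) * cos (\<nu> * x)"
      unfolding e2 by (simp add: left_diff_distrib)
    then show "\<bar>g x / \<nu> - (g 0 / \<nu> * cos (\<nu> * x) - f 0 * sin (\<nu> * x))\<bar> \<le> K * (\<bar>f 0\<bar> + \<bar>g 0 / \<nu>\<bar>) / \<nu>"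
      using combine[OF AB, of "- sin (\<nu> * x)" "cos (\<nu> * x)"] by simp
  qed
qed

lemma trig_integrals:
  fixes n :: nat
  assumes n: "1 \<le> n"
  defines "\<nu> \<equiv> real n * pi"
  shows "((\<lambda>x. cos (\<nu> * x) * cos (\<nu> * x)) has_integral 1/2) {0..1}"
    "((\<lambda>x. sin (\<nu> * x) * sin (\<nu> * x)) has_integral 1/2) {0..1}"
    "((\<lambda>x. sin (\<nu> * x) * cos (\<nu> * x)) has_integral 0) {0..1}"
proof -
  have nu: "\<nu> \<noteq> 0" using n by (simp add: \<nu>_def)
  have sc: "sin \<nu> = 0" by (simp add: \<nu>_def sin_npi)
  have one: "cos t * cos t = 1 - sin t * sin t" for t :: real
    using sin_cos_squared_add[of t] by (simp add: power2_eq_square)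
  have d: "((\<lambda>x. sin (\<nu> * x) * cos (\<nu> * x)) has_real_derivative \<nu> * (1 - 2 * (sin (\<nu> * x) * sin (\<nu> * x)))) (at x within S)" for x S
    by (rule derivative_eq_intros refl | simp)+ (simp add: one algebra_simps)
  have "((\<lambda>x. cos (\<nu> * x) * cos (\<nu> * x)) has_integral
     (1 / 2 + sin (\<nu> * 1) * cos (\<nu> * 1) / (2 * \<nu>)) - (0 / 2 + sin (\<nu> * 0) * cos (\<nu> * 0) / (2 * \<nu>))) {0..1}"
  proof (rule fundamental_theorem_of_calculus)
    fix x :: real
    have "((\<lambda>x. x / 2 + sin (\<nu> * x) * cos (\<nu> * x) / (2 * \<nu>)) has_real_derivative
        1 / 2 + \<nu> * (1 - 2 * (sin (\<nu> * x) * sin (\<nu> * x))) / (2 * \<nu>)) (at x within {0..1})"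
      by (intro DERIV_add DERIV_cdivide d DERIV_ident)
    then show "((\<lambda>x. x / 2 + sin (\<nu> * x) * cos (\<nu> * x) / (2 * \<nu>)) has_vector_derivative
        cos (\<nu> * x) * cos (\<nu> * x)) (at x within {0..1})"
      unfolding has_real_derivative_iff_has_vector_derivative[symmetric]
      by (rule back_subst[of "\<lambda>D. (_ has_real_derivative D) _"]) (use nu in \<open>simp add: one field_simps\<close>)
  qed simp
  then show "((\<lambda>x. cos (\<nu> * x) * cos (\<nu> * x)) has_integral 1/2) {0..1}" by (simp add: sc)
  have "((\<lambda>x. sin (\<nu> * x) * sin (\<nu> * x)) has_integral
     (1 / 2 - sin (\<nu> * 1) * cos (\<nu> * 1) / (2 * \<nu>)) - (0 / 2 - sin (\<nu> * 0) * cos (\<nu> * 0) / (2 * \<nu>))) {0..1}"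
  proof (rule fundamental_theorem_of_calculus)
    fix x :: real
    have "((\<lambda>x. x / 2 - sin (\<nu> * x) * cos (\<nu> * x) / (2 * \<nu>)) has_real_derivative
        1 / 2 - \<nu> * (1 - 2 * (sin (\<nu> * x) * sin (\<nu> * x))) / (2 * \<nu>)) (at x within {0..1})"
      by (intro DERIV_diff DERIV_cdivide d DERIV_ident)
    then show "((\<lambda>x. x / 2 - sin (\<nu> * x) * cos (\<nu> * x) / (2 * \<nu>)) has_vector_derivative
        sin (\<nu> * x) * sin (\<nu> * x)) (at x within {0..1})"
      unfolding has_real_derivative_iff_has_vector_derivative[symmetric]
      by (rule back_subst[of "\<lambda>D. (_ has_real_derivative D) _"]) (use nu in \<open>simp add: one field_simps\<close>)
  qed simp
  then show "((\<lambda>x. sin (\<nu> * x) * sin (\<nu> * x)) has_integral 1/2) {0..1}" by (simp add: sc)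
  have "((\<lambda>x. sin (\<nu> * x) * cos (\<nu> * x)) has_integral
     (sin (\<nu> * 1) * sin (\<nu> * 1) / (2 * \<nu>)) - (sin (\<nu> * 0) * sin (\<nu> * 0) / (2 * \<nu>))) {0..1}"
  proof (rule fundamental_theorem_of_calculus)
    fix x :: real
    have "((\<lambda>x. sin (\<nu> * x) * sin (\<nu> * x) / (2 * \<nu>)) has_real_derivative sin (\<nu> * x) * cos (\<nu> * x)) (at x within {0..1})"
      using nu by (auto intro!: derivative_eq_intros simp: field_simps)
    then show "((\<lambda>x. sin (\<nu> * x) * sin (\<nu> * x) / (2 * \<nu>)) has_vector_derivative
        sin (\<nu> * x) * cos (\<nu> * x)) (at x within {0..1})"
      by (simp only: has_real_derivative_iff_has_vector_derivative)
  qed simp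
  then show "((\<lambda>x. sin (\<nu> * x) * cos (\<nu> * x)) has_integral 0) {0..1}" by (simp add: sc)
qed

lemma mode_product_integral:
  fixes n :: nat
  assumes n: "1 \<le> n"
  defines "\<nu> \<equiv> real n * pi"
  shows "((\<lambda>x. (a * cos (\<nu> * x) + b * sin (\<nu> * x)) * (c * cos (\<nu> * x) + d * sin (\<nu> * x)))
    has_integral (a * c + b * d) / 2) {0..1}"
proof -
  note t = trig_integrals[OF n, folded \<nu>_def]
  have "((\<lambda>x. (a * c) * (cos (\<nu> * x) * cos (\<nu> * x)) + (b * d) * (sin (\<nu> * x) * sin (\<nu> * x))
      + (a * d + b * c) * (sin (\<nu> * x) * cos (\<nu> * x))) has_integral
      (a * c) * (1/2) + (b * d) * (1/2) + (a * d + b * c) * 0) {0..1}"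
    by (intro has_integral_add has_integral_mult_right t)
  then show ?thesis
    by (rule has_integral_eq_rhs[OF has_integral_eq[rotated]]) (auto simp: algebra_simps)
qed

text \<open>Bounds the amplitudes of normalised eigenfunctions. Let r be the sum of the two absolute
  amplitudes. The sinusoid has squared L^2 norm at least r^2/4, and \<open>f\<close> differs from it
  by at most r/4 once the frequency is at least 4 K. So r^2/4 \<le> 2 \<integral>f^2 + r^2/8, whence
  the constant 16.\<close>

lemma mode_norm_bound:
  assumes q: "q absolutely_integrable_on {0..1}"
  obtains N0 :: nat where "1 \<le> N0" "\<And>n l f g. N0 \<le> n \<Longrightarrow> \<bar>l - (real n * pi)\<^sup>2\<bar> \<le> 1 \<Longrightarrow> sturm_solution q l f g \<Longrightarrow>
     (\<bar>f 0\<bar> + \<bar>g 0 / (real n * pi)\<bar>)\<^sup>2 \<le> 16 * integral {0..1} (\<lambda>x. f x * f x)"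
proof -
  obtain K where K: "K > 0" "\<And>\<nu> l f g x. 1 \<le> \<nu> \<Longrightarrow> \<bar>l - \<nu>\<^sup>2\<bar> \<le> 1 \<Longrightarrow> sturm_solution q l f g \<Longrightarrow> x \<in> {0..1} \<Longrightarrow>
       \<bar>f x - (f 0 * cos (\<nu> * x) + g 0 / \<nu> * sin (\<nu> * x))\<bar> \<le> K * (\<bar>f 0\<bar> + \<bar>g 0 / \<nu>\<bar>) / \<nu>"
    by (rule mode_asymptotics[OF q], rule that, assumption+)
  obtain N0 :: nat where N0: "max 1 (4 * K) \<le> real N0" using real_arch_simple by blast
  show thesis
  proof (rule that[of N0])
    show "1 \<le> N0" using N0 by simp
    fix n l f g
    assume n: "N0 \<le> n" and l: "\<bar>l - (real n * pi)\<^sup>2\<bar> \<le> 1" and f: "sturm_solution q l f g"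
    define \<nu> where "\<nu> = real n * pi"
    have "real N0 \<le> real n" using n by simp
    moreover have "real n * 1 \<le> \<nu>" unfolding \<nu>_def using pi_ge_two by (intro mult_left_mono) auto
    ultimately have nu: "1 \<le> \<nu>" "4 * K \<le> \<nu>" and n1: "1 \<le> n" using N0 by auto
    define r where "r = \<bar>f 0\<bar> + \<bar>g 0 / \<nu>\<bar>"
    define m where "m x = f 0 * cos (\<nu> * x) + g 0 / \<nu> * sin (\<nu> * x)" for x
    have fi: "((\<lambda>x. f x * f x) has_integral integral {0..1} (\<lambda>x. f x * f x)) {0..1}"
      by (intro integrable_integral integrable_continuous_interval continuous_intros
          sturm_solution_continuous_on(1)[OF f])
    have mi: "((\<lambda>x. m x * m x) has_integral (f 0 * f 0 + g 0 / \<nu> * (g 0 / \<nu>)) / 2) {0..1}"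
      unfolding m_def \<nu>_def by (rule mode_product_integral[OF n1])
    have ci: "((\<lambda>x. 2 * (f x * f x) + r\<^sup>2 / 8) has_integral 2 * integral {0..1} (\<lambda>x. f x * f x) + r\<^sup>2 / 8) {0..1}"
      using has_integral_add[OF has_integral_mult_right[OF fi, of 2] has_integral_const_real[of "r\<^sup>2 / 8" 0 1]] by simp
    have mle: "(f 0 * f 0 + g 0 / \<nu> * (g 0 / \<nu>)) / 2 \<le> 2 * integral {0..1} (\<lambda>x. f x * f x) + r\<^sup>2 / 8"
    proof (rule has_integral_le[OF mi ci])
      fix x :: real assume x: "x \<in> {0..1}"
      have "\<bar>f x - m x\<bar> \<le> K * r / \<nu>"
        unfolding m_def r_def by (rule K(2)[OF nu(1) l[folded \<nu>_def] f x])
      also have "\<dots> \<le> r / 4"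
      proof -
        have "0 \<le> r" by (simp add: r_def)
        from mult_left_mono[OF nu(2) this] have "K * r * 4 \<le> r * \<nu>" by (simp add: ac_simps)
        then show ?thesis using nu(1) by (simp add: field_simps)
      qed
      finally have "(f x - m x)\<^sup>2 \<le> (r / 4)\<^sup>2" by (rule abs_le_square_iff[THEN iffD1, OF order_trans]) (simp add: r_def)
      moreover have "m x * m x + (2 * f x - m x)\<^sup>2 = 2 * (f x * f x) + 2 * (f x - m x)\<^sup>2"
        by (simp add: power2_eq_square algebra_simps)
      then have "m x * m x \<le> 2 * (f x * f x) + 2 * (f x - m x)\<^sup>2"
        using zero_le_power2[of "2 * f x - m x"] by linarith
      ultimately show "m x * m x \<le> 2 * (f x * f x) + r\<^sup>2 / 8" by (simp add: power_divide)
    qed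
    have sq: "(\<bar>u\<bar> + \<bar>v\<bar>)\<^sup>2 / 4 \<le> (u * u + v * v) / 2" for u v :: real
    proof -
      have "(\<bar>u\<bar> + \<bar>v\<bar>)\<^sup>2 + (\<bar>u\<bar> - \<bar>v\<bar>)\<^sup>2 = 2 * (u * u + v * v)"
        by (simp add: power2_eq_square algebra_simps)
      then show ?thesis using zero_le_power2[of "\<bar>u\<bar> - \<bar>v\<bar>"] by linarith
    qed
    have "r\<^sup>2 / 4 \<le> (f 0 * f 0 + g 0 / \<nu> * (g 0 / \<nu>)) / 2" unfolding r_def by (rule sq)
    with mle have "r\<^sup>2 \<le> 16 * integral {0..1} (\<lambda>x. f x * f x)" by linarith
    then show "(\<bar>f 0\<bar> + \<bar>g 0 / (real n * pi)\<bar>)\<^sup>2 \<le> 16 * integral {0..1} (\<lambda>x. f x * f x)"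
      unfolding r_def \<nu>_def .
  qed
qed

text \<open>The limits are the cosine and sine amplitudes along one edge; the derivative is divided
  by the frequency to put it on the same scale as the function. The spectral parameter may wander
  within distance 1 of the squared frequency.\<close>

definition mode_sequence :: "(real \<Rightarrow> real) \<Rightarrow> (nat \<Rightarrow> nat) \<Rightarrow> (nat \<Rightarrow> real \<Rightarrow> real) \<Rightarrow>
    (nat \<Rightarrow> real \<Rightarrow> real) \<Rightarrow> real \<Rightarrow> real \<Rightarrow> bool" where
  "mode_sequence q n f g a b \<longleftrightarrow>
     (\<forall>i. 1 \<le> n i \<and> (\<exists>l. \<bar>l - (real (n i) * pi)\<^sup>2\<bar> \<le> 1 \<and> sturm_solution q l (f i) (g i))) \<and>
     filterlim n at_top sequentially \<and>
     (\<lambda>i. f i 0) \<longlonglongrightarrow> a \<and> (\<lambda>i. g i 0 / (real (n i) * pi)) \<longlonglongrightarrow> b"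

lemma frequency_at_top:
  assumes "filterlim n at_top sequentially"
  shows "filterlim (\<lambda>i. real (n i) * pi) at_top sequentially"
  using filterlim_tendsto_pos_mult_at_top[OF tendsto_const pi_gt_zero
      filterlim_compose[OF filterlim_real_sequentially assms]]
  by (simp add: mult.commute)

lemma mode_sequence_uniform:
  assumes q: "q absolutely_integrable_on {0..1}" and ms: "mode_sequence q n f g a b"
  shows "\<exists>\<delta>. \<delta> \<longlonglongrightarrow> 0 \<and> (\<forall>i. 0 \<le> \<delta> i) \<and> (\<forall>i. \<forall>x\<in>{0..1}.
    \<bar>f i x - (f i 0 * cos (real (n i) * pi * x) + g i 0 / (real (n i) * pi) * sin (real (n i) * pi * x))\<bar> \<le> \<delta> i \<and>
    \<bar>g i x / (real (n i) * pi) - (g i 0 / (real (n i) * pi) * cos (real (n i) * pi * x) - f i 0 * sin (real (n i) * pi * x))\<bar> \<le> \<delta> i)"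
proof -
  define \<nu> where "\<nu> i = real (n i) * pi" for i
  obtain K where K: "K > 0"
    "\<And>\<nu> l f g x. 1 \<le> \<nu> \<Longrightarrow> \<bar>l - \<nu>\<^sup>2\<bar> \<le> 1 \<Longrightarrow> sturm_solution q l f g \<Longrightarrow> x \<in> {0..1} \<Longrightarrow>
       \<bar>f x - (f 0 * cos (\<nu> * x) + g 0 / \<nu> * sin (\<nu> * x))\<bar> \<le> K * (\<bar>f 0\<bar> + \<bar>g 0 / \<nu>\<bar>) / \<nu>"
    "\<And>\<nu> l f g x. 1 \<le> \<nu> \<Longrightarrow> \<bar>l - \<nu>\<^sup>2\<bar> \<le> 1 \<Longrightarrow> sturm_solution q l f g \<Longrightarrow> x \<in> {0..1} \<Longrightarrow>
       \<bar>g x / \<nu> - (g 0 / \<nu> * cos (\<nu> * x) - f 0 * sin (\<nu> * x))\<bar> \<le> K * (\<bar>f 0\<bar> + \<bar>g 0 / \<nu>\<bar>) / \<nu>"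
    by (rule mode_asymptotics[OF q], rule that, assumption+)
  have ms1: "1 \<le> n i" "\<exists>l. \<bar>l - (\<nu> i)\<^sup>2\<bar> \<le> 1 \<and> sturm_solution q l (f i) (g i)" for i
    using ms by (auto simp: mode_sequence_def \<nu>_def)
  have ninf: "filterlim n at_top sequentially" and fa: "(\<lambda>i. f i 0) \<longlonglongrightarrow> a" and gb: "(\<lambda>i. g i 0 / \<nu> i) \<longlonglongrightarrow> b"
    using ms by (auto simp: mode_sequence_def \<nu>_def)
  have nu1: "1 \<le> \<nu> i" for i
  proof -
    have "1 * 1 \<le> \<nu> i" unfolding \<nu>_def using ms1(1)[of i] pi_ge_two by (intro mult_mono) auto
    then show ?thesis by simp
  qed
  define \<delta> where "\<delta> i = K * (\<bar>f i 0\<bar> + \<bar>g i 0 / \<nu> i\<bar>) / \<nu> i" for i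
  have "\<delta> \<longlonglongrightarrow> 0" unfolding \<delta>_def
  proof (rule tendsto_divide_0)
    show "(\<lambda>i. K * (\<bar>f i 0\<bar> + \<bar>g i 0 / \<nu> i\<bar>)) \<longlonglongrightarrow> K * (\<bar>a\<bar> + \<bar>b\<bar>)"
      by (intro tendsto_intros fa gb)
    show "filterlim \<nu> at_infinity sequentially"
      unfolding \<nu>_def by (rule filterlim_at_top_imp_at_infinity[OF frequency_at_top[OF ninf]])
  qed
  moreover have "0 \<le> \<delta> i" for i unfolding \<delta>_def using K(1) nu1[of i] by simp
  moreover have "\<bar>f i x - (f i 0 * cos (\<nu> i * x) + g i 0 / \<nu> i * sin (\<nu> i * x))\<bar> \<le> \<delta> i \<and>
    \<bar>g i x / \<nu> i - (g i 0 / \<nu> i * cos (\<nu> i * x) - f i 0 * sin (\<nu> i * x))\<bar> \<le> \<delta> i" if "x \<in> {0..1}" for i x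
  proof -
    obtain l where l: "\<bar>l - (\<nu> i)\<^sup>2\<bar> \<le> 1" "sturm_solution q l (f i) (g i)" using ms1(2) by blast
    show ?thesis unfolding \<delta>_def using K(2,3)[OF nu1 l that] by blast
  qed
  ultimately show ?thesis unfolding \<nu>_def by blast
qed

text \<open>At 1 the sine vanishes and the cosine is \<open>(- 1) ^ n i\<close>, so after this sign
  both ends of the edge have the same limits.\<close>

lemma mode_sequence_endpoint:
  assumes q: "q absolutely_integrable_on {0..1}" and ms: "mode_sequence q n f g a b"
  shows "(\<lambda>i. (- 1) ^ n i * f i 1) \<longlonglongrightarrow> a" "(\<lambda>i. (- 1) ^ n i * (g i 1 / (real (n i) * pi))) \<longlonglongrightarrow> b"
proof -
  obtain \<delta> where d: "\<delta> \<longlonglongrightarrow> 0" "\<And>i x. x \<in> {0..1} \<Longrightarrow>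
    \<bar>f i x - (f i 0 * cos (real (n i) * pi * x) + g i 0 / (real (n i) * pi) * sin (real (n i) * pi * x))\<bar> \<le> \<delta> i"
    "\<And>i x. x \<in> {0..1} \<Longrightarrow> \<bar>g i x / (real (n i) * pi) - (g i 0 / (real (n i) * pi) * cos (real (n i) * pi * x)
       - f i 0 * sin (real (n i) * pi * x))\<bar> \<le> \<delta> i"
    using mode_sequence_uniform[OF q ms] by auto
  have lim: "(\<lambda>i. f i 0) \<longlonglongrightarrow> a" "(\<lambda>i. g i 0 / (real (n i) * pi)) \<longlonglongrightarrow> b"
    using ms by (auto simp: mode_sequence_def)
  have sgn: "\<bar>(- 1) ^ k * u - v\<bar> = \<bar>u - v * (- 1) ^ k\<bar>" for u v :: real and k :: nat
    by (cases "even k") auto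
  have "\<bar>(- 1) ^ n i * f i 1 - f i 0\<bar> \<le> \<delta> i" for i
    using d(2)[of 1 i] unfolding sgn by (simp add: sin_npi cos_npi)
  then have "(\<lambda>i. (- 1) ^ n i * f i 1 - f i 0) \<longlonglongrightarrow> 0"
    by (intro Lim_null_comparison[OF _ d(1)] always_eventually) simp
  from tendsto_add[OF this lim(1)] show "(\<lambda>i. (- 1) ^ n i * f i 1) \<longlonglongrightarrow> a" by simp
  have "\<bar>(- 1) ^ n i * (g i 1 / (real (n i) * pi)) - g i 0 / (real (n i) * pi)\<bar> \<le> \<delta> i" for i
    using d(3)[of 1 i] unfolding sgn by (simp add: sin_npi cos_npi)
  then have "(\<lambda>i. (- 1) ^ n i * (g i 1 / (real (n i) * pi)) - g i 0 / (real (n i) * pi)) \<longlonglongrightarrow> 0"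
    by (intro Lim_null_comparison[OF _ d(1)] always_eventually) simp
  from tendsto_add[OF this lim(2)] show "(\<lambda>i. (- 1) ^ n i * (g i 1 / (real (n i) * pi))) \<longlonglongrightarrow> b" by simp
qed

lemma mode_sequence_continuous_on:
  "mode_sequence q n f g a b \<Longrightarrow> continuous_on {0..1} (f i)"
  unfolding mode_sequence_def using sturm_solution_continuous_on(1) by blast

lemma trig_combination_bound:
  fixes a b t :: real
  shows "\<bar>a * cos t + b * sin t\<bar> \<le> \<bar>a\<bar> + \<bar>b\<bar>"
proof -
  have "\<bar>a * cos t + b * sin t\<bar> \<le> \<bar>a\<bar> * \<bar>cos t\<bar> + \<bar>b\<bar> * \<bar>sin t\<bar>" by (metis abs_mult abs_triangle_ineq)
  also have "\<dots> \<le> \<bar>a\<bar> * 1 + \<bar>b\<bar> * 1" by (intro add_mono mult_left_mono) auto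
  finally show ?thesis by simp
qed

text \<open>Both factors are uniformly close to sinusoids, whose product integrates exactly at the
  frequencies n \<pi>; \<open>E\<close> collects the error. Two potentials appear so that one factor
  can be the unperturbed cosine.\<close>

lemma mode_sequence_product:
  assumes q: "q absolutely_integrable_on {0..1}" and ms: "mode_sequence q n f g a b"
    and r: "r absolutely_integrable_on {0..1}" and ms': "mode_sequence r n h k c d"
  shows "(\<lambda>i. integral {0..1} (\<lambda>x. f i x * h i x)) \<longlonglongrightarrow> (a * c + b * d) / 2"
proof -
  define \<nu> where "\<nu> i = real (n i) * pi" for i
  define m where "m i x = f i 0 * cos (\<nu> i * x) + g i 0 / \<nu> i * sin (\<nu> i * x)" for i x
  define p where "p i x = h i 0 * cos (\<nu> i * x) + k i 0 / \<nu> i * sin (\<nu> i * x)" for i x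
  obtain \<delta> where d: "\<delta> \<longlonglongrightarrow> 0" "\<And>i. 0 \<le> \<delta> i" "\<And>i x. x \<in> {0..1} \<Longrightarrow> \<bar>f i x - m i x\<bar> \<le> \<delta> i"
    using mode_sequence_uniform[OF q ms] unfolding m_def \<nu>_def by auto
  obtain \<eta> where e: "\<eta> \<longlonglongrightarrow> 0" "\<And>i. 0 \<le> \<eta> i" "\<And>i x. x \<in> {0..1} \<Longrightarrow> \<bar>h i x - p i x\<bar> \<le> \<eta> i"
    using mode_sequence_uniform[OF r ms'] unfolding p_def \<nu>_def by auto
  have lim: "(\<lambda>i. f i 0) \<longlonglongrightarrow> a" "(\<lambda>i. g i 0 / \<nu> i) \<longlonglongrightarrow> b" "(\<lambda>i. h i 0) \<longlonglongrightarrow> c" "(\<lambda>i. k i 0 / \<nu> i) \<longlonglongrightarrow> d"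
    using ms ms' by (auto simp: mode_sequence_def \<nu>_def)
  define R where "R i = \<bar>f i 0\<bar> + \<bar>g i 0 / \<nu> i\<bar>" for i
  define R' where "R' i = \<bar>h i 0\<bar> + \<bar>k i 0 / \<nu> i\<bar>" for i
  have R: "R \<longlonglongrightarrow> \<bar>a\<bar> + \<bar>b\<bar>" "R' \<longlonglongrightarrow> \<bar>c\<bar> + \<bar>d\<bar>" unfolding R_def R'_def by (intro tendsto_intros lim)+
  define E where "E i = \<delta> i * (R' i + \<eta> i) + R i * \<eta> i" for i
  have "E \<longlonglongrightarrow> 0 * ((\<bar>c\<bar> + \<bar>d\<bar>) + 0) + (\<bar>a\<bar> + \<bar>b\<bar>) * 0"
    unfolding E_def by (intro tendsto_intros d(1) e(1) R)
  then have E0: "E \<longlonglongrightarrow> 0" by simp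
  have bound: "\<bar>integral {0..1} (\<lambda>x. f i x * h i x) - (f i 0 * h i 0 + g i 0 / \<nu> i * (k i 0 / \<nu> i)) / 2\<bar> \<le> E i" for i
  proof -
    have n1: "1 \<le> n i" using ms by (simp add: mode_sequence_def)
    have mi: "((\<lambda>x. m i x * p i x) has_integral (f i 0 * h i 0 + g i 0 / \<nu> i * (k i 0 / \<nu> i)) / 2) {0..1}"
      unfolding m_def p_def \<nu>_def by (rule mode_product_integral[OF n1])
    have fi: "((\<lambda>x. f i x * h i x) has_integral integral {0..1} (\<lambda>x. f i x * h i x)) {0..1}"
      by (intro integrable_integral integrable_continuous_interval continuous_intros
          mode_sequence_continuous_on[OF ms] mode_sequence_continuous_on[OF ms'])
    have "norm (integral {0..1} (\<lambda>x. f i x * h i x) - (f i 0 * h i 0 + g i 0 / \<nu> i * (k i 0 / \<nu> i)) / 2)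
        \<le> E i * measure lborel (cbox 0 (1::real))"
    proof (rule has_integral_bound)
      show "0 \<le> E i" using d(2)[of i] e(2)[of i] by (simp add: E_def R_def R'_def)
      show "((\<lambda>x. f i x * h i x - m i x * p i x) has_integral
          integral {0..1} (\<lambda>x. f i x * h i x) - (f i 0 * h i 0 + g i 0 / \<nu> i * (k i 0 / \<nu> i)) / 2) (cbox 0 1)"
        using has_integral_diff[OF fi mi] by simp
      fix x :: real assume "x \<in> cbox 0 1"
      then have x: "x \<in> {0..1}" by simp
      have "\<bar>p i x\<bar> \<le> R' i" "\<bar>m i x\<bar> \<le> R i" unfolding p_def m_def R_def R'_def by (rule trig_combination_bound)+
      moreover have "\<bar>h i x\<bar> \<le> \<bar>p i x\<bar> + \<eta> i" using e(3)[OF x, of i] by linarith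
      ultimately have hb: "\<bar>h i x\<bar> \<le> R' i + \<eta> i" and mb: "\<bar>m i x\<bar> \<le> R i" by linarith+
      have "f i x * h i x - m i x * p i x = (f i x - m i x) * h i x + m i x * (h i x - p i x)"
        by (simp add: algebra_simps)
      then have "\<bar>f i x * h i x - m i x * p i x\<bar> \<le> \<bar>f i x - m i x\<bar> * \<bar>h i x\<bar> + \<bar>m i x\<bar> * \<bar>h i x - p i x\<bar>"
        by (metis abs_mult abs_triangle_ineq)
      also have "\<dots> \<le> E i"
        unfolding E_def using d(3)[OF x, of i] hb mb e(3)[OF x, of i] d(2)[of i] by (intro add_mono mult_mono) auto
      finally show "norm (f i x * h i x - m i x * p i x) \<le> E i" by simp
    qed
    then show ?thesis by simp
  qed
  have "(\<lambda>i. integral {0..1} (\<lambda>x. f i x * h i x) - (f i 0 * h i 0 + g i 0 / \<nu> i * (k i 0 / \<nu> i)) / 2) \<longlonglongrightarrow> 0"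
    by (intro Lim_null_comparison[OF _ E0] always_eventually) (use bound in simp)
  moreover have "(\<lambda>i. (f i 0 * h i 0 + g i 0 / \<nu> i * (k i 0 / \<nu> i)) / 2) \<longlonglongrightarrow> (a * c + b * d) / 2"
    by (intro tendsto_intros lim) simp
  ultimately show ?thesis using tendsto_add by fastforce
qed

text \<open>The sinusoid times the cosine is half the cosine amplitude plus terms of doubled
  frequency, which the Riemann-Lebesgue lemma removes against \<open>q\<close>.\<close>

lemma mode_sequence_potential:
  assumes q: "q absolutely_integrable_on {0..1}" and ms: "mode_sequence q n f g a b"
  shows "(\<lambda>i. integral {0..1} (\<lambda>x. q x * (f i x * cos (real (n i) * pi * x)))) \<longlonglongrightarrow> a * integral {0..1} q / 2"
proof -
  define \<nu> where "\<nu> i = real (n i) * pi" for i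
  define m where "m i x = f i 0 * cos (\<nu> i * x) + g i 0 / \<nu> i * sin (\<nu> i * x)" for i x
  obtain \<delta> where d: "\<delta> \<longlonglongrightarrow> 0" "\<And>i. 0 \<le> \<delta> i" "\<And>i x. x \<in> {0..1} \<Longrightarrow> \<bar>f i x - m i x\<bar> \<le> \<delta> i"
    using mode_sequence_uniform[OF q ms] unfolding m_def \<nu>_def by auto
  have lim: "(\<lambda>i. f i 0) \<longlonglongrightarrow> a" "(\<lambda>i. g i 0 / \<nu> i) \<longlonglongrightarrow> b" and ninf: "filterlim n at_top sequentially"
    using ms by (auto simp: mode_sequence_def \<nu>_def)
  have "filterlim (\<lambda>i. 2 * \<nu> i) at_top sequentially"
    unfolding \<nu>_def by (rule filterlim_tendsto_pos_mult_at_top[OF tendsto_const _ frequency_at_top[OF ninf]]) simp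
  note RL = filterlim_compose[OF riemann_lebesgue[OF q] this]
  have qc: "(\<lambda>x. q x * F x) absolutely_integrable_on {0..1}" if "continuous_on {0..1} F" for F
    by (rule absolutely_integrable_mult_continuous[OF that q])
  have qi: "((\<lambda>x. q x * F x) has_integral integral {0..1} (\<lambda>x. q x * F x)) {0..1}" if "continuous_on {0..1} F" for F
    using set_lebesgue_integral_eq_integral(1)[OF qc[OF that]] by (rule integrable_integral)
  have q1: "(q has_integral integral {0..1} q) {0..1}"
    using set_lebesgue_integral_eq_integral(1)[OF q] by (rule integrable_integral)
  have qabs: "((\<lambda>x. \<bar>q x\<bar>) has_integral integral {0..1} (\<lambda>x. \<bar>q x\<bar>)) {0..1}"
    using set_lebesgue_integral_eq_integral(1)[OF set_integrable_abs[OF q]] by (rule integrable_integral)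
  let ?C = "\<lambda>i. integral {0..1} (\<lambda>x. q x * cos (2 * \<nu> i * x + 0))"
  \<comment> \<open>The phase -\<pi>/2 turns this cosine into the sine of 2 \<nu> x.\<close>
  let ?S = "\<lambda>i. integral {0..1} (\<lambda>x. q x * cos (2 * \<nu> i * x + - (pi / 2)))"
  define V where "V i = f i 0 / 2 * integral {0..1} q + f i 0 / 2 * ?C i + g i 0 / \<nu> i / 2 * ?S i" for i
  have mV: "((\<lambda>x. q x * (m i x * cos (\<nu> i * x))) has_integral V i) {0..1}" for i
  proof -
    have "((\<lambda>x. f i 0 / 2 * q x + f i 0 / 2 * (q x * cos (2 * \<nu> i * x + 0))
        + g i 0 / \<nu> i / 2 * (q x * cos (2 * \<nu> i * x + - (pi / 2)))) has_integral V i) {0..1}"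
      unfolding V_def by (intro has_integral_add has_integral_mult_right q1 qi continuous_intros)
    moreover have "f i 0 / 2 * q x + f i 0 / 2 * (q x * cos (2 * \<nu> i * x + 0))
        + g i 0 / \<nu> i / 2 * (q x * cos (2 * \<nu> i * x + - (pi / 2))) = q x * (m i x * cos (\<nu> i * x))" for x
    proof -
      have c2: "cos (2 * \<nu> i * x + 0) = 2 * (cos (\<nu> i * x) * cos (\<nu> i * x)) - 1"
        using cos_double_cos[of "\<nu> i * x"] by (simp add: power2_eq_square mult.assoc)
      have s2: "cos (2 * \<nu> i * x + - (pi / 2)) = 2 * (sin (\<nu> i * x) * cos (\<nu> i * x))"
        using sin_double[of "\<nu> i * x"] by (simp add: cos_diff mult.assoc)
      show ?thesis unfolding c2 s2 m_def by (simp add: algebra_simps)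
    qed
    ultimately show ?thesis by simp
  qed
  have "V \<longlonglongrightarrow> a / 2 * integral {0..1} q + a / 2 * 0 + b / 2 * 0"
    unfolding V_def by (intro tendsto_intros lim RL) simp_all
  then have V: "V \<longlonglongrightarrow> a * integral {0..1} q / 2" by simp
  have fc: "continuous_on {0..1} (\<lambda>x. f i x * cos (\<nu> i * x))" for i
    by (intro continuous_intros mode_sequence_continuous_on[OF ms])
  have bound: "\<bar>integral {0..1} (\<lambda>x. q x * (f i x * cos (\<nu> i * x))) - V i\<bar> \<le> \<delta> i * integral {0..1} (\<lambda>x. \<bar>q x\<bar>)" for i
  proof -
    have dint: "((\<lambda>x. q x * (f i x * cos (\<nu> i * x)) - q x * (m i x * cos (\<nu> i * x))) has_integral
        integral {0..1} (\<lambda>x. q x * (f i x * cos (\<nu> i * x))) - V i) {0..1}"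
      by (intro has_integral_diff qi[OF fc] mV)
    have "norm (integral {0..1} (\<lambda>x. q x * (f i x * cos (\<nu> i * x)) - q x * (m i x * cos (\<nu> i * x))))
        \<le> integral {0..1} (\<lambda>x. \<delta> i * \<bar>q x\<bar>)"
    proof (rule integral_norm_bound_integral)
      show "(\<lambda>x. q x * (f i x * cos (\<nu> i * x)) - q x * (m i x * cos (\<nu> i * x))) integrable_on {0..1}"
        using dint by blast
      show "(\<lambda>x. \<delta> i * \<bar>q x\<bar>) integrable_on {0..1}"
        using has_integral_mult_right[OF qabs] by blast
      fix x :: real assume x: "x \<in> {0..1}"
      have "q x * (f i x * cos (\<nu> i * x)) - q x * (m i x * cos (\<nu> i * x)) = q x * ((f i x - m i x) * cos (\<nu> i * x))"
        by (simp add: algebra_simps)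
      then have "norm (q x * (f i x * cos (\<nu> i * x)) - q x * (m i x * cos (\<nu> i * x)))
          = \<bar>q x\<bar> * (\<bar>f i x - m i x\<bar> * \<bar>cos (\<nu> i * x)\<bar>)" by (simp add: abs_mult)
      also have "\<dots> \<le> \<bar>q x\<bar> * (\<delta> i * 1)"
        using d(3)[OF x, of i] by (intro mult_left_mono mult_mono) auto
      finally show "norm (q x * (f i x * cos (\<nu> i * x)) - q x * (m i x * cos (\<nu> i * x))) \<le> \<delta> i * \<bar>q x\<bar>"
        by (simp add: mult.commute)
    qed
    then show ?thesis using integral_unique[OF dint] by simp
  qed
  have d0: "(\<lambda>i. \<delta> i * integral {0..1} (\<lambda>x. \<bar>q x\<bar>)) \<longlonglongrightarrow> 0"
    using tendsto_mult_right[OF d(1), of "integral {0..1} (\<lambda>x. \<bar>q x\<bar>)"] by simp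
  have "(\<lambda>i. integral {0..1} (\<lambda>x. q x * (f i x * cos (\<nu> i * x))) - V i) \<longlonglongrightarrow> 0"
    by (intro Lim_null_comparison[OF _ d0] always_eventually) (use bound in simp)
  from tendsto_add[OF this V] show ?thesis by (simp add: \<nu>_def)
qed

section \<open>The total potential and the main theorem\<close>

lemma sturm_solution_cos:
  "sturm_solution (\<lambda>_. 0) (\<nu>\<^sup>2) (\<lambda>x. cos (\<nu> * x)) (\<lambda>x. - \<nu> * sin (\<nu> * x))"
  unfolding sturm_solution_def
  by (intro conjI ballI ac_deriv_C1)
    (auto intro!: derivative_eq_intros continuous_intros simp: power2_eq_square)

text \<open>The signs \<open>sg i\<close> make \<open>sg i (tail e) * cos (n i * pi * x)\<close> an unperturbed eigenfunction: its
  value at every vertex \<open>v\<close> is \<open>sg i v\<close>. They are constant for even frequencies and given by the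
  bipartition for odd ones.\<close>

theorem potential_sum_zero:
  fixes G :: "('v, 'e) pre_digraph"
  assumes G: "fin_digraph G" "Digraph_Component.connected G" "card (arcs G) \<ge> 1"
    and q: "\<And>e. e \<in> arcs G \<Longrightarrow> q e absolutely_integrable_on {0..1}"
    and M: "int M = int (card (arcs G)) - int (card (verts G)) + 2"
    and ninf: "filterlim n at_top sequentially"
    and sg1: "\<And>i v. sg i v = 1 \<or> sg i v = (-1::real)"
    and sg2: "\<And>i e. e \<in> arcs G \<Longrightarrow> sg i (head G e) = (- 1) ^ n i * sg i (tail G e)"
    and \<epsilon>: "\<epsilon> \<longlonglongrightarrow> 0"
    and ev: "\<And>i. eigenvalues_within G q (int M) ((real (n i) * pi)\<^sup>2) (\<epsilon> i)"
  shows "(\<Sum>e\<in>arcs G. integral {0..1} (q e)) = 0"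
proof (rule ccontr)
  interpret fin_digraph G by fact
  assume nonzero: "(\<Sum>e\<in>arcs G. integral {0..1} (q e)) \<noteq> 0"
  obtain e0 where e0: "e0 \<in> arcs G" using G(3) by fastforce
  have "\<forall>e. \<exists>N0. e \<in> arcs G \<longrightarrow> (1::nat) \<le> N0 \<and> (\<forall>n l f g. N0 \<le> n \<longrightarrow> \<bar>l - (real n * pi)\<^sup>2\<bar> \<le> 1 \<longrightarrow>
      sturm_solution (q e) l f g \<longrightarrow> (\<bar>f 0\<bar> + \<bar>g 0 / (real n * pi)\<bar>)\<^sup>2 \<le> 16 * integral {0..1} (\<lambda>x. f x * f x))"
  proof
    fix e
    show "\<exists>N0. e \<in> arcs G \<longrightarrow> (1::nat) \<le> N0 \<and> (\<forall>n l f g. N0 \<le> n \<longrightarrow> \<bar>l - (real n * pi)\<^sup>2\<bar> \<le> 1 \<longrightarrow>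
      sturm_solution (q e) l f g \<longrightarrow> (\<bar>f 0\<bar> + \<bar>g 0 / (real n * pi)\<bar>)\<^sup>2 \<le> 16 * integral {0..1} (\<lambda>x. f x * f x))"
    proof (cases "e \<in> arcs G")
      case True
      show ?thesis by (rule mode_norm_bound[OF q[OF True]]) blast
    qed simp
  qed
  from choice[OF this] obtain N0 where N0: "\<And>e. e \<in> arcs G \<Longrightarrow> 1 \<le> N0 e"
    "\<And>e n l f g. e \<in> arcs G \<Longrightarrow> N0 e \<le> n \<Longrightarrow> \<bar>l - (real n * pi)\<^sup>2\<bar> \<le> 1 \<Longrightarrow> sturm_solution (q e) l f g \<Longrightarrow>
      (\<bar>f 0\<bar> + \<bar>g 0 / (real n * pi)\<bar>)\<^sup>2 \<le> 16 * integral {0..1} (\<lambda>x. f x * f x)"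
    by blast
  define N where "N = (\<Sum>e\<in>arcs G. N0 e)"
  have N: "N0 e \<le> N" if "e \<in> arcs G" for e
    unfolding N_def using that by (intro member_le_sum) auto
  have "\<forall>\<^sub>F i in sequentially. N \<le> n i" using ninf by (simp add: filterlim_at_top)
  moreover have "\<forall>\<^sub>F i in sequentially. \<epsilon> i < 1" using order_tendstoD(2)[OF \<epsilon>, of 1] by simp
  ultimately have "\<forall>\<^sub>F i in sequentially. N \<le> n i \<and> \<epsilon> i < 1" by (rule eventually_conj)
  then obtain T where T: "\<And>i. T \<le> i \<Longrightarrow> N \<le> n i \<and> \<epsilon> i < 1" by (auto simp: eventually_sequentially)
  \<comment> \<open>Dropping an initial segment makes the amplitude bound and the distance at most 1
    from the squared frequency hold for every index.\<close>
  define k where "k i = n (i + T)" for i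
  define \<nu> where "\<nu> i = real (k i) * pi" for i
  define X where "X i = sg (i + T)" for i
  have kN: "N0 e \<le> k i" "1 \<le> k i" if "e \<in> arcs G" for e i
    using T[of "i + T"] N[OF that] N0(1)[OF that] by (auto simp: k_def)
  have X2: "X i v * X i v = 1" for i v using sg1[of "i + T" v] by (auto simp: X_def)
  have Xh: "X i (head G e) = (- 1) ^ k i * X i (tail G e)" if "e \<in> arcs G" for i e
    unfolding X_def k_def by (rule sg2[OF that])
  have "\<forall>i. \<exists>p. (\<forall>j<M. \<bar>snd p j - (\<nu> i)\<^sup>2\<bar> \<le> \<epsilon> (i + T) \<and> fst p j \<in> eigenspace G q (snd p j)) \<and>
    (\<forall>j<M. \<forall>m<M. graph_inner G (fst p j) (fst p m) = (if j = m then 1 else 0))"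
  proof
    fix i
    from eigenvalues_within_orthonormal[OF G(1) ev[of "i + T"]] obtain Y L where
      "\<forall>j<M. \<bar>L j - (\<nu> i)\<^sup>2\<bar> \<le> \<epsilon> (i + T) \<and> Y j \<in> eigenspace G q (L j)"
      "\<forall>j<M. \<forall>m<M. graph_inner G (Y j) (Y m) = (if j = m then 1 else 0)"
      unfolding \<nu>_def k_def by blast
    then show "\<exists>p. (\<forall>j<M. \<bar>snd p j - (\<nu> i)\<^sup>2\<bar> \<le> \<epsilon> (i + T) \<and> fst p j \<in> eigenspace G q (snd p j)) \<and>
      (\<forall>j<M. \<forall>m<M. graph_inner G (fst p j) (fst p m) = (if j = m then 1 else 0))"
      by (intro exI[of _ "(Y, L)"]) simp
  qed
  from choice[OF this] obtain p where p:
    "\<And>i. (\<forall>j<M. \<bar>snd (p i) j - (\<nu> i)\<^sup>2\<bar> \<le> \<epsilon> (i + T) \<and> fst (p i) j \<in> eigenspace G q (snd (p i) j)) \<and>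
    (\<forall>j<M. \<forall>m<M. graph_inner G (fst (p i) j) (fst (p i) m) = (if j = m then 1 else 0))"
    by blast
  define Y where "Y i = fst (p i)" for i
  define L where "L i = snd (p i)" for i
  have L: "\<bar>L i j - (\<nu> i)\<^sup>2\<bar> \<le> \<epsilon> (i + T)" and Y: "Y i j \<in> eigenspace G q (L i j)" if "j < M" for i j
    using p[of i] that by (simp_all add: L_def Y_def)
  have L1: "\<bar>L i j - (\<nu> i)\<^sup>2\<bar> \<le> 1" if "j < M" for i j
    using L[OF that, of i] T[of "i + T"] by simp
  have orthY: "graph_inner G (Y i j) (Y i m) = (if j = m then 1 else 0)" if "j < M" "m < M" for i j m
    using p[of i] that by (simp add: Y_def)
  let ?Y' = "\<lambda>i j e. edge_deriv (Y i j e)"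
  \<comment> \<open>The sign at the tail converts the vertex pattern of the unperturbed cosine into
    the constant 1, so that limits at different vertices can be compared; as it squares to 1, the
    L^2 products do not change.\<close>
  define f where "f i j e x = X i (tail G e) * Y i j e x" for i j e x
  define g where "g i j e x = X i (tail G e) * ?Y' i j e x" for i j e x
  have sol: "sturm_solution (q e) (L i j) (f i j e) (g i j e)" if "j < M" "e \<in> arcs G" for i j e
  proof -
    note E = eigenspaceD(3)[OF Y[OF that(1), of i] that(2)]
    show ?thesis
      using sturm_solution_lincomb[OF E E, of "X i (tail G e)" 0]
      unfolding f_def[abs_def] g_def[abs_def] by simp
  qed
  have ff: "f i j e x * f i m e x = Y i j e x * Y i m e x" for i j m e x
  proof -
    have "f i j e x * f i m e x = (X i (tail G e) * X i (tail G e)) * (Y i j e x * Y i m e x)"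
      by (simp add: f_def ac_simps)
    then show ?thesis by (simp add: X2)
  qed
  have small: "\<bar>f i j e 0\<bar> + \<bar>g i j e 0 / \<nu> i\<bar> \<le> 4" if j: "j < M" and e: "e \<in> arcs G" for i j e
  proof -
    have "(\<bar>f i j e 0\<bar> + \<bar>g i j e 0 / \<nu> i\<bar>)\<^sup>2 \<le> 16 * integral {0..1} (\<lambda>x. f i j e x * f i j e x)"
      unfolding \<nu>_def by (rule N0(2)[OF e kN(1)[OF e] _ sol[OF j e]]) (use L1[OF j] in \<open>simp add: \<nu>_def\<close>)
    also have "integral {0..1} (\<lambda>x. f i j e x * f i j e x) \<le> graph_inner G (Y i j) (Y i j)"
      unfolding ff graph_inner_def
    proof (rule member_le_sum[OF e])
      fix e' assume e': "e' \<in> arcs G - {e}"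
      show "0 \<le> integral {0..1} (\<lambda>x. Y i j e' x * Y i j e' x)"
        by (rule integral_nonneg)
          (use e' in \<open>auto intro!: integrable_continuous_interval continuous_intros eigenspace_continuous_on[OF Y[OF j]]\<close>)
    qed simp
    also have "graph_inner G (Y i j) (Y i j) = 1" using orthY[OF j j] by simp
    finally have "(\<bar>f i j e 0\<bar> + \<bar>g i j e 0 / \<nu> i\<bar>)\<^sup>2 \<le> 4\<^sup>2" by simp
    then show ?thesis by (rule power2_le_imp_le) simp
  qed
  \<comment> \<open>Both amplitudes of all eigenfunctions on all edges form one finite family, so a
    single subsequence serves them all.\<close>
  define F where "F = (\<lambda>(j, e, t) i. if t then f i j e 0 else g i j e 0 / \<nu> i)"
  define I where "I = {..<M} \<times> arcs G \<times> (UNIV :: bool set)"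
  have "\<exists>s lim. strict_mono (s :: nat \<Rightarrow> nat) \<and> (\<forall>z\<in>I. (\<lambda>i. F z (s i)) \<longlonglongrightarrow> lim z)"
  proof (rule finite_family_convergent_subseq)
    show "finite I" by (simp add: I_def)
    show "\<bar>F z i\<bar> \<le> 4" if z: "z \<in> I" for z i
    proof -
      obtain j e t where "z = (j, e, t)" "j < M" "e \<in> arcs G" using z by (auto simp: I_def)
      moreover from this have "\<bar>f i j e 0\<bar> \<le> 4" "\<bar>g i j e 0 / \<nu> i\<bar> \<le> 4"
        using small[of j e i] by linarith+
      ultimately show ?thesis by (simp add: F_def)
    qed
  qed
  then obtain s lim where s: "strict_mono (s :: nat \<Rightarrow> nat)" "\<And>z. z \<in> I \<Longrightarrow> (\<lambda>i. F z (s i)) \<longlonglongrightarrow> lim z"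
    by blast
  define a where "a j e = lim (j, e, True)" for j e
  define b where "b j e = lim (j, e, False)" for j e
  have fa: "(\<lambda>i. f (s i) j e 0) \<longlonglongrightarrow> a j e" and gb: "(\<lambda>i. g (s i) j e 0 / \<nu> (s i)) \<longlonglongrightarrow> b j e"
    if "j < M" "e \<in> arcs G" for j e
    using s(2)[of "(j, e, True)"] s(2)[of "(j, e, False)"] that by (auto simp: F_def I_def a_def b_def)
  have kinf: "filterlim (\<lambda>i. k (s i)) at_top sequentially"
  proof -
    have "filterlim (\<lambda>i. i + T) at_top sequentially"
      by (rule filterlim_at_top_mono[OF filterlim_ident]) (auto intro: always_eventually)
    then have "filterlim k at_top sequentially"
      unfolding k_def by (rule filterlim_compose[OF ninf])
    then show ?thesis by (rule filterlim_compose[OF _ filterlim_subseq[OF s(1)]])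
  qed
  have ms: "mode_sequence (q e) (\<lambda>i. k (s i)) (\<lambda>i. f (s i) j e) (\<lambda>i. g (s i) j e) (a j e) (b j e)"
    if "j < M" "e \<in> arcs G" for j e
    unfolding mode_sequence_def
    using kN(2)[OF that(2)] L1[OF that(1)] sol[OF that] kinf fa[OF that] gb[OF that] unfolding \<nu>_def by blast
  have orth: "(\<Sum>e\<in>arcs G. (a j e * a m e + b j e * b m e) / 2) = (if j = m then 1 else 0)"
    if j: "j < M" and m: "m < M" for j m
  proof -
    have "(\<lambda>i. \<Sum>e\<in>arcs G. integral {0..1} (\<lambda>x. f (s i) j e x * f (s i) m e x))
        \<longlonglongrightarrow> (\<Sum>e\<in>arcs G. (a j e * a m e + b j e * b m e) / 2)"
      by (intro tendsto_sum mode_sequence_product[OF q ms[OF j] q ms[OF m]])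
    moreover have "(\<Sum>e\<in>arcs G. integral {0..1} (\<lambda>x. f (s i) j e x * f (s i) m e x)) = (if j = m then 1 else 0)" for i
      unfolding ff using orthY[OF j m] by (simp add: graph_inner_def)
    ultimately show ?thesis by (simp add: LIMSEQ_const_iff)
  qed
  \<comment> \<open>The Kirchhoff condition divided by the frequency; the signs at tail and head
    combine to \<open>(- 1) ^ k i\<close>, which the limit at the far end absorbs.\<close>
  have circ: "(\<Sum>e\<in>out_arcs G v. b j e) = (\<Sum>e\<in>in_arcs G v. b j e)" if j: "j < M" and v: "v \<in> verts G" for j v
  proof -
    have eq: "(\<Sum>e\<in>out_arcs G v. g i j e 0 / \<nu> i) = (\<Sum>e\<in>in_arcs G v. (- 1) ^ k i * (g i j e 1 / \<nu> i))" for i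
    proof -
      have "(\<Sum>e\<in>out_arcs G v. g i j e 0 / \<nu> i) = X i v / \<nu> i * (\<Sum>e\<in>out_arcs G v. ?Y' i j e 0)"
        unfolding sum_distrib_left by (rule sum.cong) (auto simp: g_def)
      also have "\<dots> = X i v / \<nu> i * (\<Sum>e\<in>in_arcs G v. ?Y' i j e 1)"
        using eigenspaceD(2)[OF Y[OF j]] v by (simp add: standard_matching_def)
      also have "\<dots> = (\<Sum>e\<in>in_arcs G v. (- 1) ^ k i * (g i j e 1 / \<nu> i))"
        unfolding sum_distrib_left by (rule sum.cong) (use Xh in \<open>auto simp: g_def\<close>)
      finally show ?thesis .
    qed
    have "(\<lambda>i. \<Sum>e\<in>out_arcs G v. g (s i) j e 0 / \<nu> (s i)) \<longlonglongrightarrow> (\<Sum>e\<in>out_arcs G v. b j e)"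
      by (intro tendsto_sum gb[OF j]) auto
    moreover have "(\<lambda>i. \<Sum>e\<in>in_arcs G v. (- 1) ^ k (s i) * (g (s i) j e 1 / \<nu> (s i))) \<longlonglongrightarrow> (\<Sum>e\<in>in_arcs G v. b j e)"
      unfolding \<nu>_def by (intro tendsto_sum mode_sequence_endpoint(2)[OF q ms[OF j]]) auto
    ultimately show ?thesis unfolding eq by (rule LIMSEQ_unique)
  qed
  have const: "a j e = a j e0" if j: "j < M" and e: "e \<in> arcs G" for j e
  proof -
    have "\<forall>i. \<exists>P. \<forall>e\<in>arcs G. Y i j e 0 = P (tail G e) \<and> Y i j e 1 = P (head G e)"
    proof
      fix i
      show "\<exists>P. \<forall>e\<in>arcs G. Y i j e 0 = P (tail G e) \<and> Y i j e 1 = P (head G e)"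
        by (rule standard_matching_vertex_values[OF G(1) eigenspaceD(2)[OF Y[OF j, of i]]]) blast
    qed
    from choice[OF this] obtain P where
      P: "\<And>i e. e \<in> arcs G \<Longrightarrow> Y i j e 0 = P i (tail G e) \<and> Y i j e 1 = P i (head G e)" by blast
    \<comment> \<open>This limit depends on the vertex alone, and at either end of an arc it equals
      the cosine amplitude of that arc; thus the amplitudes agree across vertices.\<close>
    define \<xi> where "\<xi> v = Topological_Spaces.lim (\<lambda>i. X (s i) v * P (s i) v)" for v
    have \<xi>: "\<xi> (tail G e) = a j e \<and> \<xi> (head G e) = a j e" if e: "e \<in> arcs G" for e
    proof
      have "(\<lambda>i. X (s i) (tail G e) * P (s i) (tail G e)) \<longlonglongrightarrow> a j e"
        using fa[OF j e] P[OF e] by (simp add: f_def)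
      then show "\<xi> (tail G e) = a j e" unfolding \<xi>_def by (rule limI)
      have "(- 1) ^ k i * f i j e 1 = X i (head G e) * P i (head G e)" for i
        using P[OF e] Xh[OF e] by (simp add: f_def)
      then have "(\<lambda>i. X (s i) (head G e) * P (s i) (head G e)) \<longlonglongrightarrow> a j e"
        using mode_sequence_endpoint(1)[OF q[OF e] ms[OF j e]] by simp
      then show "\<xi> (head G e) = a j e" unfolding \<xi>_def by (rule limI)
    qed
    have "\<xi> (tail G e) = \<xi> (tail G e0)"
      by (rule connected_propagate[OF G(2)]) (use \<xi> e e0 in auto)
    then show ?thesis using \<xi>[OF e] \<xi>[OF e0] by simp
  qed
  \<comment> \<open>Lagrange's identity with the cosine: its derivative vanishes at both ends since
    sin(\<nu>) = 0, and its signed end values form the vertex function \<open>X i\<close>, to which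
    the weak Kirchhoff condition applies.\<close>
  have green: "(\<Sum>e\<in>arcs G. integral {0..1} (\<lambda>x. q e x * (f i j e x * cos (\<nu> i * x))))
      = (L i j - (\<nu> i)\<^sup>2) * (\<Sum>e\<in>arcs G. integral {0..1} (\<lambda>x. f i j e x * cos (\<nu> i * x)))" if j: "j < M" for i j
  proof -
    have "integral {0..1} (\<lambda>x. q e x * (f i j e x * cos (\<nu> i * x)))
          - (L i j - (\<nu> i)\<^sup>2) * integral {0..1} (\<lambda>x. f i j e x * cos (\<nu> i * x))
        = X i (head G e) * ?Y' i j e 1 - X i (tail G e) * ?Y' i j e 0" if e: "e \<in> arcs G" for e
    proof -
      have c: "continuous_on {0..1} (\<lambda>x. f i j e x * cos (\<nu> i * x))"
        by (intro continuous_intros sturm_solution_continuous_on(1)[OF sol[OF j e]])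
      have "((\<lambda>x. ((q e x - L i j) - (0 - (\<nu> i)\<^sup>2)) * (f i j e x * cos (\<nu> i * x))) has_integral
          (g i j e 1 * cos (\<nu> i * 1) - f i j e 1 * (- \<nu> i * sin (\<nu> i * 1)))
          - (g i j e 0 * cos (\<nu> i * 0) - f i j e 0 * (- \<nu> i * sin (\<nu> i * 0)))) {0..1}"
        by (rule ac_deriv_has_integral[OF sturm_solution_lagrange[OF sol[OF j e] sturm_solution_cos]]) auto
      moreover have "((\<lambda>x. q e x * (f i j e x * cos (\<nu> i * x)) - (L i j - (\<nu> i)\<^sup>2) * (f i j e x * cos (\<nu> i * x))) has_integral
          integral {0..1} (\<lambda>x. q e x * (f i j e x * cos (\<nu> i * x)))
          - (L i j - (\<nu> i)\<^sup>2) * integral {0..1} (\<lambda>x. f i j e x * cos (\<nu> i * x))) {0..1}"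
        by (intro has_integral_diff has_integral_mult_right integrable_integral integrable_continuous_interval c
          set_lebesgue_integral_eq_integral(1)[OF absolutely_integrable_mult_continuous[OF c q[OF e]]])
      moreover have "(\<lambda>x. ((q e x - L i j) - (0 - (\<nu> i)\<^sup>2)) * (f i j e x * cos (\<nu> i * x)))
          = (\<lambda>x. q e x * (f i j e x * cos (\<nu> i * x)) - (L i j - (\<nu> i)\<^sup>2) * (f i j e x * cos (\<nu> i * x)))"
        by (rule ext) (simp add: algebra_simps)
      ultimately have "integral {0..1} (\<lambda>x. q e x * (f i j e x * cos (\<nu> i * x)))
          - (L i j - (\<nu> i)\<^sup>2) * integral {0..1} (\<lambda>x. f i j e x * cos (\<nu> i * x))
        = (g i j e 1 * cos (\<nu> i * 1) - f i j e 1 * (- \<nu> i * sin (\<nu> i * 1)))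
          - (g i j e 0 * cos (\<nu> i * 0) - f i j e 0 * (- \<nu> i * sin (\<nu> i * 0)))"
        by (simp only:) (rule has_integral_unique)
      also have "\<dots> = X i (head G e) * ?Y' i j e 1 - X i (tail G e) * ?Y' i j e 0"
        by (simp add: \<nu>_def sin_npi cos_npi g_def Xh[OF e])
      finally show ?thesis .
    qed
    then have "(\<Sum>e\<in>arcs G. integral {0..1} (\<lambda>x. q e x * (f i j e x * cos (\<nu> i * x)))
          - (L i j - (\<nu> i)\<^sup>2) * integral {0..1} (\<lambda>x. f i j e x * cos (\<nu> i * x)))
        = (\<Sum>e\<in>arcs G. ?Y' i j e 1 * X i (head G e) - ?Y' i j e 0 * X i (tail G e))"
      by (intro sum.cong refl) (simp add: mult.commute)
    also have "\<dots> = 0" by (rule standard_matching_kirchhoff[OF G(1) eigenspaceD(2)[OF Y[OF j]]])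
    finally show ?thesis by (simp add: sum_subtractf sum_distrib_left)
  qed
  \<comment> \<open>Here the o(1) rate enters: the factor \<open>L i j - (\<nu> i)\<^sup>2\<close>
    tends to 0 against a convergent sum, so the limit of the potential terms, the common amplitude
    over 2 times the total potential, is 0.\<close>
  have a0: "a j e = 0" if j: "j < M" and e: "e \<in> arcs G" for j e
  proof -
    have cms: "mode_sequence (\<lambda>_. 0) (\<lambda>i. k (s i)) (\<lambda>i x. cos (\<nu> (s i) * x)) (\<lambda>i x. - \<nu> (s i) * sin (\<nu> (s i) * x)) 1 0"
      unfolding mode_sequence_def
    proof (intro conjI allI)
      show "\<exists>l. \<bar>l - (real (k (s i)) * pi)\<^sup>2\<bar> \<le> 1 \<and>
        sturm_solution (\<lambda>_. 0) l (\<lambda>x. cos (\<nu> (s i) * x)) (\<lambda>x. - \<nu> (s i) * sin (\<nu> (s i) * x))" for i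
        by (rule exI[of _ "(\<nu> (s i))\<^sup>2"]) (use sturm_solution_cos in \<open>simp add: \<nu>_def\<close>)
    qed (use kinf kN(2)[OF e0] in auto)
    have "(\<lambda>i. \<Sum>e\<in>arcs G. integral {0..1} (\<lambda>x. f (s i) j e x * cos (\<nu> (s i) * x)))
        \<longlonglongrightarrow> (\<Sum>e\<in>arcs G. (a j e * 1 + b j e * 0) / 2)"
      by (intro tendsto_sum mode_sequence_product[OF q ms[OF j] _ cms]) auto
    moreover have "(\<lambda>i. L (s i) j - (\<nu> (s i))\<^sup>2) \<longlonglongrightarrow> 0"
    proof (rule Lim_null_comparison)
      show "\<forall>\<^sub>F i in sequentially. norm (L (s i) j - (\<nu> (s i))\<^sup>2) \<le> \<epsilon> (s i + T)" using L[OF j] by simp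
      show "(\<lambda>i. \<epsilon> (s i + T)) \<longlonglongrightarrow> 0"
        using LIMSEQ_subseq_LIMSEQ[OF LIMSEQ_ignore_initial_segment[OF \<epsilon>, of T] s(1)] by (simp add: o_def)
    qed
    ultimately have "(\<lambda>i. (L (s i) j - (\<nu> (s i))\<^sup>2) * (\<Sum>e\<in>arcs G. integral {0..1} (\<lambda>x. f (s i) j e x * cos (\<nu> (s i) * x))))
        \<longlonglongrightarrow> 0 * (\<Sum>e\<in>arcs G. (a j e * 1 + b j e * 0) / 2)"
      by (intro tendsto_mult)
    moreover have "(\<lambda>i. \<Sum>e\<in>arcs G. integral {0..1} (\<lambda>x. q e x * (f (s i) j e x * cos (\<nu> (s i) * x))))
        \<longlonglongrightarrow> (\<Sum>e\<in>arcs G. a j e * integral {0..1} (q e) / 2)"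
      unfolding \<nu>_def by (intro tendsto_sum mode_sequence_potential[OF q ms[OF j]])
    ultimately have "(\<Sum>e\<in>arcs G. a j e * integral {0..1} (q e) / 2) = 0"
      unfolding green[OF j] using LIMSEQ_unique by fastforce
    moreover have "(\<Sum>e\<in>arcs G. a j e * integral {0..1} (q e) / 2) = a j e0 / 2 * (\<Sum>e\<in>arcs G. integral {0..1} (q e))"
      unfolding sum_distrib_left by (rule sum.cong) (use const[OF j] in auto)
    ultimately have "a j e0 = 0" using nonzero by simp
    then show ?thesis using const[OF j e] by simp
  qed
  \<comment> \<open>Without cosine parts the limiting L^2 product is half the sum over the arcs, so
    the circulations are orthogonal with squared norm 2.\<close>
  have "(\<Sum>e\<in>arcs G. b j e * b m e) = (if j = m then 2 else 0)" if j: "j < M" and m: "m < M" for j m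
  proof -
    have "(\<Sum>e\<in>arcs G. b j e * b m e) = 2 * (\<Sum>e\<in>arcs G. (a j e * a m e + b j e * b m e) / 2)"
      unfolding sum_distrib_left by (rule sum.cong) (use a0[OF j] in auto)
    then show ?thesis using orth[OF j m] by simp
  qed
  from orthogonal_circulations_bound[OF G(1,2) M circ this] show False by simp
qed

text \<open>With more than |E| + 1 vertices, the requirements of equal values along every arc and
  value 0 at \<open>v0\<close> would admit a nonzero vertex function, which connectedness forbids.
  Hence |E| - |V| + 2 is at least 1.\<close>

lemma connected_card_verts:
  assumes "fin_digraph G" "Digraph_Component.connected G"
  shows "card (verts G) \<le> card (arcs G) + 1"
proof (rule ccontr)
  interpret fin_digraph G by fact
  assume gt: "\<not> ?thesis"
  then have "verts G \<noteq> {}" by auto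
  then obtain v0 where v0: "v0 \<in> verts G" by blast
  define A where "A z v = (case z of None \<Rightarrow> if v = v0 then 1 else (0::real)
    | Some e \<Rightarrow> (if v = head G e then 1 else 0) - (if v = tail G e then 1 else 0))" for z v
  have "card (insert None (Some ` arcs G)) < card (verts G)" using gt by (simp add: card_image)
  from underdetermined_system[OF _ finite_verts this, of A]
  obtain x where x: "\<exists>v\<in>verts G. x v \<noteq> 0"
    "\<forall>z\<in>insert None (Some ` arcs G). (\<Sum>v\<in>verts G. A z v * x v) = 0" by auto
  have "(\<Sum>v\<in>verts G. A None v * x v) = (\<Sum>v\<in>verts G. if v = v0 then x v else 0)"
    by (rule sum.cong) (auto simp: A_def)
  then have x0: "x v0 = 0" using x(2) v0 by simp
  have "x (head G e) = x (tail G e)" if e: "e \<in> arcs G" for e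
  proof -
    have "(\<Sum>v\<in>verts G. A (Some e) v * x v)
        = (\<Sum>v\<in>verts G. (if v = head G e then x v else 0) - (if v = tail G e then x v else 0))"
      by (rule sum.cong) (auto simp: A_def)
    also have "\<dots> = x (head G e) - x (tail G e)" unfolding sum_subtractf using e by simp
    finally show ?thesis using x(2) e by simp
  qed
  then have "x v = x v0" if "v \<in> verts G" for v
    using connected_propagate[OF assms(2), of x v v0] that v0 by simp
  then show False using x(1) x0 by simp
qed

text \<open>Enumerating the infinite index set in increasing order turns convergence along
  \<open>K\<close> into convergence of an ordinary sequence.\<close>

lemma infinitely_often_eigenvalues_nearD:
  assumes "infinitely_often_eigenvalues_near G q m \<mu>"
  obtains r \<epsilon> where "strict_mono (r :: nat \<Rightarrow> nat)" "\<epsilon> \<longlonglongrightarrow> 0" "\<And>i. eigenvalues_within G q m (\<mu> (r i)) (\<epsilon> i)"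
proof -
  obtain K \<epsilon> where K: "infinite K" "(\<epsilon> \<longlongrightarrow> 0) (inf sequentially (principal K))"
    "\<And>k. k \<in> K \<Longrightarrow> eigenvalues_within G q m (\<mu> k) (\<epsilon> k)"
    using assms unfolding infinitely_often_eigenvalues_near_def by blast
  have mono: "strict_mono (enumerate K)" using K(1) by (rule strict_mono_enumerate)
  have mem: "enumerate K i \<in> K" for i using K(1) by (rule enumerate_in_set)
  have "filterlim (enumerate K) (inf sequentially (principal K)) sequentially"
    unfolding filterlim_inf filterlim_principal using filterlim_subseq[OF mono] mem by simp
  from filterlim_compose[OF K(2) this] show thesis
    by (rule that[OF mono _ K(3)[OF mem]])
qed

theorem theorem1p2:
  fixes G :: "('v, 'e) pre_digraph"
    and q :: "'e \<Rightarrow> real \<Rightarrow> real"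
  assumes "fin_digraph G"
    and "Digraph_Component.connected G"
    and "card (arcs G) \<ge> 1"
    and "\<And>e. e \<in> arcs G \<Longrightarrow> q e absolutely_integrable_on {0<..<1}"
  shows
    "(is_smallest_eigenvalue G q 0 \<and>
      infinitely_often_eigenvalues_near G q
        (int (card (arcs G)) - int (card (verts G)) + 2) (\<lambda>k. (2 * real k * pi)\<^sup>2) \<longrightarrow>
      (\<forall>e\<in>arcs G. AE x in lebesgue. x \<in> {0<..<1} \<longrightarrow> q e x = 0)) \<and>
     (bipartite_digraph G \<and> is_smallest_eigenvalue G q 0 \<and>
      infinitely_often_eigenvalues_near G q
        (int (card (arcs G)) - int (card (verts G)) + 2) (\<lambda>k. (real k * pi)\<^sup>2) \<longrightarrow>
      (\<forall>e\<in>arcs G. AE x in lebesgue. x \<in> {0<..<1} \<longrightarrow> q e x = 0))"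
proof -
  note G = assms(1-3)
  have q: "q e absolutely_integrable_on {0..1}" if "e \<in> arcs G" for e
    using assms(4)[OF that] by (simp add: absolutely_integrable_on_Icc_iff_Ioo)
  \<comment> \<open>\<open>nat\<close> truncates nothing here, since a connected graph has at most
    |E| + 1 vertices.\<close>
  define M where "M = nat (int (card (arcs G)) - int (card (verts G)) + 2)"
  have M: "int M = int (card (arcs G)) - int (card (verts G)) + 2"
    using connected_card_verts[OF G(1,2)] by (simp add: M_def)
  have concl: "\<forall>e\<in>arcs G. AE x in lebesgue. x \<in> {0<..<1} \<longrightarrow> q e x = 0"
    if small: "is_smallest_eigenvalue G q 0" and sum: "(\<Sum>e\<in>arcs G. integral {0..1} (q e)) = 0"
  proof (rule nonnegative_smallest_eigenvalue[OF G q])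
    show "0 \<le> \<mu>" if "is_eigenvalue G q \<mu>" for \<mu>
      using small that by (simp add: is_smallest_eigenvalue_def)
  qed (use sum in auto)
  show ?thesis
  proof (intro conjI impI; elim conjE)
    assume small: "is_smallest_eigenvalue G q 0" and near: "infinitely_often_eigenvalues_near G q
        (int (card (arcs G)) - int (card (verts G)) + 2) (\<lambda>k. (2 * real k * pi)\<^sup>2)"
    obtain r \<epsilon> where r: "strict_mono (r :: nat \<Rightarrow> nat)" "\<epsilon> \<longlonglongrightarrow> 0"
      "\<And>i. eigenvalues_within G q (int M) ((2 * real (r i) * pi)\<^sup>2) (\<epsilon> i)"
      using infinitely_often_eigenvalues_nearD[OF near[folded M]] by blast
    have "(\<Sum>e\<in>arcs G. integral {0..1} (q e)) = 0"
    proof (rule potential_sum_zero[OF G q M, where n = "\<lambda>i. 2 * r i" and sg = "\<lambda>_ _. 1" and \<epsilon> = \<epsilon>])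
      show "filterlim (\<lambda>i. 2 * r i) at_top sequentially"
        by (rule filterlim_at_top_mono[OF filterlim_subseq[OF r(1)]]) auto
    qed (use r in auto)
    then show "\<forall>e\<in>arcs G. AE x in lebesgue. x \<in> {0<..<1} \<longrightarrow> q e x = 0" by (rule concl[OF small])
  next
    assume bip: "bipartite_digraph G" and small: "is_smallest_eigenvalue G q 0"
      and near: "infinitely_often_eigenvalues_near G q
        (int (card (arcs G)) - int (card (verts G)) + 2) (\<lambda>k. (real k * pi)\<^sup>2)"
    obtain r \<epsilon> where r: "strict_mono (r :: nat \<Rightarrow> nat)" "\<epsilon> \<longlonglongrightarrow> 0"
      "\<And>i. eigenvalues_within G q (int M) ((real (r i) * pi)\<^sup>2) (\<epsilon> i)"
      using infinitely_often_eigenvalues_nearD[OF near[folded M]] by blast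
    obtain A B where "verts G = A \<union> B" and AB: "A \<inter> B = {}"
      "\<forall>e\<in>arcs G. (tail G e \<in> A \<and> head G e \<in> B) \<or> (tail G e \<in> B \<and> head G e \<in> A)"
      using bip unfolding bipartite_digraph_def by (elim exE conjE) (rule that)
    have "(\<Sum>e\<in>arcs G. integral {0..1} (q e)) = 0"
    proof (rule potential_sum_zero[OF G q M, where n = r and \<epsilon> = \<epsilon>
          and sg = "\<lambda>i v. if even (r i) \<or> v \<in> A then 1 else - 1"])
      show "filterlim r at_top sequentially" by (rule filterlim_subseq[OF r(1)])
      fix i e assume "e \<in> arcs G"
      with AB(2) have "(tail G e \<in> A \<and> head G e \<in> B) \<or> (tail G e \<in> B \<and> head G e \<in> A)" by (rule bspec)
      with AB(1) have "head G e \<in> A \<longleftrightarrow> tail G e \<notin> A" by blast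
      then show "(if even (r i) \<or> head G e \<in> A then 1 else - 1)
          = (- 1) ^ r i * (if even (r i) \<or> tail G e \<in> A then 1 else - 1 :: real)"
        by (cases "even (r i)") simp_all
    qed (use r in simp_all)
    then show "\<forall>e\<in>arcs G. AE x in lebesgue. x \<in> {0<..<1} \<longrightarrow> q e x = 0" by (rule concl[OF small])
  qed
qed

end
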